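(* Consider the $d$-dimensional integrator reach set $\mathcal{R}(\{\bm{x}_0\},t)$ (defined in the context) resulting from the singleton initial set $\{\bm{x}_0\}$ and the input set $\mathcal{U}=[\alpha_1,\beta_1]\times\dots\times[\alpha_m,\beta_m]$ with $\alpha_j<\beta_j$. Let $\mathcal{R}_1,\dots,\mathcal{R}_m$ be the corresponding single-input integrator reach sets, so that $\mathcal{R}=\mathcal{R}_1\times\dots\times\mathcal{R}_m$. Let $\bm{r}=(r_1,\dots,r_m)^{\top}\in\mathbb{N}^m$ be the relative degree vector, and let $\bm{x}_0\in\mathbb{R}^d$ comprise the subvectors $\bm{x}_{j0}\in\mathbb{R}^{r_j}$, $j=1,\dots,m$. Let $\delta_j:=\lfloor\frac{r_j-1}{2}\rfloor$ and $$\rho^{\pm}_{j,k}:=\frac{(r_j-k+1)!}{2\mu_j}\left\{\bm{x}^{\mathrm{bdy}}_j(k)-\sum_{\ell=1}^{r_j}\mathbf{1}_{k\le\ell}\frac{t^{\ell-k}}{(\ell-k)!}\bm{x}_{j0}(\ell)\right\}-\frac12\left\{\pm(-1)^{r_j-1}t^{r_j-k+1}+\frac{\nu_j}{\mu_j}t^{r_j-k+1}\right\}.$$ The algebraic hypersurfaces $p_j^{\mathrm{upper}},p_j^{\mathrm{lower}}\in\mathbb{R}[x_1,\dots,x_{r_j}]$ bounding $\mathcal{R}_j(\{\bm{x}_0\},t)$ have degree $(\delta_j+1)(r_j-\delta_j)$, and are given by the following vanishing Hankel determinant: $$\det\left[A^{\pm}_j(r_j-2\delta_j+a+b)\right]_{a,b=0}^{\delta_j}=0,$$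 where the $A^{\pm}_j$'s are obtained from $$\sum_{k\ge 0}A^{\pm}_j(k)\,\tau^k=\exp\left(-\sum_{k=1}^{r_j}\frac{\lambda^{\pm}_j(k)}{k}\tau^k\right),$$ and $\lambda^{\pm}_j(k):=\rho^{\pm}_{j,r_j-k+1}$ for $k=1,\dots,r_j$.
   Context: The integrator dynamics in Brunovsky normal form with $d$ states and $m$ inputs is $\dot{\bm{x}}=\bm{A}\bm{x}+\bm{B}\bm{u}$ with $\bm{A}=\mathrm{blkdiag}(\bm{A}_1,\dots,\bm{A}_m)$, $\bm{B}=\mathrm{blkdiag}(\bm{b}_1,\dots,\bm{b}_m)$ and $r_1+\dots+r_m=d$. Here $\bm{A}_j$ is the $r_j\times r_j$ matrix with ones on the superdiagonal and zeros elsewhere, and $\bm{b}_j\in\mathbb{R}^{r_j}$ is the last standard basis vector. The forward reach set $\mathcal{R}(\{\bm{x}_0\},t)\subset\mathbb{R}^d$ is the set of states that the dynamics may reach at time $t$ from $\bm{x}_0$ with inputs taking values in $\mathcal{U}$. It equals the product of the sets $\mathcal{R}_j(\{\bm{x}_0\},t)\subset\mathbb{R}^{r_j}$ of states reachable at time $t$ by $\dot{\bm{x}}_j=\bm{A}_j\bm{x}_j+\bm{b}_ju_j$, $\bm{x}_j(0)=\bm{x}_{j0}$, with $u_j$ taking values in $[\alpha_j,\beta_j]$. Notation: $\mu_j=\frac{\beta_j-\alpha_j}{2}$, $\nu_j=\frac{\beta_j+\alpha_j}{2}$; $\bm{v}(k)$ is the $k$-th component of a vector $\bm{v}$; $\mathbf{1}_{k\le\ell}$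 is $1$ if $k\le\ell$ and $0$ otherwise. The components of $\bm{x}^{\mathrm{bdy}}_j\in\mathbb{R}^{r_j}$ are the indeterminates of the implicit equations. The boundary is parameterized, for $k=1,\dots,r_j$, by $$\bm{x}^{\mathrm{bdy}}_j(k)=\sum_{\ell=1}^{r_j}\mathbf{1}_{k\le\ell}\frac{t^{\ell-k}}{(\ell-k)!}\bm{x}_{j0}(\ell)+\frac{\nu_jt^{r_j-k+1}}{(r_j-k+1)!}\pm\frac{\mu_j}{(r_j-k+1)!}\left\{(-1)^{r_j-1}t^{r_j-k+1}+2\sum_{q=1}^{r_j-1}(-1)^{q+1}s_q^{r_j-k+1}\right\},$$ with $0\le s_1\le\dots\le s_{r_j-1}\le t$. The equations $p_j^{\mathrm{upper}}(\bm{x}^{\mathrm{bdy}}_j)=0$ and $p_j^{\mathrm{lower}}(\bm{x}^{\mathrm{bdy}}_j)=0$ are the implicit equations (obtained by polynomial implicitization, i.e. elimination of the parameters) corresponding to this parameterization. The first is obtained when fixing the plus sign for $\pm$, and the second when fixing the minus sign. The superscripts $\pm$ in the claim correspond to these two choices (plus for upper, minus for lower).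
   Formalization: For the lower (minus) hypersurface with r_j even, λ_j^-(k) is taken as −ρ^-_{j,r_j−k+1}; with the printed sign the determinant does not vanish on the boundary (for r_j=2, x_0=0, α=−1, β=1 it equals s_1²). *)

theory Defs
  imports
    "HOL-Analysis.Analysis"
    "HOL-Computational_Algebra.Formal_Power_Series"
    "HOL-Library.Poly_Mapping"
    "Jordan_Normal_Form.Determinant"
begin

text \<open>
  The k-th component (counted from 1) of a state is entry \<open>k - 1\<close> of a vector of
  type \<open>real vec\<close>; inputs and blocks are counted from 0.
\<close>

subsection \<open>Reach sets\<close>

text \<open>
  Inputs are Lebesgue measurable; trajectories are Caratheodory solutions, that is, solutions of
  the integral form of the differential equation.
\<close>

definition reach_set ::
  "real mat \<Rightarrow> real mat \<Rightarrow> real vec set \<Rightarrow> real vec \<Rightarrow> real \<Rightarrow> real vec set" where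
  "reach_set A B U x0 t = {x t | x u.
     (\<forall>s\<in>{0..t}. x s \<in> carrier_vec (dim_row A)) \<and>
     (\<forall>s\<in>{0..t}. u s \<in> U) \<and>
     (\<forall>i<dim_col B. (\<lambda>s. vec_index (u s) i) \<in> borel_measurable (lebesgue_on {0..t})) \<and>
     (\<forall>i<dim_row A. \<forall>T\<in>{0..t}.
        ((\<lambda>s. vec_index (A *\<^sub>v x s + B *\<^sub>v u s) i)
           has_integral (vec_index (x T) i - vec_index x0 i)) {0..T})}"

definition chain_A :: "nat \<Rightarrow> real mat" where
  "chain_A n = mat n n (\<lambda>(i, j). if j = Suc i then 1 else 0)"

definition chain_b :: "nat \<Rightarrow> real mat" where
  "chain_b n = mat n 1 (\<lambda>(i, j). if Suc i = n then 1 else 0)"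

definition input_box :: "nat \<Rightarrow> (nat \<Rightarrow> real) \<Rightarrow> (nat \<Rightarrow> real) \<Rightarrow> real vec set" where
  "input_box m \<alpha> \<beta> = {u \<in> carrier_vec m. \<forall>j<m. \<alpha> j \<le> vec_index u j \<and> vec_index u j \<le> \<beta> j}"

definition integrator_reach_set ::
  "nat \<Rightarrow> (nat \<Rightarrow> nat) \<Rightarrow> (nat \<Rightarrow> real) \<Rightarrow> (nat \<Rightarrow> real) \<Rightarrow> real vec \<Rightarrow> real \<Rightarrow> real vec set" where
  "integrator_reach_set m r \<alpha> \<beta> x0 t =
     reach_set (diag_block_mat (map (\<lambda>j. chain_A (r j)) [0..<m]))
               (diag_block_mat (map (\<lambda>j. chain_b (r j)) [0..<m]))
               (input_box m \<alpha> \<beta>) x0 t"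

definition single_input_reach_set ::
  "nat \<Rightarrow> real \<Rightarrow> real \<Rightarrow> real vec \<Rightarrow> real \<Rightarrow> real vec set" where
  "single_input_reach_set n a b y0 t =
     reach_set (chain_A n) (chain_b n) (input_box 1 (\<lambda>_. a) (\<lambda>_. b)) y0 t"

definition block :: "(nat \<Rightarrow> nat) \<Rightarrow> nat \<Rightarrow> real vec \<Rightarrow> real vec" where
  "block r j x = vec (r j) (\<lambda>i. vec_index x ((\<Sum>i'<j. r i') + i))"

text \<open>
  There is no topology on \<open>real vec\<close>; the boundary is taken in the library's Euclidean space
  of dimension n, whose points are functions vanishing from index n on.
\<close>

definition coords :: "real vec \<Rightarrow> nat \<Rightarrow> real" where
  "coords x = (\<lambda>i. if i < dim_vec x then vec_index x i else 0)"

definition vec_boundary :: "nat \<Rightarrow> real vec set \<Rightarrow> real vec set" where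
  "vec_boundary n S = {x \<in> carrier_vec n. coords x \<in> Euclidean_space n frontier_of (coords ` S)}"


subsection \<open>Multivariate polynomials\<close>

text \<open>A monomial maps each variable to its exponent; a polynomial maps monomials to coefficients.\<close>

type_synonym mpoly = "(nat \<Rightarrow>\<^sub>0 nat) \<Rightarrow>\<^sub>0 real"

definition pvar :: "nat \<Rightarrow> mpoly" where
  "pvar i = Poly_Mapping.single (Poly_Mapping.single i 1) 1"

definition pconst :: "real \<Rightarrow> mpoly" where
  "pconst c = Poly_Mapping.single 0 c"

definition pvars :: "mpoly \<Rightarrow> nat set" where
  "pvars p = (\<Union>m\<in>Poly_Mapping.keys p. Poly_Mapping.keys m)"

definition peval :: "mpoly \<Rightarrow> (nat \<Rightarrow> real) \<Rightarrow> real" where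
  "peval p f = (\<Sum>m\<in>Poly_Mapping.keys p. Poly_Mapping.lookup p m * (\<Prod>i\<in>Poly_Mapping.keys m. f i ^ Poly_Mapping.lookup m i))"

definition pdegree :: "mpoly \<Rightarrow> nat" where
  "pdegree p = Max (insert 0 ((\<lambda>m. \<Sum>i\<in>Poly_Mapping.keys m. Poly_Mapping.lookup m i) ` Poly_Mapping.keys p))"

definition peval_vec :: "mpoly \<Rightarrow> real vec \<Rightarrow> real" where
  "peval_vec p x = peval p (\<lambda>k. vec_index x (k - 1))"


subsection \<open>Boundary parameterization and implicitization\<close>

datatype branch = Upper | Lower

fun pm :: "branch \<Rightarrow> real" where
  "pm Upper = 1"
| "pm Lower = -1"

definition half_width :: "real \<Rightarrow> real \<Rightarrow> real" where
  "half_width a b = (b - a) / 2"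

definition midpoint :: "real \<Rightarrow> real \<Rightarrow> real" where
  "midpoint a b = (b + a) / 2"

definition free_motion :: "nat \<Rightarrow> real \<Rightarrow> real vec \<Rightarrow> nat \<Rightarrow> real" where
  "free_motion n t y0 k =
     (\<Sum>l=1..n. (if k \<le> l then 1 else 0) * (t ^ (l - k) / fact (l - k)) * vec_index y0 (l - 1))"

text \<open>
  The variables \<open>1..n\<close> are the coordinates of the boundary point, the variables
  \<open>n + 1..2 * n - 1\<close> are the switching parameters \<open>s\<^sub>1, ..., s\<^sub>n\<^sub>-\<^sub>1\<close>.
\<close>

definition boundary_param ::
  "branch \<Rightarrow> nat \<Rightarrow> real \<Rightarrow> real \<Rightarrow> real \<Rightarrow> real vec \<Rightarrow> nat \<Rightarrow> mpoly" where
  "boundary_param \<sigma> n a b t y0 k =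
     pconst (free_motion n t y0 k)
     + pconst (midpoint a b * t ^ (n - k + 1) / fact (n - k + 1))
     + pconst (pm \<sigma> * (half_width a b / fact (n - k + 1)))
       * (pconst ((-1) ^ (n - 1) * t ^ (n - k + 1))
          + 2 * (\<Sum>q=1..n-1. (-1) ^ (q + 1) * pvar (n + q) ^ (n - k + 1)))"

definition elimination_ideal ::
  "branch \<Rightarrow> nat \<Rightarrow> real \<Rightarrow> real \<Rightarrow> real \<Rightarrow> real vec \<Rightarrow> mpoly set" where
  "elimination_ideal \<sigma> n a b t y0 =
     {p. pvars p \<subseteq> {1..n} \<and>
         (\<exists>h. (\<forall>k\<in>{1..n}. pvars (h k) \<subseteq> {1..2*n-1}) \<and>
              p = (\<Sum>k=1..n. h k * (pvar k - boundary_param \<sigma> n a b t y0 k)))}"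

definition implicit_polynomial ::
  "branch \<Rightarrow> nat \<Rightarrow> real \<Rightarrow> real \<Rightarrow> real \<Rightarrow> real vec \<Rightarrow> mpoly \<Rightarrow> bool" where
  "implicit_polynomial \<sigma> n a b t y0 p \<longleftrightarrow>
     pvars p \<subseteq> {1..n} \<and>
     elimination_ideal \<sigma> n a b t y0 = {h * p | h. pvars h \<subseteq> {1..n}}"


subsection \<open>The Hankel determinant\<close>

definition rho ::
  "branch \<Rightarrow> nat \<Rightarrow> real \<Rightarrow> real \<Rightarrow> real \<Rightarrow> real vec \<Rightarrow> real vec \<Rightarrow> nat \<Rightarrow> real" where
  "rho \<sigma> n a b t y0 x k =
     fact (n - k + 1) / (2 * half_width a b) * (vec_index x (k - 1) - free_motion n t y0 k)
     - 1/2 * (pm \<sigma> * (-1) ^ (n - 1) * t ^ (n - k + 1)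
              + midpoint a b / half_width a b * t ^ (n - k + 1))"

text \<open>
  On the parameterized boundary \<open>rho \<sigma> ... (n - k + 1)\<close> equals \<open>pm \<sigma>\<close> times the alternating power
  sum of degree k, whose first term is \<open>s\<^sub>1 ^ k\<close>. For odd n there are as many positive as negative
  terms and the Hankel determinant vanishes for either sign. For even n it vanishes only if the
  positive terms are the more numerous, so on the lower branch \<open>rho\<close> has to be negated. For
  instance, for n = 2 that branch has \<open>rho ... 2 = - s\<^sub>1\<close> and \<open>rho ... 1 = - s\<^sub>1 ^ 2\<close>, and without
  the negation the determinant would be \<open>(lam 1 ^ 2 - lam 2) / 2 = s\<^sub>1 ^ 2\<close>.
\<close>

definition lam ::
  "branch \<Rightarrow> nat \<Rightarrow> real \<Rightarrow> real \<Rightarrow> real \<Rightarrow> real vec \<Rightarrow> real vec \<Rightarrow> nat \<Rightarrow> real" where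
  "lam \<sigma> n a b t y0 x k =
     (if \<sigma> = Lower \<and> even n then - rho \<sigma> n a b t y0 x (n - k + 1)
      else rho \<sigma> n a b t y0 x (n - k + 1))"

definition A_coeff ::
  "branch \<Rightarrow> nat \<Rightarrow> real \<Rightarrow> real \<Rightarrow> real \<Rightarrow> real vec \<Rightarrow> real vec \<Rightarrow> nat \<Rightarrow> real" where
  "A_coeff \<sigma> n a b t y0 x i =
     fps_nth (fps_compose (fps_exp 1)
       (- (\<Sum>k=1..n. fps_const (lam \<sigma> n a b t y0 x k / real k) * fps_X ^ k))) i"

definition delta :: "nat \<Rightarrow> nat" where
  "delta n = (n - 1) div 2"

definition hankel_det ::
  "branch \<Rightarrow> nat \<Rightarrow> real \<Rightarrow> real \<Rightarrow> real \<Rightarrow> real vec \<Rightarrow> real vec \<Rightarrow> real" where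
  "hankel_det \<sigma> n a b t y0 x =
     Determinant.det (mat (delta n + 1) (delta n + 1)
       (\<lambda>(i, j). A_coeff \<sigma> n a b t y0 x (n - 2 * delta n + i + j)))"

end

theory Submission
  imports Defs
begin

text \<open>
  Elimination. After an affine change of coordinates the parameterization reads
  \<open>\<lambda> k = \<Sum>q. \<epsilon> q * s q ^ k\<close> with \<open>n - 1 - \<delta>\<close> signs \<open>1\<close> and \<open>\<delta>\<close> signs \<open>- 1\<close>, and
  \<open>exp (- \<Sum>k. \<lambda> k / k * X ^ k) = \<Prod>q. (1 - s q * X) ^ \<epsilon> q\<close> is a quotient of polynomials.
  Its denominator gives a linear recursion for the coefficients \<open>A k\<close>, so the Hankel determinant
  vanishes on the parameterized set. Conversely \<open>A 1, ..., A n\<close> are polynomial coordinates on the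
  whole space, the Hankel determinant is linear in \<open>A n\<close> with a smaller Hankel determinant as
  leading coefficient, hence prime by induction, and \<open>A 1, ..., A (n - 1)\<close> are algebraically
  independent on the parameterized set (by differentiation and Vandermonde). Pseudo-division in \<open>A n\<close>
  then shows that every polynomial vanishing on this set is a multiple of the Hankel determinant.
  The degree is attained by the power of \<open>\<lambda> 1\<close>, whose coefficient is, up to sign, the determinant
  of the \<open>1 / (n - 2 * \<delta> + i + j)!\<close>.

  Boundary. The reach set is convex, so a frontier point has a supporting functional. Along this
  functional a state is an integral of the input against a nonzero polynomial \<open>Q\<close> of degree at most
  \<open>n - 1\<close>, and the frontier point must be the one reached by the bang-bang input that follows the sign
  of \<open>Q\<close>. It switches at most \<open>n - 1\<close> times, which is the parameterization.
\<close>

section \<open>Evaluation of multivariate polynomials\<close>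

text \<open>On the algebraic side the elimination ideal equals the set of polynomials in the
  coordinates that vanish at the points given by all real parameter values, ordered or not.
  Membership becomes a question about values, so most polynomial identities are proved by
  evaluation. The obstacle is divisibility: pseudo-division multiplies by powers of the leading
  coefficient, and these can be cancelled only because that coefficient, if not 1, is prime and does
  not divide the Hankel determinant. This is the invariant of the induction on the size. On the
  analytic side the reach set is not shown to be closed, so a frontier point need not come with a
  control of its own. There are only controls that reach points close to it. The supporting
  functional makes such controls nearly optimal, and since \<open>Q\<close> has finitely many zeros,
  near-optimality forces them to be close in the mean to the bang-bang control. The frontier point
  is identified in the limit.\<close>

definition mono_val :: "(nat \<Rightarrow>\<^sub>0 nat) \<Rightarrow> (nat \<Rightarrow> real) \<Rightarrow> real" where
  "mono_val m f = (\<Prod>i\<in>Poly_Mapping.keys m. f i ^ Poly_Mapping.lookup m i)"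

definition mono_deg :: "(nat \<Rightarrow>\<^sub>0 nat) \<Rightarrow> nat" where
  "mono_deg m = (\<Sum>i\<in>Poly_Mapping.keys m. Poly_Mapping.lookup m i)"

lemma mono_val_superset:
  assumes "finite K" "Poly_Mapping.keys m \<subseteq> K"
  shows "mono_val m f = (\<Prod>i\<in>K. f i ^ Poly_Mapping.lookup m i)"
  unfolding mono_val_def using assms
  by (intro prod.mono_neutral_left) (auto simp: in_keys_iff)

lemma mono_deg_superset:
  assumes "finite K" "Poly_Mapping.keys m \<subseteq> K"
  shows "mono_deg m = (\<Sum>i\<in>K. Poly_Mapping.lookup m i)"
  unfolding mono_deg_def using assms
  by (intro sum.mono_neutral_left) (auto simp: in_keys_iff)

lemma mono_val_add: "mono_val (m + m') f = mono_val m f * mono_val m' f"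
proof -
  let ?K = "Poly_Mapping.keys m \<union> Poly_Mapping.keys m'"
  have "Poly_Mapping.keys (m + m') \<subseteq> ?K" by (rule Poly_Mapping.keys_add)
  then show ?thesis
    by (subst (1 2 3) mono_val_superset[of ?K]) (auto simp: lookup_add power_add prod.distrib)
qed

lemma mono_deg_add: "mono_deg (m + m') = mono_deg m + mono_deg m'"
proof -
  let ?K = "Poly_Mapping.keys m \<union> Poly_Mapping.keys m'"
  have "Poly_Mapping.keys (m + m') \<subseteq> ?K" by (rule Poly_Mapping.keys_add)
  then show ?thesis
    by (subst (1 2 3) mono_deg_superset[of ?K]) (auto simp: lookup_add sum.distrib)
qed

lemma peval_alt: "peval p f = (\<Sum>m\<in>Poly_Mapping.keys p. Poly_Mapping.lookup p m * mono_val m f)"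
  by (simp add: peval_def mono_val_def)

lemma peval_superset:
  assumes "finite K" "Poly_Mapping.keys p \<subseteq> K"
  shows "peval p f = (\<Sum>m\<in>K. Poly_Mapping.lookup p m * mono_val m f)"
  unfolding peval_alt using assms
  by (intro sum.mono_neutral_left) (auto simp: in_keys_iff)

lemma peval_single [simp]: "peval (Poly_Mapping.single m c) f = c * mono_val m f"
  by (simp add: peval_alt)

lemma peval_add [simp]: "peval (p + q) f = peval p f + peval q f"
proof -
  let ?K = "Poly_Mapping.keys p \<union> Poly_Mapping.keys q"
  have "Poly_Mapping.keys (p + q) \<subseteq> ?K" by (rule Poly_Mapping.keys_add)
  then show ?thesis
    by (subst (1 2 3) peval_superset[of ?K]) (auto simp: lookup_add sum.distrib algebra_simps)
qed

lemma mpoly_as_sum: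
  "p = (\<Sum>m\<in>Poly_Mapping.keys p. Poly_Mapping.single m (Poly_Mapping.lookup p m))"
  for p :: "'a \<Rightarrow>\<^sub>0 'b::comm_monoid_add"
proof (rule poly_mapping_eqI)
  fix k
  show "Poly_Mapping.lookup p k = Poly_Mapping.lookup
      (\<Sum>m\<in>Poly_Mapping.keys p. Poly_Mapping.single m (Poly_Mapping.lookup p m)) k"
    by (cases "k \<in> Poly_Mapping.keys p")
       (auto simp: lookup_sum lookup_single when_def in_keys_iff if_distrib sum.delta cong: if_cong)
qed

text \<open>The case of a single monomial is restricted to the keys of \<open>p\<close>; this is
  what carries a bound on the variables of \<open>p\<close> into
  \<open>mpoly_induct\<close>.\<close>

lemma mpoly_single_induct [case_names zero single add]:
  fixes p :: "'a \<Rightarrow>\<^sub>0 'b::comm_monoid_add"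
  assumes "P 0" "\<And>m c. m \<in> Poly_Mapping.keys p \<Longrightarrow> P (Poly_Mapping.single m c)"
    "\<And>p q. P p \<Longrightarrow> P q \<Longrightarrow> P (p + q)"
  shows "P p"
proof -
  have "P (\<Sum>m\<in>K. Poly_Mapping.single m (Poly_Mapping.lookup p m))"
    if "finite K" "K \<subseteq> Poly_Mapping.keys p" for K
    using that by (induction K rule: finite_induct) (auto intro: assms)
  from this[of "Poly_Mapping.keys p"] show ?thesis by (simp flip: mpoly_as_sum)
qed

lemma peval_zero [simp]: "peval 0 f = 0" by (simp add: peval_alt)

lemma peval_mult [simp]: "peval (p * q) f = peval p f * peval q f"
proof (induction p rule: mpoly_single_induct)
  case (single m c)
  show ?case
    by (induction q rule: mpoly_single_induct)
       (auto simp: mult_single mono_val_add algebra_simps)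
qed (auto simp: algebra_simps)

lemma mono_val_zero [simp]: "mono_val 0 f = 1" by (simp add: mono_val_def)

lemma peval_const [simp]: "peval (pconst c) f = c" by (simp add: pconst_def)
lemma peval_one [simp]: "peval 1 f = 1"
  using peval_const[of 1 f] by (simp add: pconst_def)
lemma peval_var [simp]: "peval (pvar i) f = f i"
  by (simp add: pvar_def mono_val_def)
lemma peval_uminus [simp]: "peval (- p) f = - peval p f"
  using peval_add[of p "- p" f] by simp
lemma peval_diff [simp]: "peval (p - q) f = peval p f - peval q f"
  using peval_add[of p "- q" f] by simp
lemma peval_power [simp]: "peval (p ^ n) f = peval p f ^ n"
  by (induction n) auto
lemma peval_sum [simp]: "peval (\<Sum>i\<in>I. p i) f = (\<Sum>i\<in>I. peval (p i) f)"
  by (induction I rule: infinite_finite_induct) auto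
lemma peval_of_nat [simp]: "peval (of_nat k) f = of_nat k"
  by (induction k) auto
lemma peval_numeral [simp]: "peval (numeral k) f = numeral k"
  using peval_of_nat[of "numeral k" f] by simp

lemma pvar_power: "pvar i ^ k = Poly_Mapping.single (Poly_Mapping.single i k) 1"
  by (induction k) (auto simp: pvar_def mult_single simp flip: single_add)

lemma prod_single_one:
  "(\<Prod>i\<in>I. Poly_Mapping.single (m i) (1::real)) = Poly_Mapping.single (\<Sum>i\<in>I. m i :: nat \<Rightarrow>\<^sub>0 nat) 1"
  by (induction I rule: infinite_finite_induct) (auto simp: mult_single)

lemma single_factor:
  "Poly_Mapping.single m c =
     pconst c * (\<Prod>i\<in>Poly_Mapping.keys m. pvar i ^ Poly_Mapping.lookup m i)"
proof -
  have "(\<Prod>i\<in>Poly_Mapping.keys m. pvar i ^ Poly_Mapping.lookup m i) = Poly_Mapping.single m 1"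
    unfolding pvar_power prod_single_one by (simp flip: mpoly_as_sum)
  then show ?thesis by (simp add: pconst_def mult_single)
qed

lemma pvars_add: "pvars (p + q) \<subseteq> pvars p \<union> pvars q"
  unfolding pvars_def using Poly_Mapping.keys_add[of p q] by fastforce

lemma pvars_mult: "pvars (p * q) \<subseteq> pvars p \<union> pvars q"
proof
  fix i assume "i \<in> pvars (p * q)"
  then obtain m where m: "m \<in> Poly_Mapping.keys (p * q)" "i \<in> Poly_Mapping.keys m"
    by (auto simp: pvars_def)
  then obtain a b where ab: "m = a + b" "a \<in> Poly_Mapping.keys p" "b \<in> Poly_Mapping.keys q"
    using keys_mult[of p q] by auto
  then have "i \<in> Poly_Mapping.keys a \<or> i \<in> Poly_Mapping.keys b"
    using m(2) Poly_Mapping.keys_add[of a b] by auto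
  with ab show "i \<in> pvars p \<union> pvars q" by (auto simp: pvars_def)
qed

lemma pvars_const [simp]: "pvars (pconst c) = {}"
  by (auto simp: pvars_def pconst_def split: if_splits)
lemma pvars_var [simp]: "pvars (pvar i) = {i}"
  by (auto simp: pvars_def pvar_def)

lemma pconst_0: "pconst 0 = 0" and pconst_1: "pconst 1 = 1"
  by (simp_all add: pconst_def)

text \<open>Constants and variables generate all polynomials by sums and products. The cases
  \<open>add\<close> and \<open>mult\<close> say nothing about the variables of \<open>p\<close> and
  \<open>q\<close>; a statement that needs them has to include the bound in
  \<open>P\<close>.\<close>

lemma mpoly_induct [consumes 1, case_names const var add mult]:
  assumes V: "pvars p \<subseteq> V"
    and c: "\<And>c. P (pconst c)" and v: "\<And>i. i \<in> V \<Longrightarrow> P (pvar i)"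
    and a: "\<And>p q. P p \<Longrightarrow> P q \<Longrightarrow> P (p + q)" and m: "\<And>p q. P p \<Longrightarrow> P q \<Longrightarrow> P (p * q)"
  shows "P p"
proof (induction p rule: mpoly_single_induct)
  case zero
  show ?case using c[of 0] by (simp add: pconst_0)
next
  case (single m' c')
  have P1: "P 1" using c[of 1] by (simp add: pconst_1)
  have pw: "P (pvar i ^ k)" if "i \<in> V" for i k
    by (induction k) (auto intro: m v P1 that)
  have "P (\<Prod>i\<in>K. pvar i ^ Poly_Mapping.lookup m' i)" if "finite K" "K \<subseteq> V" for K
    using that by (induction K rule: finite_induct) (auto intro: m pw P1)
  moreover have "Poly_Mapping.keys m' \<subseteq> V" using single V by (auto simp: pvars_def)
  ultimately show ?case unfolding single_factor by (intro m c) auto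
qed (rule a)

lemma peval_cong:
  assumes "pvars p \<subseteq> V" "\<And>i. i \<in> V \<Longrightarrow> f i = g i"
  shows "peval p f = peval p g"
  using assms(1) by (induction rule: mpoly_induct) (auto simp: assms(2))

lemma mono_deg_0 [simp]: "mono_deg 0 = 0" by (simp add: mono_deg_def)

lemma pdegree_le_iff: "pdegree p \<le> d \<longleftrightarrow> (\<forall>m\<in>Poly_Mapping.keys p. mono_deg m \<le> d)"
  by (auto simp: pdegree_def mono_deg_def)

lemma pdegree_add_le: "pdegree p \<le> d \<Longrightarrow> pdegree q \<le> d \<Longrightarrow> pdegree (p + q) \<le> d"
  unfolding pdegree_le_iff using Poly_Mapping.keys_add[of p q] by blast

lemma pdegree_mult_le: "pdegree p \<le> d \<Longrightarrow> pdegree q \<le> e \<Longrightarrow> pdegree (p * q) \<le> d + e"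
  unfolding pdegree_le_iff using keys_mult[of p q] by (fastforce simp: mono_deg_add intro: add_mono)

lemma pdegree_const [simp]: "pdegree (pconst c) = 0"
  using pdegree_le_iff[of "pconst c" 0] by (auto simp: pconst_def)

lemma pdegree_var: "pdegree (pvar i) \<le> 1"
  unfolding pdegree_le_iff by (auto simp: pvar_def mono_deg_def)


section \<open>Polynomial functions\<close>

text \<open>Polynomials are mostly handled as functions: a determinant or a recursion is shown to be
  a polynomial function with bounds on variables and degree, and \<open>polyfunE\<close> then
  supplies the polynomial.\<close>

definition polyfun :: "nat set \<Rightarrow> nat \<Rightarrow> ((nat \<Rightarrow> real) \<Rightarrow> real) \<Rightarrow> bool" where
  "polyfun V d F \<longleftrightarrow> (\<exists>p. pvars p \<subseteq> V \<and> pdegree p \<le> d \<and> peval p = F)"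

lemma polyfunI: "pvars p \<subseteq> V \<Longrightarrow> pdegree p \<le> d \<Longrightarrow> (\<And>z. peval p z = F z) \<Longrightarrow> polyfun V d F"
  unfolding polyfun_def by blast

lemma polyfunE:
  assumes "polyfun V d F"
  obtains p where "pvars p \<subseteq> V" "pdegree p \<le> d" "\<And>z. peval p z = F z"
  using assms unfolding polyfun_def by blast

lemma polyfun_mono: "polyfun V d F \<Longrightarrow> V \<subseteq> W \<Longrightarrow> d \<le> e \<Longrightarrow> polyfun W e F"
  unfolding polyfun_def by (auto intro: order_trans)

lemma polyfun_const: "polyfun V d (\<lambda>z. c)"
  by (rule polyfunI[of "pconst c"]) auto

lemma polyfun_var: "i \<in> V \<Longrightarrow> 1 \<le> d \<Longrightarrow> polyfun V d (\<lambda>z. z i)"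
  using pdegree_var[of i] by (intro polyfunI[of "pvar i"]) auto

lemma polyfun_add: "polyfun V d F \<Longrightarrow> polyfun V d G \<Longrightarrow> polyfun V d (\<lambda>z. F z + G z)"
proof (elim polyfunE)
  fix p q assume "pvars p \<subseteq> V" "pdegree p \<le> d" "\<And>z. peval p z = F z"
    "pvars q \<subseteq> V" "pdegree q \<le> d" "\<And>z. peval q z = G z"
  then show ?thesis using pvars_add[of p q]
    by (intro polyfunI[of "p + q"] pdegree_add_le) auto
qed

lemma polyfun_mult: "polyfun V d F \<Longrightarrow> polyfun V e G \<Longrightarrow> polyfun V (d + e) (\<lambda>z. F z * G z)"
proof (elim polyfunE)
  fix p q assume "pvars p \<subseteq> V" "pdegree p \<le> d" "\<And>z. peval p z = F z"
    "pvars q \<subseteq> V" "pdegree q \<le> e" "\<And>z. peval q z = G z"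
  then show ?thesis using pvars_mult[of p q]
    by (intro polyfunI[of "p * q"] pdegree_mult_le) auto
qed

lemma polyfun_cmult: "polyfun V d F \<Longrightarrow> polyfun V d (\<lambda>z. c * F z)"
  using polyfun_mult[OF polyfun_const[of V 0 c], of d F] by simp

lemma polyfun_sum: "(\<And>i. i \<in> I \<Longrightarrow> polyfun V d (F i)) \<Longrightarrow> polyfun V d (\<lambda>z. \<Sum>i\<in>I. F i z)"
  by (induction I rule: infinite_finite_induct) (auto intro: polyfun_add polyfun_const)

lemma polyfun_prod:
  "(\<And>i. i \<in> I \<Longrightarrow> polyfun V (d i) (F i)) \<Longrightarrow> polyfun V (\<Sum>i\<in>I. d i) (\<lambda>z. \<Prod>i\<in>I. F i z)"
  by (induction I rule: infinite_finite_induct) (auto intro: polyfun_mult polyfun_const)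

text \<open>Composition loses the degree bound, which is only needed for explicit polynomials.\<close>

lemma polyfun_compose:
  assumes "pvars p \<subseteq> W" "\<And>i. i \<in> W \<Longrightarrow> \<exists>d. polyfun V d (F i)"
  shows "\<exists>d. polyfun V d (\<lambda>z. peval p (\<lambda>i. F i z))"
  using assms(1)
proof (induction rule: mpoly_induct)
  case (const c) then show ?case using polyfun_const by auto
next
  case (var i) then show ?case using assms(2) by auto
next
  case (add p q)
  then obtain d e where "polyfun V d (\<lambda>z. peval p (\<lambda>i. F i z))"
    "polyfun V e (\<lambda>z. peval q (\<lambda>i. F i z))" by auto
  then have "polyfun V (max d e) (\<lambda>z. peval (p + q) (\<lambda>i. F i z))"
    by (auto intro!: polyfun_add intro: polyfun_mono)
  then show ?case ..
next
  case (mult p q)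
  then show ?case by (auto intro: polyfun_mult)
qed


section \<open>Partial derivatives and the identity theorem\<close>

text \<open>The formal partial derivative, defined on coefficients, so that each coefficient of
  positive degree can be read off from a lower coefficient of a derivative.\<close>

definition pd :: "nat \<Rightarrow> mpoly \<Rightarrow> mpoly" where
  "pd k p = Abs_poly_mapping (\<lambda>m. real (Poly_Mapping.lookup m k + 1) *
     Poly_Mapping.lookup p (m + Poly_Mapping.single k 1))"

lemma lookup_pd: "Poly_Mapping.lookup (pd k p) m =
    real (Poly_Mapping.lookup m k + 1) * Poly_Mapping.lookup p (m + Poly_Mapping.single k 1)"
proof -
  have "finite ((\<lambda>m. m + Poly_Mapping.single k 1) -` Poly_Mapping.keys p)"
    by (intro finite_vimageI) (auto simp: inj_on_def)
  then have "finite {m. real (Poly_Mapping.lookup m k + 1) *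
     Poly_Mapping.lookup p (m + Poly_Mapping.single k 1) \<noteq> 0}"
    by (rule finite_subset[rotated]) (auto simp: in_keys_iff)
  then show ?thesis unfolding pd_def by (subst lookup_Abs_poly_mapping) auto
qed

lemma pd_add: "pd k (p + q) = pd k p + pd k q"
  by (rule poly_mapping_eqI) (simp add: lookup_pd lookup_add algebra_simps)

text \<open>Truncated subtraction of monomials is harmless: it truncates only where the exponent of
  \<open>k\<close> is 0, and there the coefficient vanishes.\<close>

lemma pd_single: "pd k (Poly_Mapping.single m c) =
    Poly_Mapping.single (m - Poly_Mapping.single k 1) (c * real (Poly_Mapping.lookup m k))"
proof (rule poly_mapping_eqI)
  fix m'
  have 1: "m' + Poly_Mapping.single k 1 = m \<longleftrightarrow>
      m - Poly_Mapping.single k 1 = m' \<and> Poly_Mapping.lookup m k > 0"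
  proof
    assume "m' + Poly_Mapping.single k 1 = m"
    then show "m - Poly_Mapping.single k 1 = m' \<and> Poly_Mapping.lookup m k > 0"
      by (auto simp: lookup_add)
  next
    assume a: "m - Poly_Mapping.single k 1 = m' \<and> Poly_Mapping.lookup m k > 0"
    show "m' + Poly_Mapping.single k 1 = m"
    proof (rule poly_mapping_eqI)
      fix j
      show "Poly_Mapping.lookup (m' + Poly_Mapping.single k 1) j = Poly_Mapping.lookup m j"
        using a by (auto simp: lookup_add lookup_minus lookup_single when_def)
    qed
  qed
  show "Poly_Mapping.lookup (pd k (Poly_Mapping.single m c)) m' =
    Poly_Mapping.lookup (Poly_Mapping.single (m - Poly_Mapping.single k 1)
      (c * real (Poly_Mapping.lookup m k))) m'"
    unfolding lookup_pd lookup_single when_def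
    by (cases "Poly_Mapping.lookup m k > 0") (use 1 in \<open>auto simp: lookup_minus lookup_add\<close>)
qed

lemma pvars_pd: "pvars (pd k p) \<subseteq> pvars p"
proof
  fix i assume "i \<in> pvars (pd k p)"
  then obtain m where m: "m \<in> Poly_Mapping.keys (pd k p)" "i \<in> Poly_Mapping.keys m"
    by (auto simp: pvars_def)
  then have "m + Poly_Mapping.single k 1 \<in> Poly_Mapping.keys p"
    by (auto simp: in_keys_iff lookup_pd)
  moreover have "i \<in> Poly_Mapping.keys (m + Poly_Mapping.single k 1)"
    using m(2) by (auto simp: in_keys_iff lookup_add)
  ultimately show "i \<in> pvars p" by (auto simp: pvars_def)
qed

lemma has_derivative_pd:
  "((\<lambda>u. peval p (z(k := u))) has_real_derivative peval (pd k p) z) (at (z k))"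
proof (induction p rule: mpoly_single_induct)
  case zero
  have "pd k 0 = 0" by (rule poly_mapping_eqI) (simp add: lookup_pd)
  then show ?case by simp
next
  case (single m c)
  let ?e = "Poly_Mapping.single k (1::nat)"
  define K where "K = Poly_Mapping.keys m - {k}"
  define R where "R = (\<Prod>i\<in>K. z i ^ Poly_Mapping.lookup m i)"
  define a where "a = Poly_Mapping.lookup m k"
  have K: "finite K" "k \<notin> K" by (auto simp: K_def)
  have sub: "Poly_Mapping.keys m \<subseteq> insert k K" "Poly_Mapping.keys (m - ?e) \<subseteq> insert k K"
    by (auto simp: K_def in_keys_iff lookup_minus)
  have 1: "mono_val m (z(k := u)) = u ^ a * R" for u
  proof -
    have "(\<Prod>i\<in>K. (z(k := u)) i ^ Poly_Mapping.lookup m i) = R"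
      unfolding R_def using K by (intro prod.cong) auto
    then show ?thesis
      using K by (subst mono_val_superset[OF _ sub(1)]) (auto simp: a_def)
  qed
  have 2: "mono_val (m - ?e) z = z k ^ (a - 1) * R"
  proof -
    have "(\<Prod>i\<in>K. z i ^ Poly_Mapping.lookup (m - ?e) i) = R"
      unfolding R_def using K by (intro prod.cong) (auto simp: lookup_minus lookup_single when_def)
    then show ?thesis
      using K by (subst mono_val_superset[OF _ sub(2)]) (auto simp: a_def lookup_minus)
  qed
  have "((\<lambda>u. c * (u ^ a * R)) has_real_derivative c * (real a * z k ^ (a - 1) * R)) (at (z k))"
    by (auto intro!: derivative_eq_intros)
  then show ?case
    unfolding pd_single peval_single 1 2 a_def[symmetric] by (simp add: mult_ac)
next
  case (add p q)
  then show ?case by (auto simp: pd_add intro: DERIV_add)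
qed

text \<open>The product rule is inherited from real analysis through uniqueness of derivatives,
  which avoids convolution sums of coefficients.\<close>

lemma peval_pd_mult: "peval (pd k (p * q)) z = peval (pd k p) z * peval q z + peval (pd k q) z * peval p z"
proof (rule DERIV_unique)
  show "((\<lambda>u. peval (p * q) (z(k := u))) has_real_derivative peval (pd k (p * q)) z) (at (z k))"
    by (rule has_derivative_pd)
  show "((\<lambda>u. peval (p * q) (z(k := u))) has_real_derivative
      peval (pd k p) z * peval q z + peval (pd k q) z * peval p z) (at (z k))"
    using DERIV_mult[OF has_derivative_pd[of p z k] has_derivative_pd[of q z k]] by simp
qed

lemma pd_var: "pd k (pvar i) = (if i = k then 1 else 0)"
  unfolding pvar_def pd_single by (auto simp: lookup_single)

lemma pd_const: "pd k (pconst c) = 0"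
  unfolding pconst_def pd_single by simp

lemma peval_chain_rule:
  assumes "pvars p \<subseteq> V" "finite V"
    "\<And>i. i \<in> V \<Longrightarrow> ((\<lambda>u. \<gamma> u i) has_real_derivative \<gamma>' i) (at u0)"
  shows "((\<lambda>u. peval p (\<gamma> u)) has_real_derivative
    (\<Sum>k\<in>V. peval (pd k p) (\<gamma> u0) * \<gamma>' k)) (at u0)"
  using assms(1)
proof (induction rule: mpoly_induct)
  case (const c)
  then show ?case by (simp add: pd_const)
next
  case (var i)
  have "(\<Sum>k\<in>V. peval (pd k (pvar i)) (\<gamma> u0) * \<gamma>' k) = (\<Sum>k\<in>V. if i = k then \<gamma>' k else 0)"
    by (intro sum.cong) (auto simp: pd_var)
  then show ?case using var assms(2,3) by simp
next
  case (add p q)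
  from DERIV_add[OF this] show ?case by (simp add: pd_add algebra_simps sum.distrib)
next
  case (mult p q)
  from DERIV_mult[OF this] show ?case
    by (simp add: peval_pd_mult algebra_simps sum.distrib sum_distrib_left)
qed

lemma peval_at_0: "peval p (\<lambda>_. 0) = Poly_Mapping.lookup p 0"
proof (induction p rule: mpoly_single_induct)
  case (single m c)
  show ?case
  proof (cases "m = 0")
    case False
    then obtain i where "i \<in> Poly_Mapping.keys m" using keys_eq_empty by blast
    then have "mono_val m (\<lambda>_. 0) = 0" unfolding mono_val_def
      by (intro prod_zero) (auto simp: in_keys_iff intro!: bexI[of _ i])
    then show ?thesis using False by (simp add: lookup_single)
  qed simp
qed (auto simp: lookup_add)

text \<open>All coefficients of \<open>p\<close> are, up to a factor, constant terms of iterated partial derivatives.\<close>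

lemma mpoly_eq_0_if_pd_closed:
  fixes p :: mpoly and J :: "mpoly set" and V :: "nat set"
  assumes J: "p \<in> J" and V: "\<And>q. q \<in> J \<Longrightarrow> pvars q \<subseteq> V"
    and pd: "\<And>q k. q \<in> J \<Longrightarrow> k \<in> V \<Longrightarrow> pd k q \<in> J"
    and const_term: "\<And>q. q \<in> J \<Longrightarrow> Poly_Mapping.lookup q 0 = 0"
  shows "p = 0"
proof (rule poly_mapping_eqI)
  fix m
  have "Poly_Mapping.lookup p m = 0" if "mono_deg m = d" for d
    using that J
  proof (induction d arbitrary: p m)
    case 0
    then have "m = 0" by (intro poly_mapping_eqI) (auto simp: mono_deg_def in_keys_iff)
    then show ?case using 0 const_term by simp
  next
    case (Suc d)
    then have "m \<noteq> 0" by auto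
    then obtain i where i: "i \<in> Poly_Mapping.keys m" using keys_eq_empty by blast
    show ?case
    proof (cases "i \<in> V")
      case False
      then have "m \<notin> Poly_Mapping.keys p" using i V[OF Suc.prems(2)] by (auto simp: pvars_def)
      then show ?thesis by (simp add: in_keys_iff)
    next
      case True
      define m' where "m' = m - Poly_Mapping.single i 1"
      have m: "m = m' + Poly_Mapping.single i 1"
        by (rule poly_mapping_eqI)
           (use i in \<open>auto simp: m'_def lookup_add lookup_minus lookup_single when_def in_keys_iff\<close>)
      have "mono_deg m' = d" using Suc.prems(1) unfolding m mono_deg_add by (simp add: mono_deg_def)
      from Suc.IH[OF this pd[OF Suc.prems(2) True]]
      have "Poly_Mapping.lookup p (m' + Poly_Mapping.single i 1) = 0" by (simp add: lookup_pd del: of_nat_add)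
      then show ?thesis by (simp only: m[symmetric])
    qed
  qed
  then show "Poly_Mapping.lookup p m = Poly_Mapping.lookup 0 m" by simp
qed

text \<open>The polynomials that vanish everywhere are closed under partial derivatives, and their
  constant terms are values at 0.\<close>

lemma mpoly_eq_0_if_peval_0:
  assumes "\<And>z. peval p z = 0"
  shows "p = 0"
proof (rule mpoly_eq_0_if_pd_closed[where V = UNIV])
  show "p \<in> {p. \<forall>z. peval p z = 0}" using assms by simp
next
  fix q k assume q: "q \<in> {p. \<forall>z. peval p z = 0}"
  have "peval (pd k q) z = 0" for z
  proof (rule DERIV_unique[OF has_derivative_pd])
    show "((\<lambda>u. peval q (z(k := u))) has_real_derivative 0) (at (z k))" using q by simp
  qed
  then show "pd k q \<in> {p. \<forall>z. peval p z = 0}" by simp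
next
  fix q :: mpoly assume "q \<in> {p. \<forall>z. peval p z = 0}"
  then show "Poly_Mapping.lookup q 0 = 0" by (simp flip: peval_at_0)
qed simp

lemma mpoly_eqI:
  assumes "\<And>z. peval p z = peval q z"
  shows "p = q"
  using mpoly_eq_0_if_peval_0[of "p - q"] assms by simp

section \<open>Primality of Hankel determinants\<close>

definition hankel :: "nat \<Rightarrow> nat \<Rightarrow> (nat \<Rightarrow> real) \<Rightarrow> real" where
  "hankel c k z = det (mat (Suc k) (Suc k) (\<lambda>(i, j). z (c + i + j)))"

text \<open>Every term of the Leibniz formula has the same degree bound, because a permutation only
  reorders the \<open>s j\<close>. This keeps the bound for the Hankel determinant at its exact
  degree.\<close>

lemma polyfun_det:
  assumes "\<And>i j. i < k \<Longrightarrow> j < k \<Longrightarrow> polyfun V (r i + s j) (F i j)"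
  shows "polyfun V (\<Sum>i<k. r i + s i) (\<lambda>z. det (mat k k (\<lambda>(i, j). F i j z)))"
proof -
  have eq: "det (mat k k (\<lambda>(i, j). F i j z)) = (\<Sum>p | p permutes {0..<k}. signof p * (\<Prod>i = 0..<k. F i (p i) z))" for z
  proof (subst det_def'[of _ k])
    show "(\<Sum>p | p permutes {0..<k}. signof p * (\<Prod>i = 0..<k. mat k k (\<lambda>(i, j). F i j z) $$ (i, p i))) =
      (\<Sum>p | p permutes {0..<k}. signof p * (\<Prod>i = 0..<k. F i (p i) z))"
    proof (intro sum.cong refl arg_cong2[where f = "(*)"] prod.cong)
      fix p i assume "p \<in> {p. p permutes {0..<k}}" "i \<in> {0..<k}"
      then have "i < k" "p i < k" using permutes_in_image[of p "{0..<k}" i] by auto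
      then show "mat k k (\<lambda>(i, j). F i j z) $$ (i, p i) = F i (p i) z" by simp
    qed
  qed simp
  show ?thesis unfolding eq
  proof (intro polyfun_sum polyfun_cmult)
    fix p assume "p \<in> {p. p permutes {0..<k}}"
    then have p: "p permutes {0..<k}" by simp
    have "polyfun V (\<Sum>i = 0..<k. r i + s (p i)) (\<lambda>z. \<Prod>i = 0..<k. F i (p i) z)"
      by (intro polyfun_prod assms) (use permutes_in_image[OF p] in auto)
    moreover have "(\<Sum>i = 0..<k. r i + s (p i)) = (\<Sum>i<k. r i + s i)"
      using sum.permute[OF p, of s] by (simp add: sum.distrib o_def lessThan_atLeast0)
    ultimately show "polyfun V (\<Sum>i<k. r i + s i) (\<lambda>z. \<Prod>i = 0..<k. F i (p i) z)" by simp
  qed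
qed

text \<open>Both determinants are expanded along the last row. Deleting that row removes the only
  entry in which the matrices differ, so all cofactors agree.\<close>

lemma det_corner:
  fixes f g :: "nat \<Rightarrow> nat \<Rightarrow> 'a::comm_ring_1"
  assumes "\<And>i j. i \<le> k \<Longrightarrow> j \<le> k \<Longrightarrow> (i, j) \<noteq> (k, k) \<Longrightarrow> f i j = g i j"
  shows "det (mat (Suc k) (Suc k) (\<lambda>(i, j). f i j)) =
    (f k k - g k k) * det (mat k k (\<lambda>(i, j). f i j)) + det (mat (Suc k) (Suc k) (\<lambda>(i, j). g i j))"
proof -
  let ?A = "mat (Suc k) (Suc k) (\<lambda>(i, j). f i j)" and ?B = "mat (Suc k) (Suc k) (\<lambda>(i, j). g i j)"
  have del: "mat_delete ?A k j = mat_delete ?B k j" if "j \<le> k" for j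
    by (rule eq_matI) (use that assms in \<open>auto simp: mat_delete_def\<close>)
  have corner: "mat_delete ?A k k = mat k k (\<lambda>(i, j). f i j)"
    by (rule eq_matI) (auto simp: mat_delete_def)
  have A: "det ?A = (\<Sum>j<k. f k j * cofactor ?A k j) + f k k * det (mat k k (\<lambda>(i, j). f i j))"
    by (subst laplace_expansion_row[of _ "Suc k" k]) (auto simp: cofactor_def corner simp flip: mult_2)
  have B: "det ?B = (\<Sum>j<k. g k j * cofactor ?B k j) + g k k * det (mat k k (\<lambda>(i, j). f i j))"
    by (subst laplace_expansion_row[of _ "Suc k" k])
       (auto simp: cofactor_def corner simp flip: mult_2 del)
  have "(\<Sum>j<k. f k j * cofactor ?A k j) = (\<Sum>j<k. g k j * cofactor ?B k j)"
    by (intro sum.cong) (auto simp: cofactor_def del assms)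
  with A B show ?thesis by (simp add: algebra_simps)
qed

text \<open>The index \<open>c + 2 * k + 2\<close> occurs only in the bottom right corner, so the
  determinant is linear in that variable and the smaller Hankel determinant is its
  coefficient.\<close>

lemma hankel_Suc:
  "hankel c (Suc k) z =
    z (c + 2 * k + 2) * hankel c k z + hankel c (Suc k) (z(c + 2 * k + 2 := 0))"
  unfolding hankel_def
  by (subst det_corner[where g = "\<lambda>i j. (z(c + 2 * k + 2 := 0)) (c + i + j)"])
     (auto simp: mult_2 add.assoc)

lemma polyfun_hankel: "polyfun {c..c + 2 * k} (\<Sum>i<Suc k. 1 + 0) (hankel c k)"
  unfolding hankel_def by (intro polyfun_det polyfun_var) auto

text \<open>The antidiagonal matrix separates consecutive Hankel determinants.\<close>

lemma hankel_antidiagonal: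
  fixes c k :: nat
  defines "z \<equiv> \<lambda>i. if i = c + Suc k then 1 else (0::real)"
  shows "hankel c k z = 0" "hankel c (Suc k) z \<noteq> 0"
proof -
  let ?A = "mat (Suc k) (Suc k) (\<lambda>(i, j). z (c + i + j))"
  \<comment> \<open>The first column has the indices c, ..., c + k, all outside the support of
    \<open>z\<close>.\<close>
  have "?A *\<^sub>v unit_vec (Suc k) 0 = 0\<^sub>v (Suc k)"
    by (rule eq_vecI) (auto simp: z_def)
  moreover have "unit_vec (Suc k) 0 \<noteq> (0\<^sub>v (Suc k) :: real vec)" by simp
  ultimately show "hankel c k z = 0"
    unfolding hankel_def by (subst det_0_iff_vec_prod_zero[of _ "Suc k"]) (auto intro!: exI[of _ "unit_vec (Suc k) 0"])
next
  let ?A = "mat (Suc (Suc k)) (Suc (Suc k)) (\<lambda>(i, j). z (c + i + j))"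
  \<comment> \<open>Here \<open>?A\<close> is the permutation matrix that reverses the order, an
    involution.\<close>
  have "?A * ?A = 1\<^sub>m (Suc (Suc k))"
  proof (rule eq_matI)
    fix i j assume "i < dim_row (1\<^sub>m (Suc (Suc k)) :: real mat)" "j < dim_col (1\<^sub>m (Suc (Suc k)) :: real mat)"
    then have ij: "i < Suc (Suc k)" "j < Suc (Suc k)" by auto
    have "(?A * ?A) $$ (i, j) = (\<Sum>l<Suc (Suc k). z (c + i + l) * z (c + l + j))"
      using ij by (auto simp: scalar_prod_def lessThan_atLeast0)
    also have "\<dots> = (\<Sum>l<Suc (Suc k). if l = Suc k - i then if i = j then 1 else 0 else 0)"
      by (intro sum.cong) (use ij in \<open>auto simp: z_def\<close>)
    also have "\<dots> = (if i = j then 1 else 0)" by (subst sum.delta) auto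
    finally show "(?A * ?A) $$ (i, j) = 1\<^sub>m (Suc (Suc k)) $$ (i, j)" using ij by simp
  qed auto
  then have "det ?A * det ?A = 1"
    using det_mult[of ?A "Suc (Suc k)" ?A] by (simp add: det_one)
  then show "hankel c (Suc k) z \<noteq> 0" unfolding hankel_def by auto
qed

text \<open>Pseudo-division by a polynomial that is linear in the variable \<open>v\<close>.\<close>

lemma linear_reduction:
  fixes a b f :: mpoly
  assumes "pvars f \<subseteq> insert v V" "pvars a \<subseteq> V" "pvars b \<subseteq> V"
  shows "\<exists>D g. pvars g \<subseteq> V \<and> (pvar v * a + b) dvd (a ^ D * f - g)"
  using assms(1)
proof (induction rule: mpoly_induct)
  case (const c)
  show ?case by (intro exI[of _ 0] exI[of _ "pconst c"]) auto
next
  case (var i)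
  show ?case
  proof (cases "i = v")
    case True
    have "pvars (- b) \<subseteq> V" using assms(3) by (simp add: pvars_def)
    then show ?thesis using True
      by (intro exI[of _ 1] exI[of _ "- b"]) (auto simp: algebra_simps)
  next
    case False
    then show ?thesis using var by (intro exI[of _ 0] exI[of _ "pvar i"]) auto
  qed
next
  case (add p q)
  let ?H = "pvar v * a + b"
  obtain D g E h where *: "pvars g \<subseteq> V" "?H dvd a ^ D * p - g" "pvars h \<subseteq> V" "?H dvd a ^ E * q - h"
    using add by blast
  have pw: "pvars (a ^ k) \<subseteq> V" for k
    by (induction k) (use assms(2) pvars_mult[of a] pvars_const[of 1] in \<open>auto simp: pconst_1\<close>)
  have "a ^ (D + E) * (p + q) - (a ^ E * g + a ^ D * h)
      = a ^ E * (a ^ D * p - g) + a ^ D * (a ^ E * q - h)"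
    by (simp add: algebra_simps power_add)
  moreover have "pvars (a ^ E * g + a ^ D * h) \<subseteq> V"
    using pvars_add[of "a ^ E * g" "a ^ D * h"] pvars_mult[of "a ^ E" g] pvars_mult[of "a ^ D" h] pw *(1,3)
    by blast
  ultimately show ?case using *(2,4) by (metis dvd_add dvd_mult)
next
  case (mult p q)
  let ?H = "pvar v * a + b"
  obtain D g E h where *: "pvars g \<subseteq> V" "?H dvd a ^ D * p - g" "pvars h \<subseteq> V" "?H dvd a ^ E * q - h"
    using mult by blast
  have "a ^ (D + E) * (p * q) - g * h = (a ^ E * q) * (a ^ D * p - g) + g * (a ^ E * q - h)"
    by (simp add: algebra_simps power_add)
  moreover have "pvars (g * h) \<subseteq> V" using pvars_mult[of g h] *(1,3) by blast
  ultimately show ?case using *(2,4) by (metis dvd_add dvd_mult)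
qed

text \<open>\<open>pvar v * a + b\<close> vanishes at \<open>- b / a\<close>.\<close>

lemma linear_dvd_imp_0:
  fixes a b g :: mpoly
  assumes "(pvar v * a + b) dvd g" "pvars g \<subseteq> V" "v \<notin> V" "pvars a \<subseteq> V" "pvars b \<subseteq> V" "a \<noteq> 0"
  shows "g = 0"
proof -
  have "peval (a * g) z = 0" for z
  proof (cases "peval a z = 0")
    case False
    define z' where "z' = z(v := - peval b z / peval a z)"
    have z': "peval p z' = peval p z" if "pvars p \<subseteq> V" for p
      using that assms(3) by (intro peval_cong[of _ V]) (auto simp: z'_def)
    have "peval (pvar v * a + b) z' = 0"
      using z'[OF assms(4)] z'[OF assms(5)] False by (simp add: z'_def)
    then have "peval g z' = 0" using assms(1) by (auto elim!: dvdE)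
    then show ?thesis using z'[OF assms(2)] by simp
  qed simp
  then have "a * g = 0" by (rule mpoly_eq_0_if_peval_0)
  then show ?thesis using assms(6) by simp
qed

lemma dvd_power_cancel:
  fixes H a f :: mpoly
  assumes "\<And>f. H dvd a * f \<Longrightarrow> H dvd f" "H dvd a ^ D * f"
  shows "H dvd f"
  using assms(2)
proof (induction D)
  case (Suc D)
  have "H dvd a * (a ^ D * f)" using Suc.prems by (simp add: mult.assoc)
  then show ?case by (rule Suc.IH[OF assms(1)])
qed simp

text \<open>Up to a power of \<open>a\<close>, every polynomial is congruent modulo \<open>H\<close>
  to one without \<open>v\<close>. If \<open>H\<close> divides a product of two such polynomials,
  the product is 0, hence one of them is; \<open>cancel\<close> then removes the power of
  \<open>a\<close>.\<close>

lemma prime_linear: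
  fixes a b :: mpoly and v :: nat
  defines "H \<equiv> pvar v * a + b"
  assumes V: "v \<notin> V" "pvars a \<subseteq> V" "pvars b \<subseteq> V" "a \<noteq> 0"
    and cancel: "\<And>f. H dvd a * f \<Longrightarrow> H dvd f"
  shows "prime_elem H"
proof (rule prime_elemI)
  show "H \<noteq> 0"
  proof
    assume "H = 0"
    obtain z where z: "peval a z \<noteq> 0" using \<open>a \<noteq> 0\<close> mpoly_eq_0_if_peval_0 by blast
    \<comment> \<open>Solved for the variable \<open>v\<close> so that \<open>H\<close> takes the
      value 1.\<close>
    define z' where "z' = z(v := (1 - peval b z) / peval a z)"
    have "peval p z' = peval p z" if "pvars p \<subseteq> V" for p
      using that V by (intro peval_cong[of _ V]) (auto simp: z'_def)
    then have "peval H z' = 1" using V z by (simp add: H_def z'_def)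
    with \<open>H = 0\<close> show False by simp
  qed
  show "\<not> H dvd 1"
    using linear_dvd_imp_0[of v a b 1 V] V pvars_const[of 1] unfolding H_def by (auto simp: pconst_1)
next
  fix f g assume fg: "H dvd f * g"
  have red: "\<exists>D f'. pvars f' \<subseteq> UNIV - {v} \<and> H dvd a ^ D * f - f'" for f
    unfolding H_def by (rule linear_reduction) (use V in auto)
  obtain D f' where f': "pvars f' \<subseteq> UNIV - {v}" "H dvd a ^ D * f - f'" using red by blast
  obtain E g' where g': "pvars g' \<subseteq> UNIV - {v}" "H dvd a ^ E * g - g'" using red by blast
  have "f' * g' = a ^ (D + E) * (f * g) - a ^ E * g * (a ^ D * f - f') - f' * (a ^ E * g - g')"
    by (simp add: algebra_simps power_add)
  then have "H dvd f' * g'" using fg f'(2) g'(2) by (metis dvd_diff dvd_mult)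
  then have "f' * g' = 0" unfolding H_def
    by (rule linear_dvd_imp_0[where V = "UNIV - {v}"])
       (use V f'(1) g'(1) pvars_mult[of f' g'] in auto)
  then have "f' = 0 \<or> g' = 0" by simp
  then have "H dvd a ^ D * f \<or> H dvd a ^ E * g" using f'(2) g'(2) by auto
  moreover have "H dvd a ^ i * p \<Longrightarrow> H dvd p" for i p
    by (rule dvd_power_cancel[where H = H and a = a and f = p and D = i]) (erule cancel, assumption)
  ultimately show "H dvd f \<or> H dvd g" by metis
qed

text \<open>The last conjunct is the cancellation property that \<open>prime_linear\<close> needs.
  It passes to the next size because the new \<open>a\<close> is the polynomial of the previous
  size, which is prime: if it divides H * q, it divides q unless it divides H. For
  \<open>k = 0\<close> the coefficient \<open>a\<close> is 1.\<close>

lemma hankel_linear: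
  "\<exists>a b. pvars a \<subseteq> {c..<c + 2 * k} \<and> pvars b \<subseteq> {c..<c + 2 * k} \<and> a \<noteq> 0 \<and>
     peval (pvar (c + 2 * k) * a + b) = hankel c k \<and>
     (\<forall>f. (pvar (c + 2 * k) * a + b) dvd a * f \<longrightarrow> (pvar (c + 2 * k) * a + b) dvd f)"
proof (induction k)
  case 0
  show ?case
  proof (rule exI[of _ 1], rule exI[of _ 0], intro conjI)
    show "pvars 1 \<subseteq> {c..<c + 2 * 0}" using pvars_const[of 1] by (simp add: pconst_1)
    show "pvars 0 \<subseteq> {c..<c + 2 * 0}" by (simp add: pvars_def)
    show "peval (pvar (c + 2 * 0) * 1 + 0) = hankel c 0"
      by (auto simp: fun_eq_iff hankel_def det_single)
  qed auto
next
  case (Suc k)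
  obtain a' b' where IH: "pvars a' \<subseteq> {c..<c + 2 * k}" "pvars b' \<subseteq> {c..<c + 2 * k}" "a' \<noteq> 0"
    "peval (pvar (c + 2 * k) * a' + b') = hankel c k"
    "\<forall>f. (pvar (c + 2 * k) * a' + b') dvd a' * f \<longrightarrow> (pvar (c + 2 * k) * a' + b') dvd f"
    using Suc by (elim exE conjE) (rule that; assumption)
  define a where "a = pvar (c + 2 * k) * a' + b'"
  let ?V = "{c..<c + 2 * Suc k}" and ?v = "c + 2 * Suc k"
  have "prime_elem a" unfolding a_def
    by (rule prime_linear[OF _ IH(1-3) IH(5)[rule_format]]) auto
  have a: "peval a = hankel c k" using IH(4) by (simp add: a_def)
  have pa: "pvars a \<subseteq> ?V"
    unfolding a_def using pvars_add[of "pvar (c + 2 * k) * a'" b'] pvars_mult[of "pvar (c + 2 * k)" a'] IH(1,2)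
    by fastforce
  obtain B where B: "pvars B \<subseteq> {c..c + 2 * Suc k}" "\<And>z. peval B z = hankel c (Suc k) z"
    using polyfun_hankel[of c "Suc k"] by (elim polyfunE) blast
  \<comment> \<open>The remaining part \<open>b\<close> is the Hankel polynomial with its corner
    variable set to 0.\<close>
  have "\<exists>d. polyfun ?V d (\<lambda>z. peval B (\<lambda>i. if i = ?v then 0 else z i))"
  proof (rule polyfun_compose[OF B(1)])
    fix i assume "i \<in> {c..c + 2 * Suc k}"
    then show "\<exists>d. polyfun ?V d (\<lambda>z. if i = ?v then 0 else z i)"
      by (cases "i = ?v") (auto intro!: exI[of _ 1] polyfun_const polyfun_var)
  qed
  then obtain b where b: "pvars b \<subseteq> ?V" "\<And>z. peval b z = peval B (\<lambda>i. if i = ?v then 0 else z i)"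
    by (auto elim: polyfunE)
  have b': "peval b z = hankel c (Suc k) (z(c + 2 * k + 2 := 0))" for z
    unfolding b(2) B(2) by (rule arg_cong[where f = "hankel c (Suc k)"]) auto
  let ?H = "pvar ?v * a + b"
  have H: "peval ?H = hankel c (Suc k)"
  proof
    fix z show "peval ?H z = hankel c (Suc k) z"
      by (subst hankel_Suc) (simp add: a b')
  qed
  have "?H dvd f" if dvd: "?H dvd a * f" for f
  proof -
    obtain q where q: "a * f = ?H * q" using dvd unfolding dvd_def by blast
    have "a dvd ?H * q" unfolding q[symmetric] by (rule dvd_triv_left)
    from prime_elem_dvd_multD[OF \<open>prime_elem a\<close> this] consider "a dvd ?H" | "a dvd q" by (elim disjE)
    then show ?thesis
    proof cases
      \<comment> \<open>Excluded: at the antidiagonal point the smaller determinant vanishes and the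
        larger one does not.\<close>
      case 1
      then obtain w where "?H = a * w" unfolding dvd_def by blast
      then have "hankel c (Suc k) z = hankel c k z * peval w z" for z
        by (metis H a peval_mult)
      from this[of "\<lambda>i. if i = c + Suc k then 1 else 0"] show ?thesis
        using hankel_antidiagonal[of c k] by simp
    next
      case 2
      then obtain q' where "q = a * q'" unfolding dvd_def by blast
      with q have "a * f = a * (?H * q')" by (simp only: mult.left_commute)
      moreover have "a \<noteq> 0" using \<open>prime_elem a\<close> by auto
      ultimately have "f = ?H * q'" using mult_left_cancel by blast
      then show ?thesis by (rule dvdI)
    qed
  qed
  then have "\<forall>f. ?H dvd a * f \<longrightarrow> ?H dvd f" by (intro allI impI)
  moreover have "a \<noteq> 0" using \<open>prime_elem a\<close> by auto
  ultimately have *: "pvars a \<subseteq> ?V \<and> pvars b \<subseteq> ?V \<and> a \<noteq> 0 \<and> peval ?H = hankel c (Suc k) \<and>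
      (\<forall>f. ?H dvd a * f \<longrightarrow> ?H dvd f)"
    using pa b(1) H by (intro conjI)
  show ?case by (rule exI[where x = a], rule exI[where x = b], rule *)
qed

text \<open>In the application \<open>Z\<close> consists of the points with coordinates A 1, ..., A
  n that come from the parameterization. The last premise says that no nonzero polynomial in the
  first \<open>n - 1\<close> coordinates vanishes on \<open>Z\<close>; it forces the remainder of
  the pseudo-division to be 0.\<close>

lemma hankel_generates:
  assumes c: "1 \<le> c" and n: "n = c + 2 * k"
  obtains h where "pvars h \<subseteq> {1..n}" "peval h = hankel c k"
    "\<And>f Z. pvars f \<subseteq> {1..n} \<Longrightarrow> \<forall>z\<in>Z. peval f z = 0 \<Longrightarrow> \<forall>z\<in>Z. hankel c k z = 0 \<Longrightarrow>
       (\<And>g. pvars g \<subseteq> {1..<n} \<Longrightarrow> \<forall>z\<in>Z. peval g z = 0 \<Longrightarrow> g = 0) \<Longrightarrow>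
       \<exists>q. pvars q \<subseteq> {1..n} \<and> f = q * h"
proof -
  obtain a b where ab: "pvars a \<subseteq> {c..<n}" "pvars b \<subseteq> {c..<n}" "a \<noteq> 0"
    "peval (pvar n * a + b) = hankel c k"
    and cancel: "\<forall>f. (pvar n * a + b) dvd a * f \<longrightarrow> (pvar n * a + b) dvd f"
    using hankel_linear[of c k, folded n] by (elim exE conjE) (rule that; assumption)
  let ?h = "pvar n * a + b"
  have sub: "{c..<n} \<subseteq> {1..<n}" using c by auto
  have h: "pvars ?h \<subseteq> {1..n}"
    using pvars_add[of "pvar n * a" b] pvars_mult[of "pvar n" a] ab(1,2) c n by fastforce
  show ?thesis
  proof (rule that[OF h ab(4)])
    fix f Z
    assume f: "pvars f \<subseteq> {1..n}" "\<forall>z\<in>Z. peval f z = 0" "\<forall>z\<in>Z. hankel c k z = 0"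
      and dense: "\<And>g. pvars g \<subseteq> {1..<n} \<Longrightarrow> \<forall>z\<in>Z. peval g z = 0 \<Longrightarrow> g = 0"
    have "\<exists>D g. pvars g \<subseteq> {1..<n} \<and> ?h dvd (a ^ D * f - g)"
      by (rule linear_reduction) (use f(1) ab(1,2) sub n c in auto)
    then obtain D g where g: "pvars g \<subseteq> {1..<n}" "?h dvd (a ^ D * f - g)" by blast
    then obtain q where "a ^ D * f - g = ?h * q" unfolding dvd_def by blast
    then have q: "g = a ^ D * f - ?h * q" by (simp add: algebra_simps)
    have "g = 0"
    proof (rule dense[OF g(1)], rule ballI)
      fix z assume z: "z \<in> Z"
      have "peval g z = peval a z ^ D * peval f z - peval ?h z * peval q z"
        unfolding q by (simp only: peval_diff peval_mult peval_power)
      then show "peval g z = 0" using f(2,3) z unfolding ab(4) by simp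
    qed
    with g(2) have "?h dvd a ^ D * f" by simp
    then have "?h dvd f" by (rule dvd_power_cancel[rotated]) (rule cancel[rule_format])
    then obtain w where w: "f = ?h * w" unfolding dvd_def by blast
    \<comment> \<open>The quotient \<open>w\<close> might contain other variables. Setting them to 0
      does not affect the product, since \<open>f\<close> and \<open>?h\<close> only involve
      \<open>1..n\<close>.\<close>
    have "\<exists>d. polyfun {1..n} d (\<lambda>z. peval w (\<lambda>i. if i \<in> {1..n} then z i else 0))"
      proof (rule polyfun_compose[of _ UNIV])
      fix i :: nat
      show "\<exists>d. polyfun {1..n} d (\<lambda>z. if i \<in> {1..n} then z i else 0)"
        by (cases "i \<in> {1..n}") (auto intro!: exI[of _ 1] polyfun_const polyfun_var)
    qed simp
    then obtain w' where w': "pvars w' \<subseteq> {1..n}"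
      "\<And>z. peval w' z = peval w (\<lambda>i. if i \<in> {1..n} then z i else 0)" by (auto elim: polyfunE)
    have "f = w' * ?h"
    proof (rule mpoly_eqI)
      fix z :: "nat \<Rightarrow> real"
      let ?z = "\<lambda>i. if i \<in> {1..n} then z i else 0"
      have "peval f z = peval f ?z" by (rule peval_cong[OF f(1)]) auto
      also have "\<dots> = peval ?h ?z * peval w ?z" unfolding w by (rule peval_mult)
      also have "peval ?h ?z = peval ?h z" by (rule peval_cong[OF h]) auto
      finally show "peval f z = peval (w' * ?h) z" unfolding peval_mult w'(2) by (simp only: mult.commute)
    qed
    with w'(1) show "\<exists>q. pvars q \<subseteq> {1..n} \<and> f = q * ?h" by blast
  qed
qed

section \<open>Algebraic independence of signed power sums\<close>

lemma continuous_on_peval: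
  assumes "\<And>i. continuous_on S (\<lambda>u. \<gamma> u i)"
  shows "continuous_on S (\<lambda>u. peval p (\<gamma> u))"
  unfolding peval_def by (intro continuous_intros assms)

definition psum :: "nat \<Rightarrow> (nat \<Rightarrow> real) \<Rightarrow> (nat \<Rightarrow> real) \<Rightarrow> nat \<Rightarrow> real" where
  "psum N \<epsilon> s k = (\<Sum>q=1..N. \<epsilon> q * s q ^ k)"

text \<open>For injective \<open>s\<close>, differentiating the relation g (p 1, ..., p N) = 0 with
  respect to \<open>s i\<close> says that the polynomial \<open>Q\<close> with the coefficients k *
  (partial derivative k of g) is zero at \<open>s i\<close>. It has N distinct roots and degree
  below N, so all partial derivatives of \<open>g\<close> vanish at the power sums as well: the set
  \<open>J\<close> of relations is closed under \<open>pd\<close>.\<close>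

lemma psum_independent:
  assumes \<epsilon>: "\<And>q. q \<in> {1..N} \<Longrightarrow> \<epsilon> q \<noteq> 0"
    and g: "pvars g \<subseteq> {1..N}" "\<And>s. peval g (psum N \<epsilon> s) = 0"
  shows "g = 0"
proof -
  define J where "J = {g. pvars g \<subseteq> {1..N} \<and> (\<forall>s. inj_on s {1..N} \<longrightarrow> peval g (psum N \<epsilon> s) = 0)}"
  show ?thesis
  proof (rule mpoly_eq_0_if_pd_closed[of g J "{1..N}"])
    show "g \<in> J" using g by (simp add: J_def)
    show "pvars q \<subseteq> {1..N}" if "q \<in> J" for q using that by (simp add: J_def)
  next
    fix q k assume q: "q \<in> J" and k: "k \<in> {1..N}"
    have "peval (pd k q) (psum N \<epsilon> s) = 0" if s: "inj_on s {1..N}" for s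
    proof -
      define c where "c k = peval (pd k q) (psum N \<epsilon> s)" for k
      define Q where "Q = (\<Sum>k=1..N. monom (c k * real k) (k - 1))"
      have root: "poly Q (s i) = 0" if i: "i \<in> {1..N}" for i
      proof -
        define \<gamma> where "\<gamma> u = psum N \<epsilon> (s(i := u))" for u
        have \<gamma>: "\<gamma> (s i) = psum N \<epsilon> s" by (simp add: \<gamma>_def)
        have d\<gamma>: "((\<lambda>u. \<gamma> u k) has_real_derivative \<epsilon> i * (real k * s i ^ (k - 1))) (at (s i))" for k
        proof -
          have "\<gamma> u k = (\<Sum>q\<in>{1..N} - {i}. \<epsilon> q * s q ^ k) + \<epsilon> i * u ^ k" for u
            unfolding \<gamma>_def psum_def
            by (subst sum.remove[OF _ i]) (auto intro!: sum.cong)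
          then show ?thesis by (auto intro!: derivative_eq_intros)
        qed
        have "((\<lambda>u. peval q (\<gamma> u)) has_real_derivative
           (\<Sum>k\<in>{1..N}. peval (pd k q) (\<gamma> (s i)) * (\<epsilon> i * (real k * s i ^ (k - 1))))) (at (s i))"
          by (rule peval_chain_rule) (use q d\<gamma> in \<open>auto simp: J_def\<close>)
        \<comment> \<open>The relation is only known for injective \<open>s\<close>; injectivity
          persists as long as the i-th entry avoids the finitely many other values.\<close>
        moreover have "((\<lambda>u. peval q (\<gamma> u)) has_real_derivative 0) (at (s i))"
        proof (rule has_field_derivative_transform_within_open[of "\<lambda>_. 0"])
          show "open (- (s ` ({1..N} - {i})))" by (intro open_Compl finite_imp_closed) auto
          show "s i \<in> - (s ` ({1..N} - {i}))" using i inj_onD[OF s] by blast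
          fix u assume u: "u \<in> - (s ` ({1..N} - {i}))"
          have "inj_on (s(i := u)) {1..N}"
          proof (rule inj_onI)
            fix a b assume "a \<in> {1..N}" "b \<in> {1..N}" "(s(i := u)) a = (s(i := u)) b"
            then show "a = b" using u inj_onD[OF s, of a b] by (auto split: if_splits)
          qed
          then show "0 = peval q (\<gamma> u)" using q by (simp add: J_def \<gamma>_def)
        qed simp
        ultimately have "(\<Sum>k\<in>{1..N}. peval (pd k q) (\<gamma> (s i)) * (\<epsilon> i * (real k * s i ^ (k - 1)))) = 0"
          by (rule DERIV_unique)
        also have "(\<Sum>k\<in>{1..N}. peval (pd k q) (\<gamma> (s i)) * (\<epsilon> i * (real k * s i ^ (k - 1))))
            = \<epsilon> i * poly Q (s i)"
          by (simp add: Q_def poly_sum poly_monom sum_distrib_left \<gamma> c_def mult_ac)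
        finally show ?thesis using \<epsilon>[OF i] by simp
      qed
      have "Q = 0"
      proof (rule ccontr)
        assume "Q \<noteq> 0"
        have "degree Q \<le> N - 1" unfolding Q_def
          by (intro degree_sum_le) (auto intro: order_trans[OF degree_monom_le])
        moreover have "N = card (s ` {1..N})" using s by (simp add: card_image)
        moreover have "card (s ` {1..N}) \<le> card {x. poly Q x = 0}"
          by (rule card_mono) (use root \<open>Q \<noteq> 0\<close> poly_roots_finite in auto)
        moreover have "card {x. poly Q x = 0} \<le> degree Q"
          using \<open>Q \<noteq> 0\<close> by (rule card_poly_roots_bound)
        ultimately show False using k by simp
      qed
      have "coeff Q (k - 1) = (\<Sum>j=1..N. if j = k then c j * real j else 0)"
        unfolding Q_def coeff_sum by (intro sum.cong) (use k in auto)
      then have "coeff Q (k - 1) = c k * real k" using k by simp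
      then show ?thesis using \<open>Q = 0\<close> k by (simp add: c_def)
    qed
    then show "pd k q \<in> J" using q pvars_pd[of k q] by (auto simp: J_def)
  next
    fix q assume q: "q \<in> J"
    \<comment> \<open>The constant term is the value at s = 0, a tuple that need not be injective.
      It is the limit along the injective tuples \<tau> * (1, ..., N).\<close>
    define h where "h \<tau> = peval q (psum N \<epsilon> (\<lambda>i. \<tau> * real i))" for \<tau> :: real
    have "continuous_on UNIV h" unfolding h_def psum_def
      by (rule continuous_on_peval, intro continuous_intros)
    then have "isCont h 0" by (simp add: continuous_on_eq_continuous_at)
    then have "(\<lambda>n. h (inverse (real (Suc n)))) \<longlonglongrightarrow> h 0"
      using LIMSEQ_inverse_real_of_nat by (rule isCont_tendsto_compose)
    moreover have "h (inverse (real (Suc n))) = 0" for n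
      using q by (auto simp: h_def J_def inj_on_def)
    ultimately have "(\<lambda>n::nat. 0::real) \<longlonglongrightarrow> h 0" by (simp only:)
    then have "h 0 = 0" by (simp add: LIMSEQ_const_iff)
    moreover have "h 0 = peval q (\<lambda>_. 0)" unfolding h_def
      by (rule peval_cong[of _ "{1..N}"]) (use q in \<open>auto simp: J_def psum_def power_0_left\<close>)
    ultimately show "Poly_Mapping.lookup q 0 = 0" by (simp add: peval_at_0)
  qed
qed

text \<open>
  The first recursion expresses \<open>X * E' = - (\<Sum>k. l k * X ^ k) * E\<close> for
  \<open>E = exp (- \<Sum>k. l k / k * X ^ k)\<close>; the second one solves it for \<open>l\<close>.
\<close>

fun Aseq :: "(nat \<Rightarrow> real) \<Rightarrow> nat \<Rightarrow> real" where
  "Aseq l 0 = 1"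
| "Aseq l (Suc k) = - (\<Sum>i\<le>k. l (Suc i) * Aseq l (k - i)) / real (Suc k)"

fun Lseq :: "(nat \<Rightarrow> real) \<Rightarrow> nat \<Rightarrow> real" where
  "Lseq a 0 = 0"
| "Lseq a (Suc k) = - (real (Suc k) * a (Suc k)) - (\<Sum>i<k. Lseq a (Suc i) * a (k - i))"

declare Aseq.simps(2) [simp del] Lseq.simps(2) [simp del]

lemma Aseq_cong: "(\<And>i. 1 \<le> i \<Longrightarrow> i \<le> k \<Longrightarrow> l i = l' i) \<Longrightarrow> Aseq l k = Aseq l' k"
proof (induction k rule: less_induct)
  case (less k)
  then show ?case by (cases k) (auto simp: Aseq.simps(2) intro!: sum.cong)
qed

lemma Aseq_Lseq: "1 \<le> k \<Longrightarrow> Aseq (Lseq a) k = a k"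
proof (induction k rule: less_induct)
  case (less k)
  then obtain k' where k: "k = Suc k'" by (cases k) auto
  have "(\<Sum>i\<le>k'. Lseq a (Suc i) * Aseq (Lseq a) (k' - i))
      = (\<Sum>i<k'. Lseq a (Suc i) * Aseq (Lseq a) (k' - i)) + Lseq a (Suc k')"
    by (simp flip: lessThan_Suc_atMost)
  also have "(\<Sum>i<k'. Lseq a (Suc i) * Aseq (Lseq a) (k' - i)) = (\<Sum>i<k'. Lseq a (Suc i) * a (k' - i))"
    by (intro sum.cong) (auto simp: less.IH k)
  finally show ?case by (simp add: k Aseq.simps(2) Lseq.simps(2)[of a k'] del: of_nat_Suc)
qed

lemma Lseq_Aseq: "1 \<le> k \<Longrightarrow> Lseq (Aseq l) k = l k"
proof (induction k rule: less_induct)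
  case (less k)
  then obtain k' where k: "k = Suc k'" by (cases k) auto
  have "(\<Sum>i\<le>k'. l (Suc i) * Aseq l (k' - i)) = (\<Sum>i<k'. l (Suc i) * Aseq l (k' - i)) + l (Suc k')"
    by (simp flip: lessThan_Suc_atMost)
  moreover have "(\<Sum>i<k'. Lseq (Aseq l) (Suc i) * Aseq l (k' - i)) = (\<Sum>i<k'. l (Suc i) * Aseq l (k' - i))"
    by (intro sum.cong) (auto simp: less.IH k)
  ultimately show ?case by (simp add: k Aseq.simps(2)[of l k'] Lseq.simps(2)[of _ k'] del: of_nat_Suc)
qed

text \<open>Each unfolding of the recursion produces one factor of degree 1 and lowers the index by
  at least 1, so the degree is bounded by the index.\<close>

lemma polyfun_Aseq:
  assumes "\<And>i. 1 \<le> i \<Longrightarrow> i \<le> k \<Longrightarrow> polyfun V 1 (\<lambda>z. L z i)"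
  shows "polyfun V k (\<lambda>z. Aseq (L z) k)"
  using assms
proof (induction k rule: less_induct)
  case (less k)
  show ?case
  proof (cases k)
    case 0
    then show ?thesis by (simp add: polyfun_const)
  next
    case (Suc k')
    have "polyfun V k (\<lambda>z. (- 1 / real (Suc k')) * (\<Sum>i\<le>k'. L z (Suc i) * Aseq (L z) (k' - i)))"
    proof (intro polyfun_cmult polyfun_sum)
      fix i assume i: "i \<in> {..k'}"
      have "polyfun V (1 + (k' - i)) (\<lambda>z. L z (Suc i) * Aseq (L z) (k' - i))"
        using i Suc by (intro polyfun_mult less) auto
      then show "polyfun V k (\<lambda>z. L z (Suc i) * Aseq (L z) (k' - i))"
        by (rule polyfun_mono) (use Suc in auto)
    qed
    then show ?thesis by (simp add: Suc Aseq.simps(2))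
  qed
qed

lemma polyfun_Lseq: "\<exists>d. polyfun {1..k} d (\<lambda>z. Lseq z k)"
proof (induction k rule: less_induct)
  case (less k)
  show ?case
  proof (cases k)
    case 0
    then show ?thesis by (auto intro: polyfun_const)
  next
    case (Suc k')
    have "\<exists>d. \<forall>i<k'. polyfun {1..Suc i} (d i) (\<lambda>z. Lseq z (Suc i))"
      using less.IH Suc by (intro choice) auto
    then obtain d where d: "\<And>i. i < k' \<Longrightarrow> polyfun {1..Suc i} (d i) (\<lambda>z. Lseq z (Suc i))" by blast
    define D where "D = 1 + (\<Sum>i<k'. d i)"
    have "polyfun {1..k} (D + 1) (\<lambda>z. (- real (Suc k')) * z (Suc k') + (\<Sum>i<k'. (- 1) * (Lseq z (Suc i) * z (k' - i))))"
    proof (intro polyfun_add polyfun_cmult polyfun_sum polyfun_mult)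
      show "polyfun {1..k} (D + 1) (\<lambda>z. z (Suc k'))" using Suc by (intro polyfun_var) auto
      fix i assume i: "i \<in> {..<k'}"
      have "d i \<le> (\<Sum>i<k'. d i)" using i by (intro member_le_sum) auto
      then show "polyfun {1..k} D (\<lambda>z. Lseq z (Suc i))"
        using i Suc by (intro polyfun_mono[OF d]) (auto simp: D_def)
      show "polyfun {1..k} 1 (\<lambda>z. z (k' - i))" using i Suc by (intro polyfun_var) auto
    qed
    moreover have "Lseq z k = (- real (Suc k')) * z (Suc k') + (\<Sum>i<k'. (- 1) * (Lseq z (Suc i) * z (k' - i)))" for z
      by (simp add: Suc Lseq.simps(2)[of _ k'] sum_negf algebra_simps)
    ultimately show ?thesis by (simp only:) blast
  qed
qed

text \<open>The map from \<open>l\<close> to \<open>Aseq l\<close> is polynomial, so a relation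
  between the coefficients gives one between the power sums. Its right inverse \<open>Lseq\<close>
  shows that a nonzero relation stays nonzero.\<close>

lemma Aseq_psum_independent:
  assumes \<epsilon>: "\<And>q. q \<in> {1..N} \<Longrightarrow> \<epsilon> q \<noteq> 0"
    and g: "pvars g \<subseteq> {1..N}" "\<And>s. peval g (Aseq (psum N \<epsilon> s)) = 0"
  shows "g = 0"
proof -
  have "\<exists>d. polyfun {1..N} d (\<lambda>l. peval g (\<lambda>i. Aseq l i))"
    by (rule polyfun_compose[OF g(1)])
       (auto intro!: exI[where x = "_ :: nat"] polyfun_Aseq[where L = "\<lambda>z. z"] polyfun_var)
  then obtain g' where g': "pvars g' \<subseteq> {1..N}" "\<And>l. peval g' l = peval g (Aseq l)"
    by (auto elim: polyfunE)
  have "g' = 0" by (rule psum_independent[OF \<epsilon> g'(1)]) (auto simp: g' g(2))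
  show ?thesis
  proof (rule mpoly_eq_0_if_peval_0)
    fix z
    have "peval g z = peval g (Aseq (Lseq z))"
      by (rule peval_cong[OF g(1)]) (auto simp: Aseq_Lseq)
    then show "peval g z = 0" using g'(2)[of "Lseq z"] \<open>g' = 0\<close> by simp
  qed
qed

section \<open>Hankel determinants of rational power series\<close>

no_notation Matrix.vec_index (infixl \<open>$\<close> 100)
no_notation Finite_Cartesian_Product.vec_nth (infixl \<open>$\<close> 90)
notation fps_nth (infixl \<open>$\<close> 75)

text \<open>Coefficient k of the equation for the difference \<open>D\<close> reads k * D k = (sum
  of C i * D (k - i)), where the term i = 0 is absent; so \<open>D\<close> vanishes coefficient by
  coefficient.\<close>

lemma fps_X_deriv_unique:
  fixes F G C :: "real fps"
  assumes "fps_X * fps_deriv F = C * F" "fps_X * fps_deriv G = C * G" "C $ 0 = 0" "F $ 0 = G $ 0"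
  shows "F = G"
proof -
  define D where "D = F - G"
  have D: "fps_X * fps_deriv D = C * D" using assms(1,2) by (simp add: D_def algebra_simps)
  have "D $ k = 0" for k
  proof (induction k rule: less_induct)
    case (less k)
    show ?case
    proof (cases k)
      case 0
      then show ?thesis using assms(4) by (simp add: D_def)
    next
      case (Suc k')
      have "real k * D $ k = (fps_X * fps_deriv D) $ k" by (simp add: Suc)
      also have "\<dots> = (\<Sum>i=0..k. C $ i * D $ (k - i))" by (simp add: D fps_mult_nth)
      also have "\<dots> = 0"
      proof (rule sum.neutral, rule ballI)
        fix i assume "i \<in> {0..k}"
        then show "C $ i * D $ (k - i) = 0"
          using less.IH[of "k - i"] assms(3) by (cases "i = 0") auto
      qed
      finally show ?thesis using Suc by simp
    qed
  qed
  then have "D = 0" by (simp add: fps_eq_iff)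
  then show ?thesis by (simp add: D_def)
qed

definition lin_fps :: "(nat \<Rightarrow> real) \<Rightarrow> nat set \<Rightarrow> real fps" where
  "lin_fps s I = (\<Prod>q\<in>I. 1 - fps_const (s q) * fps_X)"

text \<open>The entry at 0 is set to 0 because this series serves as the negated logarithmic
  derivative -X F' / F, which has no constant term.\<close>

definition psum_fps :: "(nat \<Rightarrow> real) \<Rightarrow> real fps" where
  "psum_fps l = Abs_fps (\<lambda>k. if k = 0 then 0 else l k)"

lemma psum_fps_nth: "psum_fps l $ k = (if k = 0 then 0 else l k)"
  by (simp add: psum_fps_def)

lemma psum_fps_add: "psum_fps (\<lambda>k. l k + l' k) = psum_fps l + psum_fps l'"
  by (simp add: fps_eq_iff psum_fps_nth)

lemma psum_fps_geometric: "psum_fps (\<lambda>k. x ^ k) * (1 - fps_const x * fps_X) = fps_const x * fps_X"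
proof -
  have "psum_fps (\<lambda>k. x ^ k) - fps_const x * (fps_X * psum_fps (\<lambda>k. x ^ k)) = fps_const x * fps_X"
  proof (rule fps_ext)
    fix k
    show "(psum_fps (\<lambda>k. x ^ k) - fps_const x * (fps_X * psum_fps (\<lambda>k. x ^ k))) $ k = (fps_const x * fps_X) $ k"
      by (cases k; cases "k - 1") (auto simp: psum_fps_nth)
  qed
  then show ?thesis by (simp add: algebra_simps)
qed

text \<open>Newton's identities as a logarithmic derivative: each factor contributes its own
  geometric series.\<close>

lemma lin_fps_deriv:
  assumes "finite I"
  shows "fps_X * fps_deriv (lin_fps s I) = - psum_fps (\<lambda>k. \<Sum>q\<in>I. s q ^ k) * lin_fps s I"
  using assms
proof (induction I rule: finite_induct)
  case empty
  have "psum_fps (\<lambda>k. 0) = 0" by (simp add: fps_eq_iff psum_fps_nth)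
  then show ?case by (simp add: lin_fps_def)
next
  case (insert q I)
  let ?w = "1 - fps_const (s q) * fps_X" and ?W = "lin_fps s I"
  let ?P = "psum_fps (\<lambda>k. \<Sum>q\<in>I. s q ^ k)" and ?p = "psum_fps (\<lambda>k. s q ^ k)"
  have W: "lin_fps s (insert q I) = ?w * ?W" using insert by (simp add: lin_fps_def)
  have P: "psum_fps (\<lambda>k. \<Sum>q\<in>insert q I. s q ^ k) = ?p + ?P"
    using insert by (simp add: psum_fps_add)
  have "fps_X * fps_deriv (?w * ?W) = ?w * (fps_X * fps_deriv ?W) + fps_X * fps_deriv ?w * ?W"
    unfolding fps_deriv_mult by (simp only: algebra_simps)
  also have "fps_X * fps_deriv ?w = - (?p * ?w)"
    unfolding psum_fps_geometric by (simp add: mult.commute)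
  finally show ?case unfolding W P insert.IH by (simp add: algebra_simps)
qed

lemma lin_fps_nth_0: "finite I \<Longrightarrow> lin_fps s I $ 0 = 1"
  by (induction I rule: finite_induct) (auto simp: lin_fps_def)

lemma lin_fps_nth_beyond: "finite I \<Longrightarrow> card I < k \<Longrightarrow> lin_fps s I $ k = 0"
proof (induction I arbitrary: k rule: finite_induct)
  case empty
  then show ?case by (simp add: lin_fps_def)
next
  case (insert q I)
  then obtain k' where k: "k = Suc k'" by (cases k) auto
  have "lin_fps s (insert q I) = lin_fps s I - fps_const (s q) * (fps_X * lin_fps s I)"
    using insert by (simp add: lin_fps_def algebra_simps)
  then have "lin_fps s (insert q I) $ k = lin_fps s I $ k - s q * (fps_X * lin_fps s I) $ k"
    by (metis fps_mult_left_const_nth fps_sub_nth)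
  then show ?case using insert k by simp
qed

lemma Aseq_fps_deriv: "fps_X * fps_deriv (Abs_fps (Aseq l)) = - psum_fps l * Abs_fps (Aseq l)"
proof (rule fps_ext)
  fix k
  show "(fps_X * fps_deriv (Abs_fps (Aseq l))) $ k = (- psum_fps l * Abs_fps (Aseq l)) $ k"
  proof (cases k)
    case 0
    then show ?thesis by (simp add: psum_fps_nth)
  next
    case (Suc k')
    have "(psum_fps l * Abs_fps (Aseq l)) $ Suc k' = (\<Sum>i\<le>k'. l (Suc i) * Aseq l (k' - i))"
      by (simp add: fps_mult_nth psum_fps_nth sum.atLeast0_atMost_Suc_shift atMost_atLeast0 del: sum.cl_ivl_Suc)
    moreover have "(fps_X * fps_deriv (Abs_fps (Aseq l))) $ Suc k' = real (Suc k') * Aseq l (Suc k')"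
      by simp
    ultimately show ?thesis unfolding Suc by (simp add: Aseq.simps(2)[of l k'] del: of_nat_Suc)
  qed
qed

text \<open>Exponential and recursion solve the same differential equation with constant term 1.
  Beyond \<open>n\<close> the exponent has no terms, so \<open>l\<close> is cut off there.\<close>

lemma exp_coeff_Aseq:
  "fps_nth (fps_compose (fps_exp 1) (- (\<Sum>k=1..n. fps_const (l k / real k) * fps_X ^ k))) i
     = Aseq (\<lambda>k. if k \<le> n then l k else 0) i"
proof -
  define b where "b = - (\<Sum>k=1..n. fps_const (l k / real k) * fps_X ^ k :: real fps)"
  define E where "E = fps_compose (fps_exp 1) b"
  have b0: "b $ 0 = 0" by (auto simp: b_def fps_sum_nth)
  have nth: "(\<Sum>k=1..n. fps_const (l k / real k) * fps_X ^ k) $ j = (if j \<in> {1..n} then l j / real j else 0)" for j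
    by (auto simp: fps_sum_nth fps_X_power_nth if_distrib[of "\<lambda>x. _ * x"] sum.delta cong: if_cong)
  have b_nth: "b $ j = (if j \<in> {1..n} then - (l j / real j) else 0)" for j
    unfolding b_def fps_neg_nth nth by simp
  have "fps_X * fps_deriv b = - psum_fps (\<lambda>k. if k \<le> n then l k else 0)"
  proof (rule fps_ext)
    fix j
    show "(fps_X * fps_deriv b) $ j = (- psum_fps (\<lambda>k. if k \<le> n then l k else 0)) $ j"
      by (cases j) (auto simp: b_nth psum_fps_nth simp del: of_nat_Suc)
  qed
  moreover have "fps_deriv E = E * fps_deriv b"
    unfolding E_def by (simp add: fps_compose_deriv[OF b0])
  ultimately have "fps_X * fps_deriv E = - psum_fps (\<lambda>k. if k \<le> n then l k else 0) * E"
    by (metis mult.commute mult.left_commute)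
  moreover have "E $ 0 = 1" by (simp add: E_def)
  ultimately have "E = Abs_fps (Aseq (\<lambda>k. if k \<le> n then l k else 0))"
    by (intro fps_X_deriv_unique[OF _ Aseq_fps_deriv]) (auto simp: psum_fps_nth)
  then show ?thesis by (simp add: E_def b_def)
qed

text \<open>The series is a quotient of polynomials of degrees \<open>card P\<close> and \<open>card M\<close>, and the
  coefficients of the denominator give a kernel vector of the Hankel matrix.\<close>

lemma hankel_Aseq_eq_0:
  fixes s :: "nat \<Rightarrow> real" and P M :: "nat set"
  assumes fin: "finite P" "finite M" and card: "card M \<le> \<delta>" "card P < c + \<delta>"
    and l: "\<And>k. 1 \<le> k \<Longrightarrow> l k = (\<Sum>q\<in>P. s q ^ k) - (\<Sum>q\<in>M. s q ^ k)"
  shows "hankel c \<delta> (Aseq l) = 0"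
proof -
  let ?A = "Abs_fps (Aseq l)" and ?W = "lin_fps s M"
  have psum: "psum_fps (\<lambda>k. \<Sum>q\<in>P. s q ^ k) = psum_fps l + psum_fps (\<lambda>k. \<Sum>q\<in>M. s q ^ k)"
    by (rule fps_ext) (auto simp: psum_fps_nth l)
  have "?A * ?W = lin_fps s P"
  proof (rule fps_X_deriv_unique[OF _ lin_fps_deriv])
    have "fps_X * fps_deriv (?A * ?W) = ?A * (fps_X * fps_deriv ?W) + (fps_X * fps_deriv ?A) * ?W"
      by (simp add: algebra_simps)
    then show "fps_X * fps_deriv (?A * ?W) = - psum_fps (\<lambda>k. \<Sum>q\<in>P. s q ^ k) * (?A * ?W)"
      unfolding lin_fps_deriv[OF fin(2)] Aseq_fps_deriv psum by (simp add: algebra_simps)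
  qed (auto simp: psum_fps_nth fin lin_fps_nth_0)
  then have prod: "(\<Sum>j=0..k. Aseq l (k - j) * ?W $ j) = lin_fps s P $ k" for k
    by (metis (no_types, lifting) fps_mult_nth fps_nth_Abs_fps mult.commute sum.cong)
  \<comment> \<open>The coefficients are taken in reversed order, so that a row of the Hankel matrix
    times \<open>v\<close> is a coefficient of the product series.\<close>
  define v where "v = vec (Suc \<delta>) (\<lambda>b. ?W $ (\<delta> - b))"
  let ?H = "mat (Suc \<delta>) (Suc \<delta>) (\<lambda>(i, j). Aseq l (c + i + j))"
  have "vec_index v \<delta> = 1" using fin by (simp add: v_def lin_fps_nth_0)
  then have "v \<noteq> 0\<^sub>v (Suc \<delta>)" by auto
  moreover have "?H *\<^sub>v v = 0\<^sub>v (Suc \<delta>)"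
  proof (rule eq_vecI)
    fix i assume "i < dim_vec (0\<^sub>v (Suc \<delta>) :: real vec)"
    then have i: "i < Suc \<delta>" by simp
    let ?k = "c + i + \<delta>"
    have "vec_index (?H *\<^sub>v v) i = (\<Sum>b=0..\<delta>. Aseq l (c + i + b) * ?W $ (\<delta> - b))"
      using i by (simp add: v_def scalar_prod_def atLeastLessThanSuc_atLeastAtMost)
    also have "\<dots> = (\<Sum>j=0..\<delta>. Aseq l (?k - j) * ?W $ j)"
      by (rule sum.reindex_bij_witness[of _ "\<lambda>j. \<delta> - j" "\<lambda>b. \<delta> - b"]) (auto simp: add.assoc)
    also have "\<dots> = (\<Sum>j=0..?k. Aseq l (?k - j) * ?W $ j)"
      by (rule sum.mono_neutral_left) (use fin card in \<open>auto intro!: lin_fps_nth_beyond\<close>)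
    \<comment> \<open>The index \<open>?k\<close> exceeds \<open>card P\<close>, which bounds the
      degree of the numerator.\<close>
    also have "\<dots> = 0" using fin card by (simp add: prod lin_fps_nth_beyond)
    finally show "vec_index (?H *\<^sub>v v) i = vec_index (0\<^sub>v (Suc \<delta>)) i" using i by simp
  qed simp
  moreover have "v \<in> carrier_vec (Suc \<delta>)" by (simp add: v_def)
  ultimately show ?thesis unfolding hankel_def
    by (subst det_0_iff_vec_prod_zero[of _ "Suc \<delta>"]) auto
qed


section \<open>The degree of the Hankel determinant\<close>

text \<open>Restriction to a line reduces questions about degrees and units to polynomials in one
  variable.\<close>

lemma peval_on_line:
  "\<exists>Q. degree Q \<le> pdegree p \<and> (\<forall>u. poly Q u = peval p (\<lambda>i. \<alpha> i + u * \<beta> i))"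
proof -
  have "pdegree p \<le> pdegree p" ..
  then have deg: "\<And>m. m \<in> Poly_Mapping.keys p \<Longrightarrow> mono_deg m \<le> pdegree p"
    by (simp only: pdegree_le_iff)
  define M where "M m = (\<Prod>i\<in>Poly_Mapping.keys m. [:\<alpha> i, \<beta> i:] ^ Poly_Mapping.lookup m i)" for m :: "nat \<Rightarrow>\<^sub>0 nat"
  have M: "degree (M m) \<le> mono_deg m" for m
  proof -
    have "degree (M m) \<le> (\<Sum>i\<in>Poly_Mapping.keys m. degree ([:\<alpha> i, \<beta> i:] ^ Poly_Mapping.lookup m i))"
      unfolding M_def using degree_prod_sum_le[of "Poly_Mapping.keys m" "\<lambda>i. [:\<alpha> i, \<beta> i:] ^ Poly_Mapping.lookup m i"]
      by (simp add: o_def)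
    also have "\<dots> \<le> mono_deg m" unfolding mono_deg_def
    proof (rule sum_mono)
      fix i
      have "degree ([:\<alpha> i, \<beta> i:] ^ Poly_Mapping.lookup m i) \<le> degree [:\<alpha> i, \<beta> i:] * Poly_Mapping.lookup m i"
        by (rule degree_power_le)
      also have "\<dots> \<le> 1 * Poly_Mapping.lookup m i" by (rule mult_right_mono) auto
      finally show "degree ([:\<alpha> i, \<beta> i:] ^ Poly_Mapping.lookup m i) \<le> Poly_Mapping.lookup m i" by simp
    qed
    finally show ?thesis .
  qed
  have ev: "poly (M m) u = mono_val m (\<lambda>i. \<alpha> i + u * \<beta> i)" for m u
    by (simp add: M_def mono_val_def poly_prod)
  show ?thesis
  proof (intro exI[of _ "\<Sum>m\<in>Poly_Mapping.keys p. Polynomial.smult (Poly_Mapping.lookup p m) (M m)"] conjI allI)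
    show "degree (\<Sum>m\<in>Poly_Mapping.keys p. Polynomial.smult (Poly_Mapping.lookup p m) (M m)) \<le> pdegree p"
      by (intro degree_sum_le) (auto intro: order_trans[OF degree_smult_le] order_trans[OF M] deg)
  qed (simp add: poly_sum ev peval_alt)
qed

lemma poly_fun_eqI:
  fixes P Q :: "real poly"
  assumes "\<And>u. poly P u = poly Q u"
  shows "P = Q"
  using assms by (metis ext poly_eq_poly_eq_iff)

lemma pdegree_ge_line:
  assumes "\<And>u. peval p (\<lambda>i. \<alpha> i + u * \<beta> i) = C * u ^ N" "C \<noteq> 0"
  shows "N \<le> pdegree p"
proof -
  obtain Q where Q: "degree Q \<le> pdegree p" "\<And>u. poly Q u = peval p (\<lambda>i. \<alpha> i + u * \<beta> i)"
    using peval_on_line[of p \<alpha> \<beta>] by blast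
  have "Q = monom C N" by (rule poly_fun_eqI) (simp add: Q(2) assms(1) poly_monom)
  then show ?thesis using Q(1) assms(2) by (simp add: degree_monom_eq)
qed

text \<open>On every line through the origin \<open>p\<close> and \<open>q\<close> become univariate
  polynomials with product 1, hence constants.\<close>

lemma mpoly_unit_const:
  assumes "p * q = (1 :: mpoly)"
  obtains c where "c \<noteq> 0" "p = pconst c"
proof -
  have pq: "peval p z * peval q z = 1" for z
    by (metis assms peval_mult peval_one)
  have const: "peval p z = peval p (\<lambda>_. 0)" for z
  proof -
    obtain P Q where P: "\<And>u. poly P u = peval p (\<lambda>i. 0 + u * z i)"
      and Q: "\<And>u. poly Q u = peval q (\<lambda>i. 0 + u * z i)"
      using peval_on_line[of p "\<lambda>_. 0" z] peval_on_line[of q "\<lambda>_. 0" z] by blast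
    have "P * Q = 1" by (rule poly_fun_eqI) (simp add: P Q pq)
    then have "degree P = 0" by (metis degree_1 degree_mult_eq add_is_0 mult_zero_left mult_zero_right zero_neq_one)
    then obtain a where "P = [:a:]" by (metis degree_eq_zeroE)
    then show ?thesis using P[of 1] P[of 0] by simp
  qed
  have "p = pconst (peval p (\<lambda>_. 0))" by (rule mpoly_eqI, subst const) simp
  moreover have "peval p (\<lambda>_. 0) \<noteq> 0" using pq[of "\<lambda>_. 0"] by auto
  ultimately show ?thesis by (rule that[rotated])
qed

text \<open>All Leibniz terms pick up the same power of \<open>x\<close>, as in
  \<open>polyfun_det\<close>.\<close>

lemma det_scale:
  fixes x :: real
  shows "det (mat k k (\<lambda>(i, j). x ^ (r i + s j) * F i j)) =
    x ^ (\<Sum>i<k. r i + s i) * det (mat k k (\<lambda>(i, j). F i j))"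
proof -
  have "(\<Prod>i = 0..<k. mat k k (\<lambda>(i, j). x ^ (r i + s j) * F i j) $$ (i, p i)) =
      x ^ (\<Sum>i<k. r i + s i) * (\<Prod>i = 0..<k. mat k k (\<lambda>(i, j). F i j) $$ (i, p i))"
    if p: "p permutes {0..<k}" for p
  proof -
    have p': "p i < k" if "i < k" for i using permutes_in_image[OF p, of i] that by simp
    have "(\<Prod>i = 0..<k. mat k k (\<lambda>(i, j). x ^ (r i + s j) * F i j) $$ (i, p i)) =
        (\<Prod>i = 0..<k. x ^ (r i + s (p i)) * mat k k (\<lambda>(i, j). F i j) $$ (i, p i))"
      by (intro prod.cong) (auto simp: p')
    also have "\<dots> = x ^ (\<Sum>i = 0..<k. r i + s (p i)) * (\<Prod>i = 0..<k. mat k k (\<lambda>(i, j). F i j) $$ (i, p i))"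
      by (simp add: prod.distrib power_sum)
    also have "(\<Sum>i = 0..<k. r i + s (p i)) = (\<Sum>i<k. r i + s i)"
      using sum.permute[OF p, of s] by (simp add: sum.distrib o_def lessThan_atLeast0)
    finally show ?thesis .
  qed
  then show ?thesis
    by (subst (1 2) det_def'[of _ k]) (auto simp: sum_distrib_left mult_ac intro!: sum.cong)
qed

text \<open>At a root, the order of vanishing of \<open>p\<close> exceeds that of its derivative by
  one; constants are treated apart, as their derivative is 0.\<close>

lemma power_dvd_if_pderiv_0:
  fixes p :: "real poly"
  assumes "\<And>i. i \<le> k \<Longrightarrow> poly ((pderiv ^^ i) p) a = 0"
  shows "[:- a, 1:] ^ Suc k dvd p"
  using assms
proof (induction k arbitrary: p)
  case 0
  from 0[of 0] show ?case by (simp add: poly_eq_0_iff_dvd)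
next
  case (Suc k)
  have "[:- a, 1:] ^ Suc k dvd pderiv p"
  proof (rule Suc.IH)
    fix i assume "i \<le> k"
    then show "poly ((pderiv ^^ i) (pderiv p)) a = 0"
      using Suc.prems[of "Suc i"] by (simp add: funpow_swap1)
  qed
  show ?case
  proof (cases "p = 0 \<or> pderiv p = 0")
    case True
    then have "pderiv p = 0" by auto
    then obtain c where "p = [:c:]" by (metis degree_eq_zeroE pderiv_eq_0_iff)
    then show ?thesis using Suc.prems[of 0] by simp
  next
    case False
    then have "order a p \<noteq> 0" using Suc.prems[of 0] by (simp add: order_root)
    then have "order a p = Suc (order a (pderiv p))" using False order_pderiv[of p a] Suc.prems[of 0] by auto
    moreover have "Suc k \<le> order a (pderiv p)"
      using \<open>[:- a, 1:] ^ Suc k dvd pderiv p\<close> False by (simp add: order_divides del: power_Suc)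
    ultimately show ?thesis using False by (simp add: order_divides del: power_Suc)
  qed
qed

text \<open>A kernel vector \<open>v\<close> would give a polynomial \<open>\<Sum>b. v\<^sub>b * x ^ (c + k + b) / (c + k + b)!\<close> vanishing
  at 1 to order \<open>k + 1\<close>; dividing by \<open>x ^ (c + k)\<close> leaves degree at most \<open>k\<close>.\<close>

lemma det_inverse_fact: "det (mat (Suc k) (Suc k) (\<lambda>(i, j). 1 / fact (c + i + j) :: real)) \<noteq> 0"
proof
  let ?A = "mat (Suc k) (Suc k) (\<lambda>(i, j). 1 / fact (c + i + j) :: real)"
  assume "det ?A = 0"
  then obtain v where v: "v \<in> carrier_vec (Suc k)" "v \<noteq> 0\<^sub>v (Suc k)" "?A *\<^sub>v v = 0\<^sub>v (Suc k)"
    using det_0_iff_vec_prod_zero[of ?A "Suc k"] by auto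
  have row: "(\<Sum>b\<le>k. vec_index v b / fact (c + a + b)) = 0" if "a \<le> k" for a
  proof -
    have "vec_index (?A *\<^sub>v v) a = 0" using v(3) that by simp
    then show ?thesis using that v(1)
      by (simp add: scalar_prod_def lessThan_Suc_atMost flip: lessThan_atLeast0)
  qed
  define e where "e b = vec_index v b / fact (c + k + b)" for b
  define f where "f = (\<Sum>b\<le>k. monom (e b) (c + k + b))"
  define g where "g = (\<Sum>b\<le>k. monom (e b) b)"
  have f: "f = monom 1 (c + k) * g"
    by (simp add: f_def g_def sum_distrib_left mult_monom add_ac)
  have pd: "(pderiv ^^ i) (monom a m) = monom (a * (fact m / fact (m - i))) (m - i)" if "i \<le> m" for i m and a :: real
    using that
  proof (induction i)
    case (Suc i)
    have "fact (m - i) = real (m - i) * fact (m - Suc i)"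
      using Suc.prems by (metis Suc_diff_Suc Suc_le_lessD fact_Suc of_nat_mult of_nat_fact)
    then have c: "real (m - i) * (a * (fact m / fact (m - i))) = a * (fact m / fact (m - Suc i))"
      using Suc.prems by simp
    have "(pderiv ^^ i) (monom a m) = monom (a * (fact m / fact (m - i))) (m - i)"
      using Suc by simp
    then show ?case unfolding funpow.simps o_apply by (simp only: pderiv_monom c) simp
  qed simp
  have "[:- 1, 1:] ^ Suc k dvd f"
  proof (rule power_dvd_if_pderiv_0)
    fix i assume i: "i \<le> k"
    have "(pderiv ^^ i) f = (\<Sum>b\<le>k. (pderiv ^^ i) (monom (e b) (c + k + b)))"
      unfolding f_def by (rule higher_pderiv_sum)
    also have "\<dots> = (\<Sum>b\<le>k. monom (vec_index v b / fact (c + k + b - i)) (c + k + b - i))"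
      by (intro sum.cong refl, subst pd) (use i in \<open>auto simp: e_def\<close>)
    \<comment> \<open>The i-th derivative at 1 is row \<open>k - i\<close> of the kernel equation;
      the factor 1 / (c + k + b)! in \<open>e\<close> is chosen for this.\<close>
    also have "poly \<dots> 1 = (\<Sum>b\<le>k. vec_index v b / fact (c + (k - i) + b))"
      unfolding poly_sum poly_monom using i by (intro sum.cong) auto
    also have "\<dots> = 0" by (rule row) simp
    finally show "poly ((pderiv ^^ i) f) 1 = 0" .
  qed
  have "degree g \<le> k" unfolding g_def
    by (intro degree_sum_le) (auto intro: order_trans[OF degree_monom_le])
  have "g = 0"
  proof (rule ccontr)
    assume "g \<noteq> 0"
    have "f \<noteq> 0" using \<open>g \<noteq> 0\<close> by (simp add: f monom_eq_0_iff)
    have "order 1 (monom 1 (c + k) :: real poly) = 0" by (rule order_0I) (simp add: poly_monom)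
    then have "order 1 f = order 1 g" using \<open>f \<noteq> 0\<close> unfolding f by (simp add: order_mult)
    moreover have "Suc k \<le> order 1 f"
      using \<open>[:- 1, 1:] ^ Suc k dvd f\<close> \<open>f \<noteq> 0\<close> by (simp add: order_divides del: power_Suc)
    moreover have "order 1 g \<le> degree g" using \<open>g \<noteq> 0\<close> by (rule order_degree)
    ultimately show False using \<open>degree g \<le> k\<close> by simp
  qed
  moreover have "coeff g b = e b" if "b \<le> k" for b
    using that by (simp add: g_def coeff_sum)
  ultimately have "vec_index v b = 0" if "b \<le> k" for b using that by (simp add: e_def)
  then have "v = 0\<^sub>v (Suc k)" using v(1) by (intro eq_vecI) auto
  with v(2) show False by simp
qed

text \<open>With \<open>u\<close> at index 1 as the only nonzero entry, the series is exp (- u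
  X).\<close>

lemma Aseq_linear: "Aseq (\<lambda>k. if k = 1 then u else 0) k = (- u) ^ k / fact k"
proof (induction k)
  case (Suc k)
  have "(\<Sum>i\<le>k. (if Suc i = 1 then u else 0) * Aseq (\<lambda>k. if k = 1 then u else 0) (k - i))
      = u * ((- u) ^ k / fact k)"
  proof -
    have "(\<Sum>i\<le>k. (if Suc i = 1 then u else 0) * Aseq (\<lambda>k. if k = 1 then u else 0) (k - i))
      = (\<Sum>i\<le>k. if i = 0 then u * ((- u) ^ k / fact k) else 0)"
      using Suc by (intro sum.cong) auto
    then show ?thesis by simp
  qed
  then show ?case unfolding Aseq.simps(2) by (simp only: fact_Suc power_Suc) (simp add: field_simps)
qed simp

text \<open>Along the axis of \<lambda> 1 the determinant is a pure power whose exponent is the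
  upper bound from \<open>polyfun_det\<close>, so that bound is attained.\<close>

lemma hankel_Aseq_linear:
  "\<exists>C. C \<noteq> 0 \<and> (\<forall>u. hankel c k (Aseq (\<lambda>k. if k = 1 then u else 0)) = C * u ^ (\<Sum>i<Suc k. c + i + i))"
proof -
  define d where "d = det (mat (Suc k) (Suc k) (\<lambda>(i, j). 1 / fact (c + i + j) :: real))"
  define N where "N = (\<Sum>i<Suc k. (c + i) + i)"
  have *: "hankel c k (Aseq (\<lambda>k. if k = 1 then u else 0)) = (- u) ^ N * d" for u
    using det_scale[of "Suc k" "- u" "\<lambda>i. c + i" "\<lambda>j. j" "\<lambda>i j. 1 / fact (c + i + j)"]
    unfolding hankel_def Aseq_linear d_def N_def by simp
  have "hankel c k (Aseq (\<lambda>k. if k = 1 then u else 0)) = ((- 1) ^ N * d) * u ^ N" for u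
    unfolding * power_minus[of u N] by (simp only: mult_ac)
  moreover have "(- 1) ^ N * d \<noteq> 0" using det_inverse_fact[of k c] by (simp add: d_def)
  ultimately show ?thesis unfolding N_def by blast
qed

text \<open>For \<open>k = \<delta>\<close> and \<open>c = n - 2 * \<delta>\<close> this is
  (\<delta> + 1) * (n - \<delta>).\<close>

lemma hankel_weight: "(\<Sum>i<Suc k. c + i + i) = (k + 1) * (c + k)"
  by (induction k) (auto simp: algebra_simps)

section \<open>The Hankel determinant generates the vanishing ideal\<close>

lemma hankel_cong:
  assumes "\<And>i. c \<le> i \<Longrightarrow> i \<le> c + 2 * k \<Longrightarrow> z i = z' i"
  shows "hankel c k z = hankel c k z'"
  unfolding hankel_def by (rule arg_cong[where f = det], rule eq_matI) (auto simp: assms)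

text \<open>The integrator data enter only through an affine change of coordinates with slopes
  \<open>E\<close> and offsets \<open>D\<close>. The index is reversed because component k of the
  state carries the powers of exponent n + 1 - k. The count of negative signs in \<open>neg\<close>
  makes the Hankel determinant vanish on the parameterized set.\<close>

lemma implicit_core:
  fixes E D \<epsilon> :: "nat \<Rightarrow> real" and n :: nat
  defines "\<delta> \<equiv> (n - 1) div 2"
  defines "L \<equiv> \<lambda>z k. E k * z (n + 1 - k) + D k"
  assumes n: "1 \<le> n" and E: "\<And>k. k \<in> {1..n} \<Longrightarrow> E k \<noteq> 0"
    and \<epsilon>: "\<And>q. q \<in> {1..n - 1} \<Longrightarrow> \<epsilon> q = 1 \<or> \<epsilon> q = - 1"
    and neg: "card {q \<in> {1..n - 1}. \<epsilon> q = - 1} = \<delta>"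
  obtains H where "pvars H \<subseteq> {1..n}" "\<And>z. peval H z = hankel (n - 2 * \<delta>) \<delta> (Aseq (L z))"
    "pdegree H = (\<delta> + 1) * (n - \<delta>)"
    "\<And>p. pvars p \<subseteq> {1..n} \<Longrightarrow>
      (\<forall>z s. (\<forall>k\<in>{1..n}. L z k = psum (n - 1) \<epsilon> s k) \<longrightarrow> peval p z = 0) \<longleftrightarrow>
      (\<exists>h. pvars h \<subseteq> {1..n} \<and> p = h * H)"
proof -
  define c where "c = n - 2 * \<delta>"
  have "2 * \<delta> \<le> n - 1" by (simp add: \<delta>_def)
  then have c: "1 \<le> c" "n = c + 2 * \<delta>" using n by (auto simp: c_def)
  define HF where "HF z = hankel c \<delta> (Aseq (L z))" for z
  have deg: "(\<Sum>i<Suc \<delta>. c + i + i) = (\<delta> + 1) * (n - \<delta>)" unfolding hankel_weight using c by simp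
  have polyL: "polyfun {1..n} 1 (\<lambda>z. L z i)" if "1 \<le> i" "i \<le> n" for i
    unfolding L_def using that by (intro polyfun_add polyfun_cmult polyfun_var polyfun_const) auto
  have polyA: "polyfun {1..n} i (\<lambda>z. Aseq (L z) i)" if "i \<le> n" for i
    by (rule polyfun_Aseq) (use that polyL in auto)
  have "polyfun {1..n} (\<Sum>i<Suc \<delta>. c + i + i) HF"
    unfolding HF_def hankel_def by (rule polyfun_det, rule polyA) (use c in auto)
  then obtain H where H: "pvars H \<subseteq> {1..n}" "pdegree H \<le> (\<delta> + 1) * (n - \<delta>)" "\<And>z. peval H z = HF z"
    unfolding deg by (auto elim: polyfunE)
  have "(\<delta> + 1) * (n - \<delta>) \<le> pdegree H"
  proof -
    obtain C where C: "C \<noteq> 0" "\<And>u. hankel c \<delta> (Aseq (\<lambda>k. if k = 1 then u else 0)) = C * u ^ ((\<delta> + 1) * (n - \<delta>))"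
      using hankel_Aseq_linear[of c \<delta>] unfolding deg by blast
    \<comment> \<open>A line in the direction of coordinate \<open>n\<close>:
      \<open>\<alpha>\<close> makes every \<open>L\<close> zero, and \<open>\<beta>\<close> moves
      only the value of \<open>L\<close> at k = 1, with unit speed.\<close>
    define \<alpha> where "\<alpha> i = - D (n + 1 - i) / E (n + 1 - i)" for i
    define \<beta> where "\<beta> i = (if i = n then 1 / E 1 else 0)" for i
    have "peval H (\<lambda>i. \<alpha> i + u * \<beta> i) = C * u ^ ((\<delta> + 1) * (n - \<delta>))" for u
    proof -
      have "L (\<lambda>i. \<alpha> i + u * \<beta> i) k = (if k = 1 then u else 0)" if "1 \<le> k" "k \<le> n" for k
        using that E[of k] by (auto simp: L_def \<alpha>_def \<beta>_def field_simps)
      then have *: "hankel c \<delta> (Aseq (L (\<lambda>i. \<alpha> i + u * \<beta> i))) = hankel c \<delta> (Aseq (\<lambda>k. if k = 1 then u else 0))"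
        using c by (intro hankel_cong Aseq_cong) auto
      show ?thesis unfolding H(3) HF_def * C(2) ..
    qed
    then show ?thesis using C(1) by (rule pdegree_ge_line)
  qed
  with H(2) have degH: "pdegree H = (\<delta> + 1) * (n - \<delta>)" by simp
  have vanish: "hankel c \<delta> (Aseq (psum (n - 1) \<epsilon> s)) = 0" for s
  proof (rule hankel_Aseq_eq_0)
    let ?P = "{q \<in> {1..n - 1}. \<epsilon> q = 1}" and ?M = "{q \<in> {1..n - 1}. \<epsilon> q = - 1}"
    show "finite ?P" "finite ?M" "card ?M \<le> \<delta>" using neg by auto
    have un: "?P \<union> ?M = {1..n - 1}" using \<epsilon> by blast
    have disj: "?P \<inter> ?M = {}" by auto
    have "card ?P + card ?M = card (?P \<union> ?M)" by (rule card_Un_disjoint[symmetric]) (use disj in auto)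
    then have "card ?P + \<delta> = n - 1" unfolding un neg by simp
    \<comment> \<open>\<open>card ?P\<close> is \<open>n - 1 - \<delta>\<close>, one less than
      \<open>c + \<delta>\<close>.\<close>
    then show "card ?P < c + \<delta>" using c by linarith
    fix k
    have "psum (n - 1) \<epsilon> s k = (\<Sum>q\<in>?P \<union> ?M. \<epsilon> q * s q ^ k)" unfolding un psum_def ..
    also have "\<dots> = (\<Sum>q\<in>?P. \<epsilon> q * s q ^ k) + (\<Sum>q\<in>?M. \<epsilon> q * s q ^ k)"
      by (rule sum.union_disjoint) (use disj in auto)
    finally show "psum (n - 1) \<epsilon> s k = (\<Sum>q\<in>?P. s q ^ k) - (\<Sum>q\<in>?M. s q ^ k)"
      by (simp add: sum_negf)
  qed
  show ?thesis
  proof (rule hankel_generates[OF c])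
    fix h
    assume h: "pvars h \<subseteq> {1..n}" "peval h = hankel c \<delta>"
      and gen: "\<And>f Z. pvars f \<subseteq> {1..n} \<Longrightarrow> \<forall>z\<in>Z. peval f z = 0 \<Longrightarrow> \<forall>z\<in>Z. hankel c \<delta> z = 0 \<Longrightarrow>
       (\<And>g. pvars g \<subseteq> {1..<n} \<Longrightarrow> \<forall>z\<in>Z. peval g z = 0 \<Longrightarrow> g = 0) \<Longrightarrow>
       \<exists>q. pvars q \<subseteq> {1..n} \<and> f = q * h"
    show thesis
    proof (rule that[OF H(1) _ degH])
      show "peval H z = hankel (n - 2 * \<delta>) \<delta> (Aseq (L z))" for z
        by (simp add: H(3) HF_def c_def)
    next
      fix p assume p: "pvars p \<subseteq> {1..n}"
      show "(\<forall>z s. (\<forall>k\<in>{1..n}. L z k = psum (n - 1) \<epsilon> s k) \<longrightarrow> peval p z = 0) \<longleftrightarrow>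
        (\<exists>h. pvars h \<subseteq> {1..n} \<and> p = h * H)" (is "?V \<longleftrightarrow> ?G")
      proof
        assume ?G
        then obtain g where g: "p = g * H" by blast
        show ?V
        proof (intro allI impI)
          fix z s assume "\<forall>k\<in>{1..n}. L z k = psum (n - 1) \<epsilon> s k"
          then have *: "hankel c \<delta> (Aseq (L z)) = hankel c \<delta> (Aseq (psum (n - 1) \<epsilon> s))"
            using c by (intro hankel_cong Aseq_cong) auto
          show "peval p z = 0" unfolding g peval_mult H(3) HF_def * vanish by simp
        qed
      next
        assume V: ?V
        \<comment> \<open>The inverse of the coordinate change from \<open>z\<close> to the
          coefficients of the series; \<open>p'\<close> will be \<open>p\<close> written in these
          coefficients.\<close>
        define X where "X a i = (Lseq a (n + 1 - i) - D (n + 1 - i)) / E (n + 1 - i)" for a i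
        have "\<exists>d. polyfun {1..n} d (\<lambda>a. peval p (\<lambda>i. X a i))"
        proof (rule polyfun_compose[OF p])
          fix i assume i: "i \<in> {1..n}"
          obtain d where "polyfun {1..n + 1 - i} d (\<lambda>z. Lseq z (n + 1 - i))" using polyfun_Lseq by blast
          then have "polyfun {1..n} d (\<lambda>z. Lseq z (n + 1 - i))" by (rule polyfun_mono) (use i in auto)
          then have "polyfun {1..n} d (\<lambda>a. 1 / E (n + 1 - i) * (Lseq a (n + 1 - i) + - D (n + 1 - i)))"
            by (intro polyfun_cmult polyfun_add polyfun_const)
          then show "\<exists>d. polyfun {1..n} d (\<lambda>a. X a i)" by (auto simp: X_def)
        qed
        then obtain p' where p': "pvars p' \<subseteq> {1..n}" "\<And>a. peval p' a = peval p (X a)"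
          by (auto elim: polyfunE)
        have LX: "L (X (Aseq l)) k = l k" if "k \<in> {1..n}" for l k
          using that E[of k] by (simp add: L_def X_def Lseq_Aseq)
        define Z where "Z = range (\<lambda>s. Aseq (psum (n - 1) \<epsilon> s))"
        have "\<exists>q. pvars q \<subseteq> {1..n} \<and> p' = q * h"
        proof (rule gen[OF p'(1), of Z])
          have "peval p' (Aseq (psum (n - 1) \<epsilon> s)) = 0" for s
            unfolding p'(2) using V LX by blast
          then show "\<forall>z\<in>Z. peval p' z = 0" unfolding Z_def by blast
          show "\<forall>z\<in>Z. hankel c \<delta> z = 0" unfolding Z_def using vanish by blast
          fix g assume g: "pvars g \<subseteq> {1..<n}" "\<forall>z\<in>Z. peval g z = 0"
          have "{1..<n} = {1..n - 1}" by auto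
          show "g = 0"
          proof (rule Aseq_psum_independent)
            show "\<epsilon> q \<noteq> 0" if "q \<in> {1..n - 1}" for q using \<epsilon>[OF that] by auto
            show "pvars g \<subseteq> {1..n - 1}" using g(1) \<open>{1..<n} = {1..n - 1}\<close> by (simp only:)
            show "peval g (Aseq (psum (n - 1) \<epsilon> s)) = 0" for s using g(2) unfolding Z_def by blast
          qed
        qed
        then obtain q where q: "pvars q \<subseteq> {1..n}" "p' = q * h" by blast
        have "\<exists>d. polyfun {1..n} d (\<lambda>z. peval q (\<lambda>i. Aseq (L z) i))"
          by (rule polyfun_compose[OF q(1)]) (use polyA in auto)
        then obtain q' where q': "pvars q' \<subseteq> {1..n}" "\<And>z. peval q' z = peval q (Aseq (L z))"
          by (auto elim: polyfunE)
        have "p = q' * H"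
        proof (rule mpoly_eqI)
          fix z
          have "peval p z = peval p (X (Aseq (L z)))"
          proof (rule peval_cong[OF p])
            fix i assume i: "i \<in> {1..n}"
            then have "Lseq (Aseq (L z)) (n + 1 - i) = E (n + 1 - i) * z i + D (n + 1 - i)"
              by (subst Lseq_Aseq) (auto simp: L_def)
            moreover have "E (n + 1 - i) \<noteq> 0" using i by (intro E) auto
            ultimately show "z i = X (Aseq (L z)) i" by (simp add: X_def)
          qed
          also have "\<dots> = peval p' (Aseq (L z))" by (simp add: p'(2))
          also have "\<dots> = peval (q' * H) z" by (simp add: q(2) q'(2) h(2) H(3) HF_def)
          finally show "peval p z = peval (q' * H) z" .
        qed
        with q'(1) show ?G by blast
      qed
    qed
  qed
qed


section \<open>The elimination ideal\<close>

lemma pvars_sum: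
  assumes "finite I" "\<And>i. i \<in> I \<Longrightarrow> pvars (f i) \<subseteq> V"
  shows "pvars (\<Sum>i\<in>I. f i) \<subseteq> V"
  using assms
proof (induction I rule: finite_induct)
  case empty then show ?case by (simp add: pvars_def)
next
  case (insert i I)
  then show ?case using pvars_add[of "f i" "\<Sum>i\<in>I. f i"] by auto
qed

lemma pvars_power: "pvars (p ^ k) \<subseteq> pvars p"
proof (induction k)
  case 0 show ?case using pvars_const[of 1] by (simp add: pconst_1)
next
  case (Suc k) then show ?case using pvars_mult[of p "p ^ k"] by auto
qed

text \<open>Modulo the ideal of the \<open>pvar k - F k\<close>, a polynomial is congruent to the
  result \<open>r\<close> of substituting \<open>F\<close>; \<open>r\<close> is pinned down by its
  values. The bound on the variables of \<open>p\<close> is repeated in the conclusion because the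
  product case uses a factor as a multiplier.\<close>

lemma substitution_expansion:
  fixes F :: "nat \<Rightarrow> mpoly"
  assumes p: "pvars p \<subseteq> {1..n}" and F: "\<And>k. k \<in> {1..n} \<Longrightarrow> pvars (F k) \<subseteq> V" and V: "{1..n} \<subseteq> V"
  shows "\<exists>h r. (\<forall>k\<in>{1..n}. pvars (h k) \<subseteq> V) \<and> pvars r \<subseteq> V \<and> pvars p \<subseteq> V \<and>
    p = r + (\<Sum>k=1..n. h k * (pvar k - F k)) \<and> (\<forall>\<omega>. peval r \<omega> = peval p (\<lambda>k. peval (F k) \<omega>))"
  using p
proof (induction rule: mpoly_induct)
  case (const c)
  show ?case by (rule exI[of _ "\<lambda>_. 0"], rule exI[of _ "pconst c"]) (simp add: pvars_def pconst_def)
next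
  case (var i)
  have "(\<Sum>k=1..n. (if k = i then 1 else 0) * (pvar k - F k)) = pvar i - F i"
    using var by (simp add: if_distrib[of "\<lambda>x. x * _"] sum.delta cong: if_cong)
  then have eq: "pvar i = F i + (\<Sum>k=1..n. (if k = i then 1 else 0) * (pvar k - F k))" by simp
  show ?case
  proof (rule exI[of _ "\<lambda>k. if k = i then 1 else 0"], rule exI[of _ "F i"], intro conjI ballI allI)
    show "pvars (if k = i then 1 else 0) \<subseteq> V" for k
      using pvars_const[of 1] pvars_const[of 0] by (auto simp: pconst_1 pconst_0)
    show "pvars (F i) \<subseteq> V" using F var by blast
    show "pvars (pvar i) \<subseteq> V" using V var by auto
  qed (rule eq, simp)
next
  case (add p q)
  let ?S = "\<lambda>h. \<Sum>k=1..n. h k * (pvar k - F k)"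
  obtain h r where 1: "\<forall>k\<in>{1..n}. pvars (h k) \<subseteq> V" "pvars r \<subseteq> V" "pvars p \<subseteq> V" "p = r + ?S h"
    "\<forall>\<omega>. peval r \<omega> = peval p (\<lambda>k. peval (F k) \<omega>)" using add.IH(1) by (elim exE conjE)
  obtain h' r' where 2: "\<forall>k\<in>{1..n}. pvars (h' k) \<subseteq> V" "pvars r' \<subseteq> V" "pvars q \<subseteq> V" "q = r' + ?S h'"
    "\<forall>\<omega>. peval r' \<omega> = peval q (\<lambda>k. peval (F k) \<omega>)" using add.IH(2) by (elim exE conjE)
  show ?case
  proof (rule exI[of _ "\<lambda>k. h k + h' k"], rule exI[of _ "r + r'"], intro conjI ballI allI)
    show "pvars (h k + h' k) \<subseteq> V" if "k \<in> {1..n}" for k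
      using that 1(1) 2(1) pvars_add[of "h k" "h' k"] by blast
    show "pvars (r + r') \<subseteq> V" using 1(2) 2(2) pvars_add[of r r'] by blast
    show "pvars (p + q) \<subseteq> V" using 1(3) 2(3) pvars_add[of p q] by blast
    have "?S (\<lambda>k. h k + h' k) = ?S h + ?S h'" by (simp only: distrib_right sum.distrib)
    then show "p + q = r + r' + ?S (\<lambda>k. h k + h' k)" using 1(4) 2(4) by (simp only: add_ac)
  qed (simp add: 1(5) 2(5))
next
  case (mult p q)
  let ?S = "\<lambda>h. \<Sum>k=1..n. h k * (pvar k - F k)"
  obtain h r where 1: "\<forall>k\<in>{1..n}. pvars (h k) \<subseteq> V" "pvars r \<subseteq> V" "pvars p \<subseteq> V" "p = r + ?S h"
    "\<forall>\<omega>. peval r \<omega> = peval p (\<lambda>k. peval (F k) \<omega>)" using mult.IH(1) by (elim exE conjE)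
  obtain h' r' where 2: "\<forall>k\<in>{1..n}. pvars (h' k) \<subseteq> V" "pvars r' \<subseteq> V" "pvars q \<subseteq> V" "q = r' + ?S h'"
    "\<forall>\<omega>. peval r' \<omega> = peval q (\<lambda>k. peval (F k) \<omega>)" using mult.IH(2) by (elim exE conjE)
  \<comment> \<open>The witness comes from p q - r r' = q (p - r) + r (q - r').\<close>
  show ?case
  proof (rule exI[of _ "\<lambda>k. r * h' k + q * h k"], rule exI[of _ "r * r'"], intro conjI ballI allI)
    show "pvars (r * h' k + q * h k) \<subseteq> V" if "k \<in> {1..n}" for k
      using that 1(1,2) 2(1,3) pvars_add[of "r * h' k" "q * h k"] pvars_mult[of r "h' k"] pvars_mult[of q "h k"] by blast
    show "pvars (r * r') \<subseteq> V" using 1(2) 2(2) pvars_mult[of r r'] by blast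
    show "pvars (p * q) \<subseteq> V" using 1(3) 2(3) pvars_mult[of p q] by blast
    have S: "?S (\<lambda>k. r * h' k + q * h k) = r * ?S h' + q * ?S h"
      by (simp only: distrib_right sum.distrib sum_distrib_left mult.assoc)
    have "p * q = r * q + q * ?S h" by (subst 1(4)) (simp only: distrib_right mult.commute[of "?S h" q])
    also have "r * q = r * r' + r * ?S h'" by (subst 2(4)) (simp only: distrib_left)
    finally show "p * q = r * r' + ?S (\<lambda>k. r * h' k + q * h k)" unfolding S by (simp only: add.assoc)
  qed (simp add: 1(5) 2(5))
qed

lemma pvars_boundary_param:
  assumes "k \<in> {1..n}"
  shows "pvars (boundary_param \<sigma> n a b t y0 k) \<subseteq> {n + 1..2 * n - 1}"
proof -
  let ?V = "{n + 1..2 * n - 1}"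
  have add: "pvars (p + q) \<subseteq> ?V" if "pvars p \<subseteq> ?V" "pvars q \<subseteq> ?V" for p q
    using that pvars_add[of p q] by blast
  have mult: "pvars (p * q) \<subseteq> ?V" if "pvars p \<subseteq> ?V" "pvars q \<subseteq> ?V" for p q
    using that pvars_mult[of p q] by blast
  have c: "pvars (pconst x) \<subseteq> ?V" for x by simp
  have two: "2 = pconst 2" by (simp add: pconst_def)
  have sgn: "(- 1) ^ m = pconst ((- 1) ^ m)" for m
    by (induction m) (simp_all add: pconst_1 pconst_def mult_single single_uminus)
  show ?thesis unfolding boundary_param_def two sgn
  proof (intro add mult c pvars_sum)
    fix q assume "q \<in> {1..n - 1}"
    then have "pvars (pvar (n + q)) \<subseteq> ?V" by auto
    then show "pvars (pvar (n + q) ^ (n - k + 1)) \<subseteq> ?V" using pvars_power by blast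
  qed simp
qed

text \<open>The ideal is generated by differences of coordinates and polynomials in the parameters,
  so elimination amounts to substitution: the remainder from \<open>substitution_expansion\<close>
  is zero as soon as all its values are.\<close>

lemma elimination_ideal_iff:
  "p \<in> elimination_ideal \<sigma> n a b t y0 \<longleftrightarrow>
     pvars p \<subseteq> {1..n} \<and> (\<forall>\<omega>. peval p (\<lambda>k. peval (boundary_param \<sigma> n a b t y0 k) \<omega>) = 0)"
proof (cases "pvars p \<subseteq> {1..n}")
  case p: True
  let ?F = "boundary_param \<sigma> n a b t y0"
  show ?thesis
  proof (intro iffI conjI p allI)
    fix \<omega> assume "p \<in> elimination_ideal \<sigma> n a b t y0"
    then obtain h where h: "p = (\<Sum>k=1..n. h k * (pvar k - ?F k))"
      unfolding elimination_ideal_def by blast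
    \<comment> \<open>The boundary point is put into the slots \<open>1..n\<close>. The
      parameterization only reads slots above \<open>n\<close>, so all generators vanish at this
      assignment.\<close>
    define \<omega>' where "\<omega>' i = (if i \<in> {1..n} then peval (?F i) \<omega> else \<omega> i)" for i
    have F: "peval (?F k) \<omega>' = peval (?F k) \<omega>" if "k \<in> {1..n}" for k
      by (rule peval_cong[OF pvars_boundary_param[OF that]]) (auto simp: \<omega>'_def)
    have "peval p (\<lambda>k. peval (?F k) \<omega>) = peval p \<omega>'"
      by (rule peval_cong[OF p]) (simp add: \<omega>'_def)
    also have "\<dots> = (\<Sum>k=1..n. peval (h k) \<omega>' * (\<omega>' k - peval (?F k) \<omega>'))" by (simp add: h)
    also have "\<dots> = 0" by (intro sum.neutral ballI) (simp only: F, simp add: \<omega>'_def)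
    finally show "peval p (\<lambda>k. peval (?F k) \<omega>) = 0" .
  next
    assume *: "pvars p \<subseteq> {1..n} \<and> (\<forall>\<omega>. peval p (\<lambda>k. peval (?F k) \<omega>) = 0)"
    have "\<exists>h r. (\<forall>k\<in>{1..n}. pvars (h k) \<subseteq> {1..2 * n - 1}) \<and> pvars r \<subseteq> {1..2 * n - 1} \<and> pvars p \<subseteq> {1..2 * n - 1} \<and>
      p = r + (\<Sum>k=1..n. h k * (pvar k - ?F k)) \<and> (\<forall>\<omega>. peval r \<omega> = peval p (\<lambda>k. peval (?F k) \<omega>))"
    proof (rule substitution_expansion[OF p])
      show "pvars (?F k) \<subseteq> {1..2 * n - 1}" if "k \<in> {1..n}" for k
        using pvars_boundary_param[OF that, of \<sigma> a b t y0] by force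
    qed auto
    then obtain h r where h: "\<forall>k\<in>{1..n}. pvars (h k) \<subseteq> {1..2 * n - 1}"
      "p = r + (\<Sum>k=1..n. h k * (pvar k - ?F k))" "\<forall>\<omega>. peval r \<omega> = peval p (\<lambda>k. peval (?F k) \<omega>)"
      by (elim exE conjE) (rule that; assumption)
    have "r = 0" by (rule mpoly_eq_0_if_peval_0) (simp add: h(3) *)
    then show "p \<in> elimination_ideal \<sigma> n a b t y0"
      unfolding elimination_ideal_def using h p by auto
  qed
qed (auto simp: elimination_ideal_def)

section \<open>Implicitization of the boundary parameterization\<close>

lemma card_even_interval: "card {q \<in> {1..m}. even q} = m div 2"
proof (induction m)
  case (Suc m)
  have "{q \<in> {1..Suc m}. even q} = (if even (Suc m) then insert (Suc m) {q \<in> {1..m}. even q} else {q \<in> {1..m}. even q})"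
    by (auto simp: le_Suc_eq)
  with Suc show ?case by (auto elim!: oddE evenE)
qed simp

lemma card_odd_interval: "card {q \<in> {1..m}. odd q} = (m + 1) div 2"
proof (induction m)
  case (Suc m)
  have "{q \<in> {1..Suc m}. odd q} = (if odd (Suc m) then insert (Suc m) {q \<in> {1..m}. odd q} else {q \<in> {1..m}. odd q})"
    by (auto simp: le_Suc_eq)
  with Suc show ?case by (auto elim!: oddE evenE)
qed simp

context
  fixes \<sigma> :: branch and n :: nat and a b t :: real and y0 :: "real vec"
  assumes n: "1 \<le> n" and ab: "a < b"
begin

definition branch_sign :: real where
  "branch_sign = (if \<sigma> = Lower \<and> even n then - 1 else 1)"

definition lam_slope :: "nat \<Rightarrow> real" where
  "lam_slope k = branch_sign * (fact k / (2 * half_width a b))"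

definition lam_offset :: "nat \<Rightarrow> real" where
  "lam_offset k = - lam_slope k * free_motion n t y0 (n + 1 - k)
     - branch_sign * (1/2 * (pm \<sigma> * (-1) ^ (n - 1) * t ^ k + midpoint a b / half_width a b * t ^ k))"

definition lam_poly :: "(nat \<Rightarrow> real) \<Rightarrow> nat \<Rightarrow> real" where
  "lam_poly z k = lam_slope k * z (n + 1 - k) + lam_offset k"

text \<open>The sign with which \<open>s q ^ k\<close> enters \<lambda> k on the branch, after the
  negation made in \<open>lam\<close>.\<close>

definition eps :: "nat \<Rightarrow> real" where
  "eps q = branch_sign * (pm \<sigma> * (-1) ^ (q + 1))"

lemma half_width_pos: "half_width a b > 0" using ab by (simp add: half_width_def)

lemma lam_slope_nonzero: "lam_slope k \<noteq> 0"
  using half_width_pos by (simp add: lam_slope_def branch_sign_def)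

lemma eps_cases: "eps q = 1 \<or> eps q = - 1"
  unfolding eps_def branch_sign_def by (cases \<sigma>; cases "even q") auto

text \<open>The negative signs sit at even q, except on the lower branch with odd \<open>n\<close>.
  There they sit at odd q, but \<open>n - 1\<close> is even and both parities are equally
  frequent.\<close>

lemma card_eps_neg: "card {q \<in> {1..n - 1}. eps q = - 1} = (n - 1) div 2"
proof (cases "\<sigma> = Lower \<and> odd n")
  case True
  then have "{q \<in> {1..n - 1}. eps q = - 1} = {q \<in> {1..n - 1}. odd q}"
    unfolding eps_def branch_sign_def by auto
  then have "card {q \<in> {1..n - 1}. eps q = - 1} = (n - 1 + 1) div 2" by (simp only: card_odd_interval)
  then show ?thesis using True by (auto elim!: oddE)
next
  case False
  then have "{q \<in> {1..n - 1}. eps q = - 1} = {q \<in> {1..n - 1}. even q}"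
    unfolding eps_def branch_sign_def by (cases \<sigma>) (auto simp: minus_one_power_iff split: if_splits)
  then show ?thesis by (simp only: card_even_interval)
qed

lemma lam_eq:
  assumes "k \<in> {1..n}" and z: "\<And>i. i < n \<Longrightarrow> vec_index x i = z (Suc i)"
  shows "lam \<sigma> n a b t y0 x k = lam_poly z k"
proof -
  have k: "n - (n - k + 1) + 1 = k" "n - k + 1 - 1 = n - k" "n - k < n" "n + 1 - k = Suc (n - k)" using assms by auto
  show ?thesis
    unfolding lam_def rho_def k(1,2) z[OF k(3)] lam_poly_def lam_offset_def lam_slope_def k(4)
    by (auto simp: branch_sign_def algebra_simps)
qed

text \<open>The matrix involves only coefficients up to index \<open>n\<close>, so the cutoff of
  \<lambda> after \<open>n\<close> is invisible.\<close>

lemma hankel_det_eq: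
  assumes "\<And>i. i < n \<Longrightarrow> vec_index x i = z (Suc i)"
  shows "hankel_det \<sigma> n a b t y0 x = hankel (n - 2 * delta n) (delta n) (Aseq (lam_poly z))"
proof -
  have "2 * delta n \<le> n" by (simp add: delta_def)
  have A: "A_coeff \<sigma> n a b t y0 x i = Aseq (lam_poly z) i" if "i \<le> n" for i
    unfolding A_coeff_def exp_coeff_Aseq by (rule Aseq_cong) (use that lam_eq assms in auto)
  show ?thesis unfolding hankel_det_def hankel_def
    by (rule arg_cong[where f = det], rule eq_matI) (use A \<open>2 * delta n \<le> n\<close> in auto)
qed

text \<open>The offset cancels the free motion, the midpoint term and the constant power of
  \<open>t\<close>, and the slope removes the factor 2 \<mu> / k!. Only the signed power sum
  remains.\<close>

lemma lam_poly_boundary_param: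
  assumes "k \<in> {1..n}"
  shows "lam_poly (\<lambda>k. peval (boundary_param \<sigma> n a b t y0 k) \<omega>) k = psum (n - 1) eps (\<lambda>q. \<omega> (n + q)) k"
proof -
  have k: "n - (n + 1 - k) + 1 = k" using assms by auto
  have "(\<Sum>q=1..n-1. (-1) ^ (q + 1) * \<omega> (n + q) ^ k) * (branch_sign * pm \<sigma>) = psum (n - 1) eps (\<lambda>q. \<omega> (n + q)) k"
    by (simp add: psum_def eps_def sum_distrib_left sum_distrib_right mult_ac)
  moreover define S where "S = (\<Sum>q=1..n-1. (-1) ^ (q + 1) * \<omega> (n + q) ^ k)"
  ultimately have S: "psum (n - 1) eps (\<lambda>q. \<omega> (n + q)) k = S * (branch_sign * pm \<sigma>)" by simp
  have P: "peval (boundary_param \<sigma> n a b t y0 (n + 1 - k)) \<omega> = free_motion n t y0 (n + 1 - k)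
     + midpoint a b * t ^ k / fact k + pm \<sigma> * (half_width a b / fact k) * ((-1) ^ (n - 1) * t ^ k + 2 * S)"
    unfolding boundary_param_def k S_def by simp
  define F where "F = (fact k :: real)"
  have "F > 0" by (simp add: F_def)
  define T where "T = t ^ k" define N where "N = (-1 :: real) ^ (n - 1)"
  define w where "w = half_width a b" define M where "M = midpoint a b"
  have "w > 0" using half_width_pos by (simp add: w_def)
  show ?thesis
    unfolding lam_poly_def lam_offset_def lam_slope_def P S F_def[symmetric] T_def[symmetric]
      N_def[symmetric] w_def[symmetric] M_def[symmetric]
    using \<open>w > 0\<close> \<open>F > 0\<close> by (simp add: field_simps)
qed

lemma boundary_param_iff:
  "(\<forall>k\<in>{1..n}. lam_poly z k = psum (n - 1) eps (\<lambda>q. \<omega> (n + q)) k) \<longleftrightarrow>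
   (\<forall>k\<in>{1..n}. z k = peval (boundary_param \<sigma> n a b t y0 k) \<omega>)" (is "?A \<longleftrightarrow> ?B")
proof -
  have "?A \<longleftrightarrow> (\<forall>k\<in>{1..n}. z (n + 1 - k) = peval (boundary_param \<sigma> n a b t y0 (n + 1 - k)) \<omega>)"
    using lam_slope_nonzero by (intro ball_cong refl) (auto simp: lam_poly_boundary_param[symmetric] lam_poly_def simp del: One_nat_def)
  also have "\<dots> \<longleftrightarrow> ?B"
  proof (intro iffI ballI)
    fix k assume *: "\<forall>k\<in>{1..n}. z (n + 1 - k) = peval (boundary_param \<sigma> n a b t y0 (n + 1 - k)) \<omega>"
      and k: "k \<in> {1..n}"
    have "n + 1 - k \<in> {1..n}" "n + 1 - (n + 1 - k) = k" using k by auto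
    then show "z k = peval (boundary_param \<sigma> n a b t y0 k) \<omega>" using * by metis
  next
    fix k assume *: ?B and k: "k \<in> {1..n}"
    have "n + 1 - k \<in> {1..n}" using k by auto
    then show "z (n + 1 - k) = peval (boundary_param \<sigma> n a b t y0 (n + 1 - k)) \<omega>" using * by blast
  qed
  finally show ?thesis .
qed

lemma hankel_implicit_polynomial:
  obtains H where "pvars H \<subseteq> {1..n}" "pdegree H = (delta n + 1) * (n - delta n)"
    "\<And>x. x \<in> carrier_vec n \<Longrightarrow> peval_vec H x = hankel_det \<sigma> n a b t y0 x"
    "implicit_polynomial \<sigma> n a b t y0 H"
proof (rule implicit_core[OF n, of lam_slope eps lam_offset])
  show "lam_slope k \<noteq> 0" for k by (rule lam_slope_nonzero)
  show "eps q = 1 \<or> eps q = - 1" for q by (rule eps_cases)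
  show "card {q \<in> {1..n - 1}. eps q = - 1} = (n - 1) div 2" by (rule card_eps_neg)
next
  fix H
  assume H: "pvars H \<subseteq> {1..n}"
    "\<And>z. peval H z = hankel (n - 2 * ((n - 1) div 2)) ((n - 1) div 2) (Aseq (\<lambda>k. lam_slope k * z (n + 1 - k) + lam_offset k))"
    "pdegree H = ((n - 1) div 2 + 1) * (n - (n - 1) div 2)"
    and ideal: "\<And>p. pvars p \<subseteq> {1..n} \<Longrightarrow>
      (\<forall>z s. (\<forall>k\<in>{1..n}. lam_slope k * z (n + 1 - k) + lam_offset k = psum (n - 1) eps s k) \<longrightarrow> peval p z = 0) \<longleftrightarrow>
      (\<exists>h. pvars h \<subseteq> {1..n} \<and> p = h * H)"
  have vanish: "(\<forall>\<omega>. peval p (\<lambda>k. peval (boundary_param \<sigma> n a b t y0 k) \<omega>) = 0) \<longleftrightarrow>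
      (\<forall>z s. (\<forall>k\<in>{1..n}. lam_poly z k = psum (n - 1) eps s k) \<longrightarrow> peval p z = 0)"
    (is "?A \<longleftrightarrow> ?B") if p: "pvars p \<subseteq> {1..n}" for p
  proof
    assume A: ?A
    show ?B
    proof (intro allI impI)
      fix z s assume *: "\<forall>k\<in>{1..n}. lam_poly z k = psum (n - 1) eps s k"
      define \<omega> where "\<omega> i = s (i - n)" for i
      have "s = (\<lambda>q. \<omega> (n + q))" by (simp add: \<omega>_def)
      with * have "\<forall>k\<in>{1..n}. z k = peval (boundary_param \<sigma> n a b t y0 k) \<omega>"
        using boundary_param_iff[of z \<omega>] by (simp only:)
      then have "peval p z = peval p (\<lambda>k. peval (boundary_param \<sigma> n a b t y0 k) \<omega>)"
        by (intro peval_cong[OF p]) blast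
      then show "peval p z = 0" using A by (simp only:)
    qed
  next
    assume B: ?B
    show ?A using B lam_poly_boundary_param by blast
  qed
  show thesis
  proof (rule that[of H])
    show "pvars H \<subseteq> {1..n}" by fact
    show "pdegree H = (delta n + 1) * (n - delta n)" unfolding delta_def by fact
    show "peval_vec H x = hankel_det \<sigma> n a b t y0 x" if "x \<in> carrier_vec n" for x
    proof -
      have "hankel_det \<sigma> n a b t y0 x =
          hankel (n - 2 * delta n) (delta n) (Aseq (lam_poly (\<lambda>k. vec_index x (k - 1))))"
        by (rule hankel_det_eq) simp
      then show ?thesis unfolding peval_vec_def H(2) delta_def lam_poly_def by (simp only:)
    qed
    have "elimination_ideal \<sigma> n a b t y0 = {h * H |h. pvars h \<subseteq> {1..n}}"
    proof (rule Set.set_eqI)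
      fix p :: mpoly
      have sub: "pvars (h * H) \<subseteq> {1..n}" if "pvars h \<subseteq> {1..n}" for h
        using that H(1) pvars_mult[of h H] by blast
      show "p \<in> elimination_ideal \<sigma> n a b t y0 \<longleftrightarrow> p \<in> {h * H |h. pvars h \<subseteq> {1..n}}"
      proof (cases "pvars p \<subseteq> {1..n}")
        case True
        show ?thesis
          unfolding elimination_ideal_iff vanish[OF True] lam_poly_def ideal[OF True] using True by blast
      next
        case False
        then show ?thesis using sub unfolding elimination_ideal_iff by blast
      qed
    qed
    with H(1) show "implicit_polynomial \<sigma> n a b t y0 H"
      unfolding implicit_polynomial_def by (rule conjI)
  qed
qed

text \<open>Two generators of one principal ideal divide each other, so they differ by a unit, and
  units are constants.\<close>

lemma implicit_polynomial_unique:
  assumes "implicit_polynomial \<sigma> n a b t y0 p" "implicit_polynomial \<sigma> n a b t y0 H" "H \<noteq> 0"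
  obtains c where "c \<noteq> 0" "p = pconst c * H"
proof -
  have 1: "pvars 1 \<subseteq> {1..n}" using pvars_const[of 1] by (simp add: pconst_1)
  have "p \<in> {h * p |h. pvars h \<subseteq> {1..n}}" "H \<in> {h * H |h. pvars h \<subseteq> {1..n}}"
    using 1 by (auto intro!: exI[of _ 1])
  then have "p \<in> {h * H |h. pvars h \<subseteq> {1..n}}" "H \<in> {h * p |h. pvars h \<subseteq> {1..n}}"
    using assms(1,2) unfolding implicit_polynomial_def by (simp_all only:)
  then obtain g h where gh: "p = h * H" "H = g * p" by blast
  then have "(h * g) * H = 1 * H" by (metis mult.assoc mult.commute mult_1)
  then have "h * g = 1" using assms(3) mult_right_cancel by blast
  then obtain c where "c \<noteq> 0" "h = pconst c" by (rule mpoly_unit_const)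
  with gh(1) show thesis using that by blast
qed

end

lemma pdegree_cmult:
  assumes "c \<noteq> 0"
  shows "pdegree (pconst c * H) = pdegree H"
proof (rule antisym)
  show "pdegree (pconst c * H) \<le> pdegree H"
    using pdegree_mult_le[of "pconst c" 0 H "pdegree H"] by simp
  have "H = pconst (1 / c) * (pconst c * H)"
    using assms by (intro mpoly_eqI) simp
  then show "pdegree H \<le> pdegree (pconst c * H)"
    using pdegree_mult_le[of "pconst (1 / c)" 0 "pconst c * H" "pdegree (pconst c * H)"]
    by (simp only: pdegree_const add_0 order_refl simp_thms)
qed

lemma implicit_polynomial_hankel:
  assumes n: "1 \<le> n" and ab: "a < b"
  shows "\<exists>p. implicit_polynomial \<sigma> n a b t y0 p"
    and "implicit_polynomial \<sigma> n a b t y0 p \<Longrightarrow> pdegree p = (delta n + 1) * (n - delta n)"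
    and "implicit_polynomial \<sigma> n a b t y0 p \<Longrightarrow>
      \<exists>c. c \<noteq> 0 \<and> (\<forall>x\<in>carrier_vec n. peval_vec p x = c * hankel_det \<sigma> n a b t y0 x)"
    and "implicit_polynomial \<sigma> n a b t y0 p \<Longrightarrow>
      (\<And>k. k \<in> {1..n} \<Longrightarrow> vec_index x (k - 1) = peval (boundary_param \<sigma> n a b t y0 k) \<omega>) \<Longrightarrow>
      peval_vec p x = 0"
proof -
  obtain H where H: "pvars H \<subseteq> {1..n}" "pdegree H = (delta n + 1) * (n - delta n)"
    "\<And>x. x \<in> carrier_vec n \<Longrightarrow> peval_vec H x = hankel_det \<sigma> n a b t y0 x"
    "implicit_polynomial \<sigma> n a b t y0 H"
    using hankel_implicit_polynomial[OF n ab, of \<sigma> t y0] by metis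
  then show "\<exists>p. implicit_polynomial \<sigma> n a b t y0 p" by blast
  have "2 * delta n \<le> n - 1" by (simp add: delta_def)
  then have "0 < (delta n + 1) * (n - delta n)" using n by simp
  moreover have "pdegree 0 = 0" using pdegree_const[of 0] by (simp add: pconst_0)
  ultimately have "H \<noteq> 0" using H(2) by auto
  {
    assume p: "implicit_polynomial \<sigma> n a b t y0 p"
    obtain c where c: "c \<noteq> 0" "p = pconst c * H"
      using implicit_polynomial_unique[OF n ab p H(4) \<open>H \<noteq> 0\<close>] by blast
    show "pdegree p = (delta n + 1) * (n - delta n)"
      unfolding c(2) pdegree_cmult[OF c(1)] by (rule H(2))
    show "\<exists>c. c \<noteq> 0 \<and> (\<forall>x\<in>carrier_vec n. peval_vec p x = c * hankel_det \<sigma> n a b t y0 x)"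
      using c H(3) by (intro exI[of _ c]) (simp add: peval_vec_def)
    assume x: "\<And>k. k \<in> {1..n} \<Longrightarrow> vec_index x (k - 1) = peval (boundary_param \<sigma> n a b t y0 k) \<omega>"
    have "p = 1 * p" "pvars 1 \<subseteq> {1..n}" using pvars_const[of 1] by (auto simp: pconst_1)
    then have "p \<in> elimination_ideal \<sigma> n a b t y0" using p unfolding implicit_polynomial_def by blast
    then have *: "pvars p \<subseteq> {1..n}" "peval p (\<lambda>k. peval (boundary_param \<sigma> n a b t y0 k) \<omega>) = 0"
      unfolding elimination_ideal_iff by blast+
    have "peval_vec p x = peval p (\<lambda>k. peval (boundary_param \<sigma> n a b t y0 k) \<omega>)"
      unfolding peval_vec_def by (rule peval_cong[OF *(1)]) (rule x)
    then show "peval_vec p x = 0" using *(2) by simp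
  }
qed

section \<open>Chains of integrators with measurable inputs\<close>

lemma has_integral_abs_le:
  fixes f :: "real \<Rightarrow> real"
  assumes "(f has_integral I) {u..v}" "u \<le> v" "\<And>s. s \<in> {u..v} \<Longrightarrow> \<bar>f s\<bar> \<le> B"
  shows "\<bar>I\<bar> \<le> B * (v - u)"
proof -
  have "0 \<le> B" using assms(2) assms(3)[of u] by auto
  then show ?thesis
    using has_integral_bound[of B f I u v] assms by (simp add: cbox_interval)
qed

text \<open>The difference quotients are at most C * \<bar>v - u\<bar>, so the derivative is 0
  everywhere.\<close>

lemma const_if_quadratic_bound:
  fixes E :: "real \<Rightarrow> real"
  assumes "\<And>u v. 0 \<le> u \<Longrightarrow> u \<le> v \<Longrightarrow> v \<le> T \<Longrightarrow> \<bar>E v - E u\<bar> \<le> C * (v - u)\<^sup>2" "0 \<le> T"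
  shows "E T = E 0"
proof (rule has_derivative_zero_unique[where f = E and s = "{0..T}" and x = T and y = 0])
  have C: "\<bar>E v - E u\<bar> \<le> C * (v - u)\<^sup>2" if "u \<in> {0..T}" "v \<in> {0..T}" for u v
    using assms(1)[of u v] assms(1)[of v u] that
    by (cases "u \<le> v") (auto simp: abs_minus_commute power2_commute)
  fix u assume u: "u \<in> {0..T}"
  have "((\<lambda>v. (E v - E u) / (v - u)) \<longlongrightarrow> 0) (at u within {0..T})"
  proof (rule Lim_null_comparison)
    show "\<forall>\<^sub>F v in at u within {0..T}. norm ((E v - E u) / (v - u)) \<le> C * \<bar>v - u\<bar>"
    proof (unfold eventually_at_filter, rule always_eventually, intro allI impI)
      fix v assume "v \<noteq> u" "v \<in> {0..T}"
      then have "\<bar>E v - E u\<bar> / \<bar>v - u\<bar> \<le> C * (v - u)\<^sup>2 / \<bar>v - u\<bar>"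
        by (intro divide_right_mono C u) auto
      also have "\<dots> = C * \<bar>v - u\<bar>" using \<open>v \<noteq> u\<close> by (simp add: power2_eq_square abs_if field_simps)
      finally show "norm ((E v - E u) / (v - u)) \<le> C * \<bar>v - u\<bar>" by simp
    qed
    show "((\<lambda>v. C * \<bar>v - u\<bar>) \<longlongrightarrow> 0) (at u within {0..T})"
      by (auto intro!: tendsto_eq_intros)
  qed
  then have "(E has_field_derivative 0) (at u within {0..T})"
    by (simp add: has_field_derivative_iff)
  moreover have "(*) (0 :: real) = (\<lambda>h. 0)" by (simp add: fun_eq_iff)
  ultimately show "(E has_derivative (\<lambda>h. 0)) (at u within {0..T})"
    unfolding has_field_derivative_def by (simp only:)
qed (use assms in auto)

lemma measurable_times_continuous:
  fixes f g :: "real \<Rightarrow> real"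
  assumes "f \<in> borel_measurable (lebesgue_on {u..v})" "continuous_on {u..v} g"
  shows "(\<lambda>s. g s * f s) \<in> borel_measurable (lebesgue_on {u..v})"
  by (rule borel_measurable_times[OF continuous_imp_measurable_on_sets_lebesgue[OF assms(2)] assms(1)]) simp

lemma integrable_times_continuous:
  fixes f g :: "real \<Rightarrow> real"
  assumes "f \<in> borel_measurable (lebesgue_on {u..v})" "continuous_on {u..v} g"
    "\<And>s. s \<in> {u..v} \<Longrightarrow> \<bar>f s\<bar> \<le> M"
  shows "(\<lambda>s. g s * f s) integrable_on {u..v}"
proof (rule measurable_bounded_by_integrable_imp_integrable_real)
  show "(\<lambda>s. g s * f s) \<in> borel_measurable (lebesgue_on {u..v})"
    using assms by (intro measurable_times_continuous)
  have "continuous_on {u..v} (\<lambda>s. \<bar>g s\<bar> * \<bar>M\<bar>)" by (intro continuous_intros assms)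
  then show "(\<lambda>s. \<bar>g s\<bar> * \<bar>M\<bar>) integrable_on {u..v}" by (rule integrable_continuous_real)
  show "\<bar>g s * f s\<bar> \<le> \<bar>g s\<bar> * \<bar>M\<bar>" if "s \<in> {u..v}" for s
    unfolding abs_mult using assms(3)[OF that] by (intro mult_left_mono) auto
qed auto

lemma continuous_on_primitive:
  fixes f F :: "real \<Rightarrow> real"
  assumes "0 \<le> T" "\<And>s. s \<in> {0..T} \<Longrightarrow> (f has_integral (F s - c)) {0..s}"
  shows "continuous_on {0..T} F"
proof -
  have "f integrable_on {0..T}" using assms by (auto simp: integrable_on_def)
  then have "continuous_on {0..T} (\<lambda>s. c + integral {0..s} f)"
    by (intro continuous_intros indefinite_integral_continuous_1)
  then show ?thesis
  proof (rule continuous_on_eq)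
    fix s assume "s \<in> {0..T}"
    from integral_unique[OF assms(2)[OF this]] show "c + integral {0..s} f = F s" by simp
  qed
qed

text \<open>\<open>F\<close> is only absolutely continuous. The difference of the two sides over a subinterval is
  quadratically small in its length, so it vanishes.\<close>

lemma integration_by_parts_primitive:
  fixes f g g' F :: "real \<Rightarrow> real"
  assumes T: "0 \<le> T" and f: "f \<in> borel_measurable (lebesgue_on {0..T})"
    and M: "\<And>s. s \<in> {0..T} \<Longrightarrow> \<bar>f s\<bar> \<le> M"
    and F: "\<And>s. s \<in> {0..T} \<Longrightarrow> (f has_integral (F s - c)) {0..s}"
    and g: "\<And>s. s \<in> {0..T} \<Longrightarrow> (g has_real_derivative g' s) (at s within {0..T})"
    and g': "continuous_on {0..T} g'"
  shows "((\<lambda>s. g' s * F s + g s * f s) has_integral (g T * F T - g 0 * F 0)) {0..T}"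
proof -
  define h where "h s = g' s * F s + g s * f s" for s
  have contF: "continuous_on {0..T} F" by (rule continuous_on_primitive[OF T F])
  have contg: "continuous_on {0..T} g" using g by (rule DERIV_continuous_on)
  have "(\<lambda>s. g' s * F s) integrable_on {0..T}"
    by (intro integrable_continuous_real continuous_intros contF g')
  then have int_h: "h integrable_on {0..T}" unfolding h_def
    by (intro integrable_add integrable_times_continuous[OF f contg M])
  have int_f: "f integrable_on {0..T}" using F[of T] T by (auto simp: integrable_on_def)
  have "\<exists>B. \<forall>s\<in>{0..T}. \<bar>g' s\<bar> \<le> B"
    using compact_imp_bounded[OF compact_continuous_image[OF g' compact_Icc]]
    by (auto simp: bounded_real)
  then obtain B where B: "\<And>s. s \<in> {0..T} \<Longrightarrow> \<bar>g' s\<bar> \<le> B" by blast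
  have M0: "0 \<le> M" and B0: "0 \<le> B" using M[of 0] B[of 0] T by auto
  define E where "E s = integral {0..s} h - g s * F s" for s
  have "E T = E 0"
  proof (rule const_if_quadratic_bound[OF _ T])
    fix u v assume uv: "0 \<le> u" "u \<le> v" "v \<le> T"
    then have sub: "{u..v} \<subseteq> {0..T}" by auto
    have split: "(k has_integral (integral {0..v} k - integral {0..u} k)) {u..v}"
      if "k integrable_on {0..T}" for k :: "real \<Rightarrow> real"
    proof -
      have k: "k integrable_on {0..v}" by (rule integrable_on_subinterval[OF that]) (use uv in auto)
      have "integral {0..u} k + integral {u..v} k = integral {0..v} k"
        by (rule Henstock_Kurzweil_Integration.integral_combine) (use uv k in auto)
      moreover have "k integrable_on {u..v}" by (rule integrable_on_subinterval[OF that sub])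
      ultimately show ?thesis by (simp add: has_integral_iff)
    qed
    have If: "(f has_integral (F v - F u)) {u..v}"
      using split[OF int_f] integral_unique[OF F[of u]] integral_unique[OF F[of v]] uv by simp
    have Ig: "(g' has_integral (g v - g u)) {u..v}"
    proof (rule fundamental_theorem_of_calculus)
      fix s assume "s \<in> {u..v}"
      then have "(g has_real_derivative g' s) (at s within {u..v})"
        using DERIV_subset[OF g sub] sub by blast
      then show "(g has_vector_derivative g' s) (at s within {u..v})"
        by (simp add: has_real_derivative_iff_has_vector_derivative)
    qed (use uv in auto)
    \<comment> \<open>The increment of g F over [u, v] is F v (g v - g u) + g u (F v - F u).
      Subtracting the matching integrand leaves g' (F s - F v) + (g s - g u) f, which is pointwise
      of order v - u.\<close>
    have "((\<lambda>s. h s - F v * g' s - g u * f s) has_integral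
        (integral {0..v} h - integral {0..u} h - F v * (g v - g u) - g u * (F v - F u))) {u..v}"
      by (intro has_integral_diff has_integral_mult_right split[OF int_h] If Ig)
    moreover have "\<bar>h s - F v * g' s - g u * f s\<bar> \<le> 2 * B * M * (v - u)" if s: "s \<in> {u..v}" for s
    proof -
      have "\<bar>F v - F s\<bar> \<le> M * (v - s)"
      proof (rule has_integral_abs_le)
        have *: "(f has_integral (integral {0..v} f - integral {0..s} f)) {s..v}"
        proof -
          have k: "f integrable_on {0..v}" "f integrable_on {s..v}"
            by (rule integrable_on_subinterval[OF int_f], use uv s in auto)+
          have "integral {0..s} f + integral {s..v} f = integral {0..v} f"
            by (rule Henstock_Kurzweil_Integration.integral_combine) (use uv k s in auto)
          with k show ?thesis by (simp add: has_integral_iff)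
        qed
        show "(f has_integral (F v - F s)) {s..v}"
          using * integral_unique[OF F[of s]] integral_unique[OF F[of v]] uv s by simp
      qed (use s uv M in auto)
      also have "\<dots> \<le> M * (v - u)" using s M0 by (intro mult_left_mono) auto
      finally have 1: "\<bar>F s - F v\<bar> \<le> M * (v - u)" by (simp add: abs_minus_commute)
      have "\<bar>g s - g u\<bar> \<le> B * (s - u)"
      proof (rule has_integral_abs_le)
        show "(g' has_integral (g s - g u)) {u..s}"
        proof (rule fundamental_theorem_of_calculus)
          fix x assume "x \<in> {u..s}"
          then have "(g has_real_derivative g' x) (at x within {u..s})"
            using DERIV_subset[OF g, of x "{u..s}"] sub s by force
          then show "(g has_vector_derivative g' x) (at x within {u..s})"
            by (simp add: has_real_derivative_iff_has_vector_derivative)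
        qed (use s in auto)
      qed (use s uv B in auto)
      also have "\<dots> \<le> B * (v - u)" using s B0 by (intro mult_left_mono) auto
      finally have 2: "\<bar>g s - g u\<bar> \<le> B * (v - u)" .
      have "h s - F v * g' s - g u * f s = g' s * (F s - F v) + (g s - g u) * f s"
        by (simp add: h_def algebra_simps)
      also have "\<bar>\<dots>\<bar> \<le> \<bar>g' s\<bar> * \<bar>F s - F v\<bar> + \<bar>g s - g u\<bar> * \<bar>f s\<bar>"
        by (metis abs_mult abs_triangle_ineq)
      also have "\<dots> \<le> B * (M * (v - u)) + (B * (v - u)) * M"
        using s sub uv by (intro add_mono mult_mono 1 2 B M) (auto intro!: mult_nonneg_nonneg simp: B0 M0)
      finally show ?thesis by (simp add: algebra_simps)
    qed
    ultimately have "\<bar>integral {0..v} h - integral {0..u} h - F v * (g v - g u) - g u * (F v - F u)\<bar>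
        \<le> 2 * B * M * (v - u) * (v - u)"
      by (rule has_integral_abs_le[OF _ uv(2)])
    then show "\<bar>E v - E u\<bar> \<le> 2 * B * M * (v - u)\<^sup>2"
      by (simp add: E_def power2_eq_square algebra_simps)
  qed
  then have "integral {0..T} h = g T * F T - g 0 * F 0" by (simp add: E_def)
  with int_h show ?thesis unfolding h_def[symmetric] by (simp add: has_integral_iff)
qed

text \<open>Repeated integration by parts moves all integrations of a chain of integrators onto the kernel.\<close>

lemma integrator_chain:
  fixes \<eta> :: "nat \<Rightarrow> real \<Rightarrow> real"
  assumes t: "0 \<le> t" and meas: "\<eta> n \<in> borel_measurable (lebesgue_on {0..t})"
    and M: "\<And>s. s \<in> {0..t} \<Longrightarrow> \<bar>\<eta> n s\<bar> \<le> M"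
    and chain: "\<And>k T. k < n \<Longrightarrow> T \<in> {0..t} \<Longrightarrow> (\<eta> (Suc k) has_integral (\<eta> k T - c k)) {0..T}"
    and m: "m < n"
  shows "((\<lambda>s. (t - s) ^ m / fact m * \<eta> (Suc m) s) has_integral
    (\<eta> 0 t - (\<Sum>k\<le>m. t ^ k / fact k * c k))) {0..t}"
  using m
proof (induction m)
  case 0
  then show ?case using chain[of 0 t] t by simp
next
  case (Suc m)
  have cont: "continuous_on {0..t} (\<eta> k)" if "k < n" for k
    using continuous_on_primitive[OF t chain[OF that]] .
  have bd: "\<eta> k \<in> borel_measurable (lebesgue_on {0..t}) \<and> (\<exists>M. \<forall>s\<in>{0..t}. \<bar>\<eta> k s\<bar> \<le> M)" if "k \<le> n" for k
  proof (cases "k = n")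
    case False
    then have k: "k < n" using that by simp
    then have "\<eta> k \<in> borel_measurable (lebesgue_on {0..t})"
      by (intro continuous_imp_measurable_on_sets_lebesgue cont) auto
    moreover have "\<exists>M. \<forall>s\<in>{0..t}. \<bar>\<eta> k s\<bar> \<le> M"
      using compact_imp_bounded[OF compact_continuous_image[OF cont[OF k] compact_Icc]]
      by (auto simp: bounded_real)
    ultimately show ?thesis by blast
  qed (use meas M in blast)
  obtain M' where M': "\<And>s. s \<in> {0..t} \<Longrightarrow> \<bar>\<eta> (Suc (Suc m)) s\<bar> \<le> M'"
    using bd[of "Suc (Suc m)"] Suc.prems Suc_leI by blast
  \<comment> \<open>The antiderivative of the kernel that vanishes at \<open>t\<close>, so that the
    only boundary term is the one at 0.\<close>
  define g where "g s = - ((t - s) ^ Suc m / fact (Suc m))" for s :: real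
  have "((\<lambda>s. (t - s) ^ m / fact m * \<eta> (Suc m) s + g s * \<eta> (Suc (Suc m)) s) has_integral
      (g t * \<eta> (Suc m) t - g 0 * \<eta> (Suc m) 0)) {0..t}"
  proof (rule integration_by_parts_primitive[OF t _ M' chain])
    show "\<eta> (Suc (Suc m)) \<in> borel_measurable (lebesgue_on {0..t})"
      using bd[of "Suc (Suc m)"] Suc.prems by auto
    show "(g has_real_derivative (t - s) ^ m / fact m) (at s within {0..t})" for s
      unfolding g_def
      by (auto intro!: derivative_eq_intros simp: field_simps simp del: power_Suc of_nat_Suc)
    show "continuous_on {0..t} (\<lambda>s. (t - s) ^ m / fact m)" by (intro continuous_intros) auto
  qed (use Suc.prems in auto)
  from has_integral_diff[OF Suc.IH this] Suc.prems
  have "((\<lambda>s. - (g s * \<eta> (Suc (Suc m)) s)) has_integral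
      (\<eta> 0 t - (\<Sum>k\<le>m. t ^ k / fact k * c k) - (g t * \<eta> (Suc m) t - g 0 * \<eta> (Suc m) 0))) {0..t}"
    by (simp add: algebra_simps)
  \<comment> \<open>An integral over the single point 0 is 0, so the chain starts at
    \<open>c\<close>.\<close>
  moreover have "\<eta> (Suc m) 0 = c (Suc m)"
    using chain[of "Suc m" 0] Suc.prems t has_integral_unique[of "\<eta> (Suc (Suc m))" _ "{0}" 0] by fastforce
  moreover have "g t = 0" "g 0 = - (t ^ Suc m / fact (Suc m))" by (simp_all add: g_def)
  ultimately show ?case by (simp add: g_def diff_diff_eq del: power_Suc fact_Suc)
qed

text \<open>The chain is built backwards from the input by repeated integration:
  \<open>\<zeta> j\<close> is the state \<open>\<eta> (n - j)\<close>.\<close>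

lemma integrator_chain_exists:
  fixes w :: "real \<Rightarrow> real"
  assumes "w integrable_on {0..t}" "0 \<le> t"
  shows "\<exists>\<eta>. \<eta> n = w \<and> (\<forall>k<n. \<forall>T\<in>{0..t}. (\<eta> (Suc k) has_integral (\<eta> k T - c k)) {0..T})"
proof -
  define \<zeta> where "\<zeta> = rec_nat w (\<lambda>j f T. c (n - Suc j) + integral {0..T} f)"
  have \<zeta>: "\<zeta> 0 = w" "\<And>j T. \<zeta> (Suc j) T = c (n - Suc j) + integral {0..T} (\<zeta> j)"
    by (simp_all add: \<zeta>_def)
  have int: "\<zeta> j integrable_on {0..t}" for j
  proof (induction j)
    case 0
    then show ?case using assms by (simp add: \<zeta>)
  next
    case (Suc j)
    have "continuous_on {0..t} (\<lambda>T. c (n - Suc j) + integral {0..T} (\<zeta> j))"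
      by (intro continuous_intros indefinite_integral_continuous_1 Suc)
    then show ?case by (simp add: integrable_continuous_real flip: \<zeta>(2))
  qed
  have "(\<zeta> (n - Suc k) has_integral (\<zeta> (n - k) T - c k)) {0..T}" if "k < n" "T \<in> {0..t}" for k T
  proof -
    have "\<zeta> (n - Suc k) integrable_on {0..T}"
      by (rule integrable_on_subinterval[OF int]) (use that in auto)
    moreover have "n - k = Suc (n - Suc k)" "n - Suc (n - Suc k) = k" using that by auto
    ultimately show ?thesis by (simp add: \<zeta>(2) has_integral_iff)
  qed
  then show ?thesis by (intro exI[of _ "\<lambda>k. \<zeta> (n - k)"]) (auto simp: \<zeta>)
qed

section \<open>Supporting functionals at frontier points\<close>

lemma continuous_on_coordinate: "continuous_on S (\<lambda>c :: 'a \<Rightarrow> real. c i)"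
  by (rule continuous_on_subset[OF continuous_on_product_coordinates]) simp

lemma compact_box: "compact {c :: 'a \<Rightarrow> real. \<forall>i. c i \<in> {l..u}}"
proof -
  have "compactin (product_topology (\<lambda>i :: 'a. euclideanreal) UNIV) (PiE UNIV (\<lambda>_. {l..u}))"
    by (simp add: compactin_PiE)
  then have "compact (PiE (UNIV :: 'a set) (\<lambda>_. {l..u}))"
    by (simp add: euclidean_product_topology)
  also have "PiE (UNIV :: 'a set) (\<lambda>_. {l..u}) = {c. \<forall>i. c i \<in> {l..u}}"
    by auto
  finally show ?thesis .
qed

lemma compact_sphere:
  "compact {c :: nat \<Rightarrow> real. (\<forall>i. c i \<in> {-1..1}) \<and> (\<forall>i\<ge>n. c i = 0) \<and> (\<Sum>i<n. (c i)\<^sup>2) = 1}"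
proof -
  have 1: "closed {c :: nat \<Rightarrow> real. (\<Sum>i<n. (c i)\<^sup>2) = 1}"
    by (rule closed_Collect_eq, rule continuous_on_sum, rule continuous_on_power,
        rule continuous_on_coordinate, rule continuous_on_const)
  have "closed {c :: nat \<Rightarrow> real. c i = 0}" for i
    by (rule closed_Collect_eq, rule continuous_on_coordinate, rule continuous_on_const)
  then have 2: "closed (\<Inter>i\<in>{n..}. {c :: nat \<Rightarrow> real. c i = 0})"
    by (rule closed_INT[rule_format])
  have "compact ({c. \<forall>i. c i \<in> {-1..1}} \<inter> ((\<Inter>i\<in>{n..}. {c. c i = 0}) \<inter> {c :: nat \<Rightarrow> real. (\<Sum>i<n. (c i)\<^sup>2) = 1}))"
    by (rule compact_Int_closed[OF compact_box closed_Int[OF 2 1]])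
  then show ?thesis by (rule back_subst[where P = compact]) auto
qed

text \<open>Weights of convex combinations are functions on the type of points that vanish off
  \<open>Y\<close>; the closest point of the hull of \<open>Y\<close> is then found by minimizing
  over weights.\<close>

lemma compact_simplex:
  assumes "finite Y"
  shows "compact {\<theta> :: 'a \<Rightarrow> real. (\<forall>y. \<theta> y \<in> {0..1}) \<and> (\<forall>y. y \<notin> Y \<longrightarrow> \<theta> y = 0) \<and> (\<Sum>y\<in>Y. \<theta> y) = 1}"
proof -
  have 1: "closed {\<theta> :: 'a \<Rightarrow> real. (\<Sum>y\<in>Y. \<theta> y) = 1}"
    by (rule closed_Collect_eq, rule continuous_on_sum, rule continuous_on_coordinate, rule continuous_on_const)
  have "closed {\<theta> :: 'a \<Rightarrow> real. \<theta> y = 0}" for y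
    by (rule closed_Collect_eq, rule continuous_on_coordinate, rule continuous_on_const)
  then have 2: "closed (\<Inter>y\<in>-Y. {\<theta> :: 'a \<Rightarrow> real. \<theta> y = 0})"
    by (rule closed_INT[rule_format])
  have "compact ({\<theta>. \<forall>i. \<theta> i \<in> {0..1}} \<inter> ((\<Inter>i\<in>-Y. {\<theta>. \<theta> i = 0}) \<inter> {\<theta> :: 'a \<Rightarrow> real. (\<Sum>i\<in>Y. \<theta> i) = 1}))"
    by (rule compact_Int_closed[OF compact_box closed_Int[OF 2 1]])
  then show ?thesis by (rule back_subst[where P = compact]) auto
qed

text \<open>By compactness of the unit sphere finitely many points of \<open>C\<close> lie strictly beyond \<open>x\<close> in every
  direction; projecting \<open>x + v\<close> onto their convex hull shows that the hull contains \<open>x + v\<close>.\<close>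

lemma interior_if_no_support:
  fixes C :: "(nat \<Rightarrow> real) set" and x :: "nat \<Rightarrow> real"
  assumes n: "1 \<le> n"
    and conv: "\<And>Y \<theta>. finite Y \<Longrightarrow> Y \<subseteq> C \<Longrightarrow> (\<And>y. y \<in> Y \<Longrightarrow> 0 \<le> \<theta> y) \<Longrightarrow> (\<Sum>y\<in>Y. \<theta> y) = (1::real) \<Longrightarrow>
      \<exists>z\<in>C. \<forall>i<n. z i = (\<Sum>y\<in>Y. \<theta> y * y i)"
    and sep: "\<And>c. \<exists>i<n. c i \<noteq> 0 \<Longrightarrow> \<exists>y\<in>C. (\<Sum>i<n. c i * (y i - x i)) > 0"
  shows "\<exists>\<epsilon>>0. \<forall>v. (\<forall>i<n. \<bar>v i\<bar> < \<epsilon>) \<longrightarrow> (\<exists>z\<in>C. \<forall>i<n. z i = x i + v i)"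
proof -
  define K where "K = {c :: nat \<Rightarrow> real. (\<forall>i. c i \<in> {-1..1}) \<and> (\<forall>i\<ge>n. c i = 0) \<and> (\<Sum>i<n. (c i)\<^sup>2) = 1}"
  \<comment> \<open>The margin 1 / (k + 1) is part of the index, so that a finite subcover yields
    one margin \<open>\<eta>\<close> for all directions.\<close>
  define U where "U p = {c. 1 / real (Suc (snd p)) < (\<Sum>i<n. c i * (fst p i - x i))}" for p :: "(nat \<Rightarrow> real) \<times> nat"
  have "compact K" unfolding K_def by (rule compact_sphere)
  moreover have "open (U p)" for p
    unfolding U_def
    by (rule open_Collect_less, rule continuous_on_const, rule continuous_on_sum, rule continuous_on_mult,
        rule continuous_on_coordinate, rule continuous_on_const)
  moreover have "K \<subseteq> (\<Union>p\<in>C \<times> UNIV. U p)"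
  proof
    fix c assume "c \<in> K"
    then have "(\<Sum>i<n. (c i)\<^sup>2) \<noteq> 0" by (simp add: K_def)
    then have "\<exists>i<n. c i \<noteq> 0" by (metis (no_types, lifting) lessThan_iff power_zero_numeral sum.neutral)
    from sep[OF this] obtain y where y: "y \<in> C" "(\<Sum>i<n. c i * (y i - x i)) > 0" by blast
    from reals_Archimedean[OF y(2)] obtain k where "inverse (real (Suc k)) < (\<Sum>i<n. c i * (y i - x i))" by blast
    then have "c \<in> U (y, k)" by (simp add: U_def inverse_eq_divide)
    with y(1) show "c \<in> (\<Union>p\<in>C \<times> UNIV. U p)" by blast
  qed
  ultimately obtain D where D: "D \<subseteq> C \<times> UNIV" "finite D" "K \<subseteq> (\<Union>p\<in>D. U p)"
    using compactE_image[of K "C \<times> UNIV" U] by metis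
  define Y where "Y = fst ` D"
  define \<eta> where "\<eta> = 1 / real (Suc (Max (snd ` D)))"
  have Y: "finite Y" "Y \<subseteq> C" using D by (auto simp: Y_def)
  have \<eta>: "\<eta> > 0" by (simp add: \<eta>_def)
  have far: "\<exists>y\<in>Y. \<eta> < (\<Sum>i<n. c i * (y i - x i))" if c: "c \<in> K" for c
  proof -
    obtain p where p: "p \<in> D" "c \<in> U p" using D(3) c by blast
    have "snd p \<le> Max (snd ` D)" using p(1) D(2) by simp
    then have "\<eta> \<le> 1 / real (Suc (snd p))" unfolding \<eta>_def by (intro divide_left_mono) auto
    moreover have "1 / real (Suc (snd p)) < (\<Sum>i<n. c i * (fst p i - x i))" using p(2) by (simp add: U_def)
    moreover have "fst p \<in> Y" using p(1) by (simp add: Y_def)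
    ultimately show ?thesis by (intro bexI[of _ "fst p"]) linarith
  qed
  define \<Delta> where "\<Delta> = {\<theta> :: (nat \<Rightarrow> real) \<Rightarrow> real. (\<forall>y. \<theta> y \<in> {0..1}) \<and> (\<forall>y. y \<notin> Y \<longrightarrow> \<theta> y = 0) \<and> (\<Sum>y\<in>Y. \<theta> y) = 1}"
  have "(\<lambda>i. if i = 0 then 1 else 0 :: real) \<in> K"
  proof -
    have "(\<Sum>i<n. (if i = 0 then 1 else 0 :: real)\<^sup>2) = (\<Sum>i<n. if i = 0 then 1 else 0)"
      by (intro sum.cong) auto
    then show ?thesis using n by (auto simp: K_def)
  qed
  from far[OF this] obtain y0 where y0: "y0 \<in> Y" by blast
  have point: "(\<lambda>y. if y = y1 then 1 else 0) \<in> \<Delta>" if "y1 \<in> Y" for y1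
    using that Y(1) by (auto simp: \<Delta>_def)
  have hull: "\<exists>z\<in>C. \<forall>i<n. z i = x i + v i" if v: "(\<Sum>i<n. (v i)\<^sup>2) \<le> \<eta>\<^sup>2" for v
  proof -
    \<comment> \<open>The squared distance from x + v to the point of the hull with weights
      \<open>\<theta>\<close>.\<close>
    define \<phi> where "\<phi> \<theta> = (\<Sum>i<n. (x i + v i - (\<Sum>y\<in>Y. \<theta> y * y i))\<^sup>2)" for \<theta> :: "(nat \<Rightarrow> real) \<Rightarrow> real"
    have "continuous_on \<Delta> \<phi>" unfolding \<phi>_def
      by (rule continuous_on_sum, rule continuous_on_power, rule continuous_on_diff, rule continuous_on_const,
          rule continuous_on_sum, rule continuous_on_mult, rule continuous_on_coordinate, rule continuous_on_const)
    moreover have "compact \<Delta>" unfolding \<Delta>_def by (rule compact_simplex[OF Y(1)])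
    moreover have "\<Delta> \<noteq> {}" using point[OF y0] by blast
    ultimately obtain \<theta> where \<theta>: "\<theta> \<in> \<Delta>" "\<And>\<theta>'. \<theta>' \<in> \<Delta> \<Longrightarrow> \<phi> \<theta> \<le> \<phi> \<theta>'"
      using continuous_attains_inf[of \<Delta> \<phi>] by blast
    define z where "z i = (\<Sum>y\<in>Y. \<theta> y * y i)" for i
    define e where "e i = (if i < n then x i + v i - z i else 0)" for i
    define q where "q = (\<Sum>i<n. (e i)\<^sup>2)"
    have q: "\<phi> \<theta> = q" unfolding \<phi>_def q_def by (intro sum.cong) (auto simp: e_def z_def)
    have obtuse: "(\<Sum>i<n. e i * (y i - z i)) \<le> 0" if y: "y \<in> Y" for y
    proof (rule ccontr)
      define d where "d = (\<Sum>i<n. e i * (y i - z i))"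
      define N where "N = (\<Sum>i<n. (y i - z i)\<^sup>2)"
      assume "\<not> (\<Sum>i<n. e i * (y i - z i)) \<le> 0"
      then have d: "d > 0" by (simp add: d_def)
      have N: "N \<ge> 0" unfolding N_def by (intro sum_nonneg) auto
      \<comment> \<open>First-order optimality: shifting the fraction \<open>s\<close> of the weight
        to \<open>y\<close> must not decrease the distance.\<close>
      have *: "2 * d \<le> s * N" if s: "0 < s" "s \<le> 1" for s
      proof -
        define \<theta>' where "\<theta>' u = (1 - s) * \<theta> u + s * (if u = y then 1 else 0)" for u
        have "\<theta>' \<in> \<Delta>"
        proof -
          have "\<theta>' u \<in> {0..1}" for u
          proof -
            have "0 \<le> \<theta> u" "\<theta> u \<le> 1" using \<theta>(1) by (auto simp: \<Delta>_def)
            then have "(1 - s) * \<theta> u \<le> (1 - s) * 1" "0 \<le> (1 - s) * \<theta> u" using s mult_left_mono[of "\<theta> u" 1 "1 - s"] by auto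
            then show ?thesis using s by (auto simp: \<theta>'_def)
          qed
          moreover have "(\<Sum>u\<in>Y. \<theta>' u) = (1 - s) * (\<Sum>u\<in>Y. \<theta> u) + s * (\<Sum>u\<in>Y. if u = y then 1 else 0)"
            unfolding \<theta>'_def sum.distrib sum_distrib_left ..
          then have "(\<Sum>u\<in>Y. \<theta>' u) = 1" using \<theta>(1) y Y(1) by (simp add: \<Delta>_def)
          ultimately show ?thesis using \<theta>(1) y by (auto simp: \<Delta>_def \<theta>'_def)
        qed
        have z': "(\<Sum>u\<in>Y. \<theta>' u * u i) = z i + s * (y i - z i)" for i
        proof -
          have "(\<Sum>u\<in>Y. \<theta>' u * u i) = (1 - s) * z i + s * (\<Sum>u\<in>Y. if u = y then u i else 0)"
            unfolding \<theta>'_def z_def sum_distrib_left sum.distrib[symmetric]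
            by (intro sum.cong) (auto simp: algebra_simps)
          then show ?thesis using y Y(1) by (simp add: algebra_simps)
        qed
        have "\<phi> \<theta>' = (\<Sum>i<n. (e i)\<^sup>2 - 2 * s * (e i * (y i - z i)) + s\<^sup>2 * (y i - z i)\<^sup>2)"
          unfolding \<phi>_def z' by (intro sum.cong) (auto simp: e_def power2_eq_square algebra_simps)
        also have "\<dots> = q - 2 * s * d + s\<^sup>2 * N"
          by (simp add: q_def d_def N_def sum.distrib sum_subtractf sum_distrib_left)
        finally have "q \<le> q - 2 * s * d + s\<^sup>2 * N" using \<theta>(2)[OF \<open>\<theta>' \<in> \<Delta>\<close>] q by simp
        then have "s * (2 * d) \<le> s * (s * N)" by (simp add: power2_eq_square algebra_simps)
        then show ?thesis using s(1) by simp
      qed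
      \<comment> \<open>A step this small gives s * N \<le> d, which contradicts 2 * d \<le> s * N
        because d > 0.\<close>
      define s where "s = min 1 (d / (N + 1))"
      have "0 < s" "s \<le> 1" using d N by (auto simp: s_def)
      then have "2 * d \<le> s * N" by (rule *)
      also have "s * N \<le> d / (N + 1) * N" unfolding s_def using N by (intro mult_right_mono) auto
      also have "\<dots> \<le> d" using d N by (simp add: field_simps)
      finally show False using d by simp
    qed
    have "q = 0"
    proof (rule ccontr)
      assume "q \<noteq> 0"
      moreover have "q \<ge> 0" unfolding q_def by (intro sum_nonneg) auto
      ultimately have q0: "q > 0" by simp
      \<comment> \<open>The direction from the closest point of the hull to x + v. Some
        \<open>y\<close> in \<open>Y\<close> lies more than \<open>\<eta>\<close> beyond
        \<open>x\<close> in this direction; by \<open>obtuse\<close> none lies beyond the closest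
        point, and \<open>v\<close> is too short to make up for that.\<close>
      define c where "c i = e i / sqrt q" for i
      have csum: "(\<Sum>i<n. (c i)\<^sup>2) = 1"
        using q0 by (simp add: c_def power_divide flip: sum_divide_distrib q_def)
      have "c i \<in> {-1..1}" for i
      proof (cases "i < n")
        case True
        then have "(c i)\<^sup>2 \<le> (\<Sum>i<n. (c i)\<^sup>2)" by (intro member_le_sum) auto
        then have "\<bar>c i\<bar> \<le> 1" by (simp add: csum abs_square_le_1)
        then show ?thesis by auto
      qed (simp add: c_def e_def)
      then have "c \<in> K" using csum by (auto simp: K_def c_def e_def)
      from far[OF this] obtain y where y: "y \<in> Y" "\<eta> < (\<Sum>i<n. c i * (y i - x i))" by blast
      have "(\<Sum>i<n. e i * (y i - x i)) = (\<Sum>i<n. e i * (y i - z i) + e i * v i - (e i)\<^sup>2)"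
        by (intro sum.cong) (auto simp: e_def power2_eq_square algebra_simps)
      also have "\<dots> = (\<Sum>i<n. e i * (y i - z i)) + (\<Sum>i<n. e i * v i) - q"
        by (simp add: q_def sum.distrib sum_subtractf)
      also have "\<dots> \<le> (\<Sum>i<n. e i * v i) - q" using obtuse[OF y(1)] by simp
      finally have 1: "(\<Sum>i<n. e i * (y i - x i)) \<le> (\<Sum>i<n. e i * v i) - q" .
      have "(\<Sum>i<n. e i * v i)\<^sup>2 \<le> q * (\<Sum>i<n. (v i)\<^sup>2)"
        unfolding q_def by (rule Cauchy_Schwarz_ineq_sum)
      also have "\<dots> \<le> q * \<eta>\<^sup>2" using v q0 by (intro mult_left_mono) auto
      also have "\<dots> = (sqrt q * \<eta>)\<^sup>2" using q0 by (simp add: power_mult_distrib)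
      finally have "(\<Sum>i<n. e i * v i) \<le> sqrt q * \<eta>"
        by (rule power2_le_imp_le) (use q0 \<eta> in auto)
      with 1 q0 have 2: "(\<Sum>i<n. e i * (y i - x i)) < sqrt q * \<eta>" by linarith
      have "(\<Sum>i<n. c i * (y i - x i)) = (\<Sum>i<n. e i * (y i - x i)) / sqrt q"
        by (simp add: c_def sum_divide_distrib)
      then have "(\<Sum>i<n. e i * (y i - x i)) = sqrt q * (\<Sum>i<n. c i * (y i - x i))" using q0 by simp
      moreover have "sqrt q * \<eta> < sqrt q * (\<Sum>i<n. c i * (y i - x i))"
        using y(2) q0 by (intro mult_strict_left_mono) auto
      ultimately show False using 2 by linarith
    qed
    have "z i = x i + v i" if "i < n" for i
    proof -
      have "(e i)\<^sup>2 = 0" using \<open>q = 0\<close> that unfolding q_def by (subst (asm) sum_nonneg_eq_0_iff) auto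
      then show ?thesis using that by (simp add: e_def)
    qed
    moreover have "\<exists>z'\<in>C. \<forall>i<n. z' i = z i"
      unfolding z_def by (rule conv) (use Y \<theta>(1) in \<open>auto simp: \<Delta>_def\<close>)
    ultimately show ?thesis by auto
  qed
  \<comment> \<open>Coordinates below \<eta> / n keep the Euclidean norm of \<open>v\<close> at most
    \<open>\<eta>\<close>, as \<open>hull\<close> requires.\<close>
  show ?thesis
  proof (intro exI[of _ "\<eta> / real n"] conjI allI impI)
    show "\<eta> / real n > 0" using \<eta> n by simp
    fix v :: "nat \<Rightarrow> real" assume v: "\<forall>i<n. \<bar>v i\<bar> < \<eta> / real n"
    have "(\<Sum>i<n. (v i)\<^sup>2) \<le> (\<Sum>i<n. (\<eta> / real n)\<^sup>2)"
    proof (rule sum_mono)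
      fix i assume "i \<in> {..<n}"
      then have "\<bar>v i\<bar> \<le> \<bar>\<eta> / real n\<bar>" using v \<eta> by (auto intro: less_imp_le)
      then show "(v i)\<^sup>2 \<le> (\<eta> / real n)\<^sup>2" by (simp only: abs_le_square_iff)
    qed
    also have "\<dots> = \<eta>\<^sup>2 / real n" using n by (simp add: power2_eq_square field_simps)
    also have "\<dots> \<le> \<eta>\<^sup>2" using n \<eta> by (simp add: field_simps)
    finally show "\<exists>z\<in>C. \<forall>i<n. z i = x i + v i" by (rule hull)
  qed
qed

lemma openin_Euclidean_box:
  "openin (Euclidean_space n) {z \<in> topspace (Euclidean_space n). \<forall>i<n. \<bar>z i - x i\<bar> < \<epsilon>}"
proof -
  have "open (\<Inter>i\<in>{..<n}. {z :: nat \<Rightarrow> real. \<bar>z i - x i\<bar> < \<epsilon>})"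
  proof (rule open_INT)
    show "\<forall>i\<in>{..<n}. open {z :: nat \<Rightarrow> real. \<bar>z i - x i\<bar> < \<epsilon>}"
      by (rule ballI, rule open_Collect_less, rule continuous_on_rabs, rule continuous_on_diff,
          rule continuous_on_coordinate, rule continuous_on_const, rule continuous_on_const)
  qed simp
  then have "openin (powertop_real UNIV) (\<Inter>i\<in>{..<n}. {z :: nat \<Rightarrow> real. \<bar>z i - x i\<bar> < \<epsilon>})"
    by (simp add: euclidean_product_topology)
  then have "openin (Euclidean_space n) ({z. \<forall>i\<ge>n. z i = 0} \<inter> (\<Inter>i\<in>{..<n}. {z :: nat \<Rightarrow> real. \<bar>z i - x i\<bar> < \<epsilon>}))"
    unfolding Euclidean_space_def by (rule openin_subtopology_Int2)
  then show ?thesis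
    by (rule back_subst[where P = "openin (Euclidean_space n)"]) (auto simp: topspace_Euclidean_space)
qed

text \<open>Without a support a whole box around \<open>x\<close> would lie in \<open>C\<close>, and
  \<open>x\<close> would be interior. The second claim stands in for membership of \<open>x\<close>
  in \<open>C\<close>: points of \<open>C\<close> come arbitrarily close.\<close>

lemma frontier_of_Euclidean_support:
  assumes n: "1 \<le> n" and x: "x \<in> Euclidean_space n frontier_of C" and C: "C \<subseteq> topspace (Euclidean_space n)"
    and conv: "\<And>Y \<theta>. finite Y \<Longrightarrow> Y \<subseteq> C \<Longrightarrow> (\<And>y. y \<in> Y \<Longrightarrow> 0 \<le> \<theta> y) \<Longrightarrow> (\<Sum>y\<in>Y. \<theta> y) = (1::real) \<Longrightarrow>
      \<exists>z\<in>C. \<forall>i<n. z i = (\<Sum>y\<in>Y. \<theta> y * y i)"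
  shows "\<exists>c. (\<exists>i<n. c i \<noteq> 0) \<and> (\<forall>y\<in>C. (\<Sum>i<n. c i * y i) \<le> (\<Sum>i<n. c i * x i))"
    and "\<epsilon> > 0 \<Longrightarrow> \<exists>y\<in>C. \<forall>i<n. \<bar>y i - x i\<bar> < \<epsilon>"
proof -
  have cl: "x \<in> Euclidean_space n closure_of C" and int: "x \<notin> Euclidean_space n interior_of C"
    using x by (auto simp: frontier_of_def)
  have top: "x \<in> topspace (Euclidean_space n)" using cl by (simp add: in_closure_of)
  have box: "x \<in> {z \<in> topspace (Euclidean_space n). \<forall>i<n. \<bar>z i - x i\<bar> < \<epsilon>}" if "\<epsilon> > 0" for \<epsilon>
    using top that by simp
  have meet: "\<exists>y\<in>C. y \<in> T" if "x \<in> T" "openin (Euclidean_space n) T" for T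
    using cl that by (auto simp: in_closure_of)
  show "\<exists>y\<in>C. \<forall>i<n. \<bar>y i - x i\<bar> < \<epsilon>" if "\<epsilon> > 0"
    using meet[OF box[OF that] openin_Euclidean_box] by auto
  show "\<exists>c. (\<exists>i<n. c i \<noteq> 0) \<and> (\<forall>y\<in>C. (\<Sum>i<n. c i * y i) \<le> (\<Sum>i<n. c i * x i))"
  proof (rule ccontr)
    assume *: "\<not> ?thesis"
    have "\<exists>\<epsilon>>0. \<forall>v. (\<forall>i<n. \<bar>v i\<bar> < \<epsilon>) \<longrightarrow> (\<exists>z\<in>C. \<forall>i<n. z i = x i + v i)"
    proof (rule interior_if_no_support[OF n conv])
      fix c :: "nat \<Rightarrow> real" assume "\<exists>i<n. c i \<noteq> 0"
      with * obtain y where "y \<in> C" "(\<Sum>i<n. c i * x i) < (\<Sum>i<n. c i * y i)" by (meson not_le)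
      then show "\<exists>y\<in>C. (\<Sum>i<n. c i * (y i - x i)) > 0"
        by (intro bexI[of _ y]) (simp_all add: right_diff_distrib sum_subtractf)
    qed
    then obtain \<epsilon> where \<epsilon>: "\<epsilon> > 0" "\<And>v. \<forall>i<n. \<bar>v i\<bar> < \<epsilon> \<Longrightarrow> \<exists>z\<in>C. \<forall>i<n. z i = x i + v i" by blast
    let ?T = "{z \<in> topspace (Euclidean_space n). \<forall>i<n. \<bar>z i - x i\<bar> < \<epsilon>}"
    have "?T \<subseteq> C"
    proof
      fix z assume z: "z \<in> ?T"
      then obtain z' where z': "z' \<in> C" "\<forall>i<n. z' i = x i + (z i - x i)"
        using \<epsilon>(2)[of "\<lambda>i. z i - x i"] by auto
      have "z' = z"
      proof
        fix i show "z' i = z i"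
          using z z' C by (cases "i < n") (auto simp: topspace_Euclidean_space)
      qed
      then show "z \<in> C" using z'(1) by simp
    qed
    then have "?T \<subseteq> Euclidean_space n interior_of C"
      using openin_Euclidean_box by (rule interior_of_maximal)
    then have "x \<in> Euclidean_space n interior_of C" using box[OF \<epsilon>(1)] by (rule subsetD)
    with int show False by simp
  qed
qed


section \<open>Switching times\<close>

text \<open>By connectedness \<open>Q\<close> has one sign on the open interval, and the two end
  points do not affect the integral. If \<open>u = v\<close>, either sign serves.\<close>

lemma has_integral_power_sgn:
  fixes Q :: "real \<Rightarrow> real"
  assumes "u \<le> v" "continuous_on {u..v} Q" "\<And>s. u < s \<Longrightarrow> s < v \<Longrightarrow> Q s \<noteq> 0"
  shows "\<exists>e. (e = 1 \<or> e = - 1) \<and>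
    (\<forall>j. ((\<lambda>s. s ^ j * sgn (Q s)) has_integral e * (v ^ Suc j - u ^ Suc j) / real (Suc j)) {u..v})"
proof -
  have "\<exists>e. (e = 1 \<or> e = - 1) \<and> (\<forall>s. u < s \<longrightarrow> s < v \<longrightarrow> sgn (Q s) = e)"
  proof (cases "\<exists>s0. u < s0 \<and> s0 < v")
    case True
    then obtain s0 where s0: "u < s0" "s0 < v" by blast
    have "sgn (Q s) = sgn (Q s0)" if s: "u < s" "s < v" for s
    proof (rule ccontr)
      assume neq: "sgn (Q s) \<noteq> sgn (Q s0)"
      have nz: "Q s \<noteq> 0" "Q s0 \<noteq> 0" using assms(3) s s0 by auto
      have conn: "connected (Q ` {u<..<v})"
        by (intro connected_continuous_image continuous_on_subset[OF assms(2)]) auto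
      have "0 \<in> Q ` {u<..<v}"
      proof (cases "Q s < 0")
        case True
        then have "0 < Q s0" using neq nz by (auto simp: sgn_if split: if_splits)
        then show ?thesis using connectedD_interval[OF conn, of "Q s" "Q s0" 0] True s s0 by auto
      next
        case False
        then have "Q s0 < 0" "0 < Q s" using neq nz by (auto simp: sgn_if split: if_splits)
        then show ?thesis using connectedD_interval[OF conn, of "Q s0" "Q s" 0] s s0 by auto
      qed
      then show False using assms(3) by auto
    qed
    moreover have "sgn (Q s0) = 1 \<or> sgn (Q s0) = - 1" using assms(3)[OF s0] by (auto simp: sgn_if)
    ultimately show ?thesis by blast
  qed auto
  then obtain e where e: "e = 1 \<or> e = - 1" "\<And>s. u < s \<Longrightarrow> s < v \<Longrightarrow> sgn (Q s) = e" by blast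
  have "((\<lambda>s. s ^ j * sgn (Q s)) has_integral e * (v ^ Suc j - u ^ Suc j) / real (Suc j)) {u..v}" for j
  proof -
    have "((\<lambda>s. e * s ^ j) has_integral (e * v ^ Suc j / real (Suc j) - e * u ^ Suc j / real (Suc j))) {u..v}"
    proof (rule fundamental_theorem_of_calculus[OF assms(1)])
      fix s
      have "((\<lambda>s. e * s ^ Suc j / real (Suc j)) has_real_derivative e * s ^ j) (at s within {u..v})"
        by (auto intro!: derivative_eq_intros simp del: power_Suc of_nat_Suc)
      then show "((\<lambda>s. e * s ^ Suc j / real (Suc j)) has_vector_derivative e * s ^ j) (at s within {u..v})"
        by (simp add: has_real_derivative_iff_has_vector_derivative)
    qed
    then have "((\<lambda>s. s ^ j * sgn (Q s)) has_integral (e * v ^ Suc j / real (Suc j) - e * u ^ Suc j / real (Suc j))) {u..v}"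
      by (rule has_integral_spike_finite[of "{u, v}", rotated 2]) (auto simp: e(2))
    then show ?thesis by (simp add: diff_divide_distrib right_diff_distrib)
  qed
  with e(1) show ?thesis by blast
qed

text \<open>Surplus switching times are placed at 0 or, if the sign does not change at a zero, at the end
  of the interval.\<close>

lemma has_integral_sgn_switches:
  fixes Q :: "real \<Rightarrow> real"
  assumes "0 \<le> t" "continuous_on {0..t} Q" "finite {s. 0 < s \<and> s < t \<and> Q s = 0}"
    "card {s. 0 < s \<and> s < t \<and> Q s = 0} \<le> N"
  shows "\<exists>e \<tau>. (e = 1 \<or> e = - 1) \<and> (\<forall>j. ((\<lambda>s. s ^ j * sgn (Q s)) has_integral
    e / real (Suc j) * ((- 1) ^ N * t ^ Suc j + 2 * (\<Sum>q=1..N. (- 1) ^ (q + 1) * \<tau> q ^ Suc j))) {0..t})"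
  using assms
proof (induction N arbitrary: t)
  case 0
  then have "{s. 0 < s \<and> s < t \<and> Q s = 0} = {}" by simp
  then have "\<exists>e. (e = 1 \<or> e = - 1) \<and>
    (\<forall>j. ((\<lambda>s. s ^ j * sgn (Q s)) has_integral e * (t ^ Suc j - 0 ^ Suc j) / real (Suc j)) {0..t})"
    using 0 by (intro has_integral_power_sgn) auto
  then show ?case by simp
next
  case (Suc N)
  let ?R = "{s. 0 < s \<and> s < t \<and> Q s = 0}"
  show ?case
  proof (cases "?R = {}")
    case True
    then have "\<exists>e. (e = 1 \<or> e = - 1) \<and>
      (\<forall>j. ((\<lambda>s. s ^ j * sgn (Q s)) has_integral e * (t ^ Suc j - 0 ^ Suc j) / real (Suc j)) {0..t})"
      using Suc.prems by (intro has_integral_power_sgn) auto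
    then obtain e where e: "e = 1 \<or> e = - 1"
      "\<And>j. ((\<lambda>s. s ^ j * sgn (Q s)) has_integral e * t ^ Suc j / real (Suc j)) {0..t}" by auto
    have sq: "(- 1 :: real) ^ Suc N * (- 1) ^ Suc N = 1"
      unfolding power_mult_distrib[symmetric] by simp
    \<comment> \<open>All switching times are 0, so only the term with the power of \<open>t\<close>
      is left, and the new sign absorbs its factor \<open>(- 1) ^ Suc N\<close>.\<close>
    show ?thesis
    proof (intro exI[of _ "e * (- 1) ^ Suc N"] exI[of _ "\<lambda>_. 0"] conjI allI)
      show "e * (- 1) ^ Suc N = 1 \<or> e * (- 1) ^ Suc N = - 1"
        using e(1) by (auto simp: minus_one_power_iff)
      fix j
      have "e * (- 1) ^ Suc N / real (Suc j) * ((- 1) ^ Suc N * t ^ Suc j) =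
          ((- 1) ^ Suc N * (- 1) ^ Suc N) * (e * t ^ Suc j / real (Suc j))" by (simp only: mult_ac times_divide_eq_left times_divide_eq_right)
      also have "\<dots> = e * t ^ Suc j / real (Suc j)" unfolding sq by simp
      finally have eq: "e * (- 1) ^ Suc N / real (Suc j) * ((- 1) ^ Suc N * t ^ Suc j) = e * t ^ Suc j / real (Suc j)" .
      have zero: "(\<Sum>q=1..Suc N. (- 1) ^ (q + 1) * (0 :: real) ^ Suc j) = 0" by (intro sum.neutral) simp
      show "((\<lambda>s. s ^ j * sgn (Q s)) has_integral e * (- 1) ^ Suc N / real (Suc j) *
         ((- 1) ^ Suc N * t ^ Suc j + 2 * (\<Sum>q=1..Suc N. (- 1) ^ (q + 1) * 0 ^ Suc j))) {0..t}"
        unfolding zero mult_zero_right add_0_right eq by (rule e(2))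
    qed
  next
    case False
    \<comment> \<open>Up to the last zero \<open>r\<close> the induction hypothesis applies with one
      zero less; after it the sign is constant.\<close>
    define r where "r = Max ?R"
    have r: "r \<in> ?R" unfolding r_def by (rule Max_in) (use Suc.prems False in auto)
    have max: "s \<le> r" if "s \<in> ?R" for s unfolding r_def using Suc.prems that by simp
    have "{s. 0 < s \<and> s < r \<and> Q s = 0} \<subseteq> ?R - {r}" using r by auto
    then have fin: "finite {s. 0 < s \<and> s < r \<and> Q s = 0}"
      and "card {s. 0 < s \<and> s < r \<and> Q s = 0} \<le> card (?R - {r})"
      using Suc.prems(3) by (auto intro: finite_subset card_mono)
    moreover have "card (?R - {r}) \<le> N" using Suc.prems(3,4) r by simp
    ultimately have "\<exists>e \<tau>. (e = 1 \<or> e = - 1) \<and> (\<forall>j. ((\<lambda>s. s ^ j * sgn (Q s)) has_integral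
      e / real (Suc j) * ((- 1) ^ N * r ^ Suc j + 2 * (\<Sum>q=1..N. (- 1) ^ (q + 1) * \<tau> q ^ Suc j))) {0..r})"
      using r by (intro Suc.IH continuous_on_subset[OF Suc.prems(2)]) auto
    then obtain e \<tau> where e: "e = 1 \<or> e = - 1" "\<And>j. ((\<lambda>s. s ^ j * sgn (Q s)) has_integral
      e / real (Suc j) * ((- 1) ^ N * r ^ Suc j + 2 * (\<Sum>q=1..N. (- 1) ^ (q + 1) * \<tau> q ^ Suc j))) {0..r}" by blast
    have "\<exists>e. (e = 1 \<or> e = - 1) \<and>
      (\<forall>j. ((\<lambda>s. s ^ j * sgn (Q s)) has_integral e * (t ^ Suc j - r ^ Suc j) / real (Suc j)) {r..t})"
    proof (rule has_integral_power_sgn)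
      show "continuous_on {r..t} Q" using r by (intro continuous_on_subset[OF Suc.prems(2)]) auto
      show "Q s \<noteq> 0" if "r < s" "s < t" for s using max[of s] r that by auto
    qed (use r in auto)
    then obtain e' where e': "e' = 1 \<or> e' = - 1"
      "\<And>j. ((\<lambda>s. s ^ j * sgn (Q s)) has_integral e' * (t ^ Suc j - r ^ Suc j) / real (Suc j)) {r..t}" by blast
    have sgnN: "(- 1 :: real) ^ N = 1 \<or> (- 1 :: real) ^ N = - 1" by (auto simp: minus_one_power_iff)
    \<comment> \<open>The formula predicts the sign \<open>e * (- 1) ^ Suc N\<close> after the last
      switching time. If this is \<open>e'\<close>, the switch is at \<open>r\<close>; otherwise a
      switch at \<open>t\<close> leaves no room for the predicted sign.\<close>
    define x where "x = (if e' = e * (- 1) ^ Suc N then r else t)"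
    define \<tau>' where "\<tau>' q = (if q = Suc N then x else \<tau> q)" for q
    have "e / real (Suc j) * ((- 1) ^ N * r ^ Suc j + 2 * (\<Sum>q=1..N. (- 1) ^ (q + 1) * \<tau> q ^ Suc j))
       + e' * (t ^ Suc j - r ^ Suc j) / real (Suc j)
       = e / real (Suc j) * ((- 1) ^ Suc N * t ^ Suc j + 2 * (\<Sum>q=1..Suc N. (- 1) ^ (q + 1) * \<tau>' q ^ Suc j))" for j
    proof -
      define S where "S = (\<Sum>q=1..N. (- 1) ^ (q + 1) * \<tau> q ^ Suc j)"
      have "(\<Sum>q=1..Suc N. (- 1) ^ (q + 1) * \<tau>' q ^ Suc j) =
          (\<Sum>q=1..N. (- 1) ^ (q + 1) * \<tau>' q ^ Suc j) + (- 1) ^ (Suc N + 1) * \<tau>' (Suc N) ^ Suc j"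
        by simp
      also have "(\<Sum>q=1..N. (- 1) ^ (q + 1) * \<tau>' q ^ Suc j) = S"
        unfolding S_def by (intro sum.cong) (auto simp: \<tau>'_def)
      finally have S': "(\<Sum>q=1..Suc N. (- 1) ^ (q + 1) * \<tau>' q ^ Suc j) = S + (- 1) ^ N * x ^ Suc j"
        by (simp add: \<tau>'_def)
      define J where "J = real (Suc j)" define a where "a = r ^ Suc j" define b where "b = t ^ Suc j"
      have "J > 0" by (simp add: J_def)
      have x: "x ^ Suc j = (if e' = - e * (- 1) ^ N then a else b)" by (simp add: x_def a_def b_def)
      show ?thesis unfolding S' S_def[symmetric] x unfolding J_def[symmetric] a_def[symmetric] b_def[symmetric]
        using e(1) e'(1) sgnN \<open>J > 0\<close> by (auto simp: field_simps)
    qed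
    then have "((\<lambda>s. s ^ j * sgn (Q s)) has_integral e / real (Suc j) *
        ((- 1) ^ Suc N * t ^ Suc j + 2 * (\<Sum>q=1..Suc N. (- 1) ^ (q + 1) * \<tau>' q ^ Suc j))) {0..t}" for j
      using has_integral_combine[OF _ _ e(2)[of j] e'(2)[of j]] r by auto
    with e(1) show ?thesis by blast
  qed
qed

section \<open>Controls\<close>

definition control :: "real \<Rightarrow> real \<Rightarrow> real \<Rightarrow> (real \<Rightarrow> real) \<Rightarrow> bool" where
  "control a b t w \<longleftrightarrow> (\<forall>s\<in>{0..t}. a \<le> w s \<and> w s \<le> b) \<and> w \<in> borel_measurable (lebesgue_on {0..t})"

lemma control_abs_le: "control a b t w \<Longrightarrow> s \<in> {0..t} \<Longrightarrow> \<bar>w s\<bar> \<le> \<bar>a\<bar> + \<bar>b\<bar>"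
  by (force simp: control_def)

lemma control_integrable:
  assumes "control a b t w" "continuous_on {0..t} g"
  shows "(\<lambda>s. g s * w s) integrable_on {0..t}"
  using assms by (intro integrable_times_continuous[of w 0 t g "\<bar>a\<bar> + \<bar>b\<bar>"] control_abs_le) (auto simp: control_def)

lemma control_convex_combination:
  assumes "finite Y" "\<And>y. y \<in> Y \<Longrightarrow> 0 \<le> \<theta> y" "(\<Sum>y\<in>Y. \<theta> y) = 1" "\<And>y. y \<in> Y \<Longrightarrow> control a b t (w y)"
  shows "control a b t (\<lambda>s. \<Sum>y\<in>Y. \<theta> y * w y s)"
proof -
  have "a \<le> (\<Sum>y\<in>Y. \<theta> y * w y s) \<and> (\<Sum>y\<in>Y. \<theta> y * w y s) \<le> b" if s: "s \<in> {0..t}" for s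
  proof
    have "(\<Sum>y\<in>Y. \<theta> y * a) \<le> (\<Sum>y\<in>Y. \<theta> y * w y s)"
      using assms(2,4) s by (intro sum_mono mult_left_mono) (auto simp: control_def)
    then show "a \<le> (\<Sum>y\<in>Y. \<theta> y * w y s)" using assms(3) by (simp flip: sum_distrib_right)
    have "(\<Sum>y\<in>Y. \<theta> y * w y s) \<le> (\<Sum>y\<in>Y. \<theta> y * b)"
      using assms(2,4) s by (intro sum_mono mult_left_mono) (auto simp: control_def)
    then show "(\<Sum>y\<in>Y. \<theta> y * w y s) \<le> b" using assms(3) by (simp flip: sum_distrib_right)
  qed
  moreover have "(\<lambda>s. \<Sum>y\<in>Y. \<theta> y * w y s) \<in> borel_measurable (lebesgue_on {0..t})"
    by (intro borel_measurable_sum borel_measurable_times borel_measurable_const) (use assms(4) in \<open>auto simp: control_def\<close>)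
  ultimately show ?thesis by (simp add: control_def)
qed

section \<open>The single-input reach set\<close>

lemma chain_A_mult:
  assumes "X \<in> carrier_vec n" "i < n"
  shows "vec_index (chain_A n *\<^sub>v X) i = (if Suc i < n then vec_index X (Suc i) else 0)"
proof -
  have "vec_index (chain_A n *\<^sub>v X) i = (\<Sum>j = 0..<n. (if j = Suc i then 1 else 0) * vec_index X j)"
    using assms by (simp add: chain_A_def scalar_prod_def)
  also have "\<dots> = (\<Sum>j = 0..<n. if j = Suc i then vec_index X j else 0)"
    by (intro sum.cong) auto
  finally show ?thesis by simp
qed

lemma chain_b_mult:
  assumes "u \<in> carrier_vec 1" "i < n"
  shows "vec_index (chain_b n *\<^sub>v u) i = (if Suc i < n then 0 else vec_index u 0)"
  using assms by (auto simp: chain_b_def scalar_prod_def)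

text \<open>The matrix form is unfolded into a chain of scalar integral equations whose last link is
  the input. Both the solution formula and the decomposition into blocks start from this
  form.\<close>

lemma single_input_reach_set_iff_trajectory:
  assumes t: "0 \<le> t"
  shows "x \<in> single_input_reach_set n a b y0 t \<longleftrightarrow> x \<in> carrier_vec n \<and> (\<exists>\<xi> w. control a b t w \<and>
     (\<forall>i<n. \<forall>T\<in>{0..t}. ((\<lambda>s. if Suc i < n then \<xi> (Suc i) s else w s) has_integral (\<xi> i T - vec_index y0 i)) {0..T}) \<and>
     (\<forall>i<n. \<xi> i t = vec_index x i))" (is "?L \<longleftrightarrow> ?R")
proof
  assume ?L
  then obtain X u where x: "x = X t" and X: "\<forall>s\<in>{0..t}. X s \<in> carrier_vec n"
    and u: "\<forall>s\<in>{0..t}. u s \<in> input_box 1 (\<lambda>_. a) (\<lambda>_. b)"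
    and meas: "(\<lambda>s. vec_index (u s) 0) \<in> borel_measurable (lebesgue_on {0..t})"
    and ode: "\<forall>i<n. \<forall>T\<in>{0..t}. ((\<lambda>s. vec_index (chain_A n *\<^sub>v X s + chain_b n *\<^sub>v u s) i)
          has_integral (vec_index (X T) i - vec_index y0 i)) {0..T}"
    unfolding single_input_reach_set_def reach_set_def by (auto simp: chain_A_def chain_b_def)
  have "((\<lambda>s. if Suc i < n then vec_index (X s) (Suc i) else vec_index (u s) 0) has_integral
      (vec_index (X T) i - vec_index y0 i)) {0..T}" if i: "i < n" and T: "T \<in> {0..t}" for i T
  proof (rule has_integral_eq[OF _ ode[rule_format, OF i T]])
    fix s assume "s \<in> {0..T}"
    then have "X s \<in> carrier_vec n" "u s \<in> carrier_vec 1" using X u T by (auto simp: input_box_def)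
    then show "vec_index (chain_A n *\<^sub>v X s + chain_b n *\<^sub>v u s) i =
        (if Suc i < n then vec_index (X s) (Suc i) else vec_index (u s) 0)"
      using i chain_A_mult[of "X s" n i] chain_b_mult[of "u s" i n] by (simp add: chain_b_def)
  qed
  moreover have "control a b t (\<lambda>s. vec_index (u s) 0)"
    using u meas by (auto simp: control_def input_box_def)
  ultimately show ?R
    using x X t by (intro conjI exI[of _ "\<lambda>i s. vec_index (X s) i"] exI[of _ "\<lambda>s. vec_index (u s) 0"]) auto
next
  assume ?R
  then obtain \<xi> w where x: "x \<in> carrier_vec n" and w: "control a b t w"
    and ode: "\<And>i T. i < n \<Longrightarrow> T \<in> {0..t} \<Longrightarrow>
      ((\<lambda>s. if Suc i < n then \<xi> (Suc i) s else w s) has_integral (\<xi> i T - vec_index y0 i)) {0..T}"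
    and fin: "\<And>i. i < n \<Longrightarrow> \<xi> i t = vec_index x i" by blast
  define X where "X s = vec n (\<lambda>i. \<xi> i s)" for s
  define u where "u s = vec 1 (\<lambda>_. w s)" for s
  have "((\<lambda>s. vec_index (chain_A n *\<^sub>v X s + chain_b n *\<^sub>v u s) i) has_integral
      (vec_index (X T) i - vec_index y0 i)) {0..T}" if i: "i < n" and T: "T \<in> {0..t}" for i T
  proof -
    have "((\<lambda>s. vec_index (chain_A n *\<^sub>v X s + chain_b n *\<^sub>v u s) i) has_integral (\<xi> i T - vec_index y0 i)) {0..T}"
    proof (rule has_integral_eq[OF _ ode[OF i T]])
      fix s
      have "X s \<in> carrier_vec n" "u s \<in> carrier_vec 1" by (auto simp: X_def u_def)
      then show "(if Suc i < n then \<xi> (Suc i) s else w s) = vec_index (chain_A n *\<^sub>v X s + chain_b n *\<^sub>v u s) i"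
        using i chain_A_mult[of "X s" n i] chain_b_mult[of "u s" i n] by (simp add: chain_b_def X_def u_def)
    qed
    then show ?thesis using i by (simp add: X_def)
  qed
  moreover have "X t = x" using x fin by (intro eq_vecI) (auto simp: X_def)
  ultimately show ?L
    unfolding single_input_reach_set_def reach_set_def mem_Collect_eq using w
    by (intro exI[of _ X] exI[of _ u]) (auto simp: X_def u_def control_def chain_A_def chain_b_def input_box_def)
qed

lemma free_motion_Suc:
  assumes "i < n"
  shows "free_motion n t y0 (Suc i) = (\<Sum>k\<le>n - Suc i. t ^ k / fact k * vec_index y0 (i + k))"
proof -
  have "free_motion n t y0 (Suc i) = (\<Sum>l\<in>{Suc i..n}. t ^ (l - Suc i) / fact (l - Suc i) * vec_index y0 (l - 1))"
    unfolding free_motion_def by (rule sum.mono_neutral_cong_right) auto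
  also have "\<dots> = (\<Sum>k\<le>n - Suc i. t ^ k / fact k * vec_index y0 (i + k))"
    by (rule sum.reindex_bij_witness[of _ "\<lambda>k. k + Suc i" "\<lambda>l. l - Suc i"]) (use assms in \<open>auto simp: add.commute\<close>)
  finally show ?thesis .
qed

lemma trajectory_formula:
  assumes t: "0 \<le> t" and w: "control a b t w" and i: "i < n"
    and ode: "\<And>i T. i < n \<Longrightarrow> T \<in> {0..t} \<Longrightarrow>
      ((\<lambda>s. if Suc i < n then \<xi> (Suc i) s else w s) has_integral (\<xi> i T - vec_index y0 i)) {0..T}"
  shows "\<xi> i t = free_motion n t y0 (Suc i) + integral {0..t} (\<lambda>s. (t - s) ^ (n - Suc i) / fact (n - Suc i) * w s)"
proof -
  \<comment> \<open>The components i, ..., n - 1 followed by the input form a chain of length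
    \<open>n - i\<close>.\<close>
  define \<eta> where "\<eta> k = (if i + k < n then \<xi> (i + k) else w)" for k
  have last: "\<eta> (n - i) = w" using i by (simp add: \<eta>_def)
  have int: "((\<lambda>s. (t - s) ^ (n - Suc i) / fact (n - Suc i) * \<eta> (Suc (n - Suc i)) s) has_integral
    (\<eta> 0 t - (\<Sum>k\<le>n - Suc i. t ^ k / fact k * vec_index y0 (i + k)))) {0..t}"
  proof (rule integrator_chain[OF t, where n = "n - i"])
    show "\<eta> (n - i) \<in> borel_measurable (lebesgue_on {0..t})" using w by (simp add: last control_def)
    show "\<bar>\<eta> (n - i) s\<bar> \<le> \<bar>a\<bar> + \<bar>b\<bar>" if "s \<in> {0..t}" for s
      unfolding last by (rule control_abs_le[OF w that])
    show "(\<eta> (Suc k) has_integral (\<eta> k T - vec_index y0 (i + k))) {0..T}" if "k < n - i" "T \<in> {0..t}" for k T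
      using ode[of "i + k" T] that by (cases "Suc (i + k) < n") (auto simp: \<eta>_def)
  qed (use i in auto)
  have Suc: "Suc (n - Suc i) = n - i" using i by simp
  from integral_unique[OF int[unfolded Suc last]] show ?thesis
    using i by (simp add: \<eta>_def free_motion_Suc)
qed

text \<open>Variation of constants. The trajectory disappears and the state depends affinely on the
  control, which yields convexity and turns linear functionals of the state into integrals.\<close>

lemma single_input_reach_set_iff:
  assumes t: "0 \<le> t"
  shows "x \<in> single_input_reach_set n a b y0 t \<longleftrightarrow> x \<in> carrier_vec n \<and> (\<exists>w. control a b t w \<and>
    (\<forall>i<n. vec_index x i = free_motion n t y0 (Suc i) +
      integral {0..t} (\<lambda>s. (t - s) ^ (n - Suc i) / fact (n - Suc i) * w s)))" (is "_ \<longleftrightarrow> ?R")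
  unfolding single_input_reach_set_iff_trajectory[OF t]
proof (intro iffI)
  assume "x \<in> carrier_vec n \<and> (\<exists>\<xi> w. control a b t w \<and>
     (\<forall>i<n. \<forall>T\<in>{0..t}. ((\<lambda>s. if Suc i < n then \<xi> (Suc i) s else w s) has_integral (\<xi> i T - vec_index y0 i)) {0..T}) \<and>
     (\<forall>i<n. \<xi> i t = vec_index x i))"
  then obtain \<xi> w where x: "x \<in> carrier_vec n" and w: "control a b t w"
    and ode: "\<And>i T. i < n \<Longrightarrow> T \<in> {0..t} \<Longrightarrow>
      ((\<lambda>s. if Suc i < n then \<xi> (Suc i) s else w s) has_integral (\<xi> i T - vec_index y0 i)) {0..T}"
    and fin: "\<And>i. i < n \<Longrightarrow> \<xi> i t = vec_index x i" by blast
  show ?R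
    using trajectory_formula[OF t w _ ode] fin x w by (intro conjI exI[of _ w]) auto
next
  assume ?R
  then obtain w where x: "x \<in> carrier_vec n" and w: "control a b t w"
    and eq: "\<And>i. i < n \<Longrightarrow> vec_index x i = free_motion n t y0 (Suc i) +
      integral {0..t} (\<lambda>s. (t - s) ^ (n - Suc i) / fact (n - Suc i) * w s)" by blast
  have "w integrable_on {0..t}" using control_integrable[OF w, of "\<lambda>_. 1"] by simp
  then obtain \<eta> where \<eta>: "\<eta> n = w"
    "\<And>k T. k < n \<Longrightarrow> T \<in> {0..t} \<Longrightarrow> (\<eta> (Suc k) has_integral (\<eta> k T - vec_index y0 k)) {0..T}"
    using integrator_chain_exists[of w t n "vec_index y0"] t by blast
  have ode: "((\<lambda>s. if Suc i < n then \<eta> (Suc i) s else w s) has_integral (\<eta> i T - vec_index y0 i)) {0..T}"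
    if "i < n" "T \<in> {0..t}" for i T
  proof (cases "Suc i < n")
    case False
    then have "Suc i = n" using that by simp
    then show ?thesis using \<eta>(2)[OF that] \<eta>(1) by simp
  qed (use \<eta>(2)[OF that] in simp)
  show "x \<in> carrier_vec n \<and> (\<exists>\<xi> w. control a b t w \<and>
     (\<forall>i<n. \<forall>T\<in>{0..t}. ((\<lambda>s. if Suc i < n then \<xi> (Suc i) s else w s) has_integral (\<xi> i T - vec_index y0 i)) {0..T}) \<and>
     (\<forall>i<n. \<xi> i t = vec_index x i))"
    using x w t ode eq trajectory_formula[OF t w _ ode] by (intro conjI exI[of _ \<eta>] exI[of _ w]) auto
qed


section \<open>The boundary of the single-input reach set\<close>

lemma has_integral_reverse:
  fixes f :: "real \<Rightarrow> real"
  assumes "(f has_integral I) {0..t}" "0 \<le> t"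
  shows "((\<lambda>s. f (t - s)) has_integral I) {0..t}"
proof -
  have "((\<lambda>x. f ((- 1) *\<^sub>R x + t)) has_integral ((1 / \<bar>- 1\<bar> ^ DIM(real)) *\<^sub>R I))
      ((\<lambda>x. (1 / (- 1)) *\<^sub>R x + - ((1 / (- 1)) *\<^sub>R t)) ` cbox 0 t)"
    using assms by (intro has_integral_affinity) (auto simp: cbox_interval)
  moreover have "(\<lambda>x. (1 / (- 1)) *\<^sub>R x + - ((1 / (- 1)) *\<^sub>R t)) ` cbox 0 t = {0..t}"
  proof -
    have "(\<lambda>x. t - x) ` {0..t} = {0..t}"
      by (auto intro!: image_eqI[where x = "t - _"])
    then show ?thesis by (simp add: cbox_interval)
  qed
  ultimately show ?thesis by simp
qed

text \<open>The bang-bang control switching with the sign of \<open>Q\<close> dominates every other control, with a gap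
  that controls the \<open>L\<^sup>1\<close> distance up to a term that vanishes as \<open>k\<close> grows.\<close>

lemma bang_bang_gap:
  assumes t: "0 \<le> t" and Q: "continuous_on {0..t} Q" and w: "control a b t w" and ab: "a \<le> b"
    and v: "control a b t v" "\<And>s. s \<in> {0..t} \<Longrightarrow> Q s > 0 \<Longrightarrow> v s = b" "\<And>s. s \<in> {0..t} \<Longrightarrow> Q s < 0 \<Longrightarrow> v s = a"
    and g: "continuous_on {0..t} g" "\<And>s. s \<in> {0..t} \<Longrightarrow> \<bar>g s\<bar> \<le> B" and k: "0 \<le> k"
  shows "\<bar>integral {0..t} (\<lambda>s. g s * v s) - integral {0..t} (\<lambda>s. g s * w s)\<bar> \<le>
    B * (k * (integral {0..t} (\<lambda>s. Q s * v s) - integral {0..t} (\<lambda>s. Q s * w s)) +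
      (b - a) * integral {0..t} (\<lambda>s. max 0 (1 - k * \<bar>Q s\<bar>)))"
proof -
  have B: "0 \<le> B" using g(2)[of 0] t by auto
  let ?h = "\<lambda>s. B * (k * (Q s * v s - Q s * w s) + (b - a) * max 0 (1 - k * \<bar>Q s\<bar>))"
  have int: "(\<lambda>s. g s * v s - g s * w s) integrable_on {0..t}" "(\<lambda>s. Q s * v s - Q s * w s) integrable_on {0..t}"
    by (intro integrable_diff control_integrable[OF v(1)] control_integrable[OF w] Q g(1))+
  have int_max: "(\<lambda>s. max 0 (1 - k * \<bar>Q s\<bar>)) integrable_on {0..t}"
    by (intro integrable_continuous_real continuous_intros Q)
  have "norm (integral {0..t} (\<lambda>s. g s * v s - g s * w s)) \<le> integral {0..t} ?h"
  proof (rule integral_norm_bound_integral[OF int(1)])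
    show "?h integrable_on {0..t}"
      using integrable_on_cmult_left[OF integrable_add[OF integrable_on_cmult_left[OF int(2), of k]
          integrable_on_cmult_left[OF int_max, of "b - a"]], of B] by simp
    fix s assume s: "s \<in> {0..t}"
    have bounds: "a \<le> w s" "w s \<le> b" "a \<le> v s" "v s \<le> b" using s w v(1) by (auto simp: control_def)
    have gap: "Q s * v s - Q s * w s = \<bar>Q s\<bar> * \<bar>v s - w s\<bar>"
    proof -
      consider "Q s > 0" | "Q s < 0" | "Q s = 0" by linarith
      then show ?thesis
      proof cases
        case 1
        then show ?thesis using v(2)[OF s] bounds by (simp add: algebra_simps)
      next
        case 2
        then show ?thesis using v(3)[OF s] bounds by (simp add: algebra_simps)
      qed simp
    qed
    \<comment> \<open>Where \<open>k * \<bar>Q s\<bar>\<close> exceeds 1 the left side is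
      nonpositive; elsewhere \<open>\<bar>v s - w s\<bar>\<close> is at most
      \<open>b - a\<close>.\<close>
    have "\<bar>v s - w s\<bar> * (1 - k * \<bar>Q s\<bar>) \<le> (b - a) * max 0 (1 - k * \<bar>Q s\<bar>)"
    proof (cases "k * \<bar>Q s\<bar> \<le> 1")
      case True
      then show ?thesis using bounds by (auto simp: max_def intro!: mult_right_mono)
    next
      case False
      then have "\<bar>v s - w s\<bar> * (1 - k * \<bar>Q s\<bar>) \<le> 0" by (intro mult_nonneg_nonpos) auto
      then show ?thesis using False by simp
    qed
    then have "\<bar>v s - w s\<bar> \<le> k * (\<bar>Q s\<bar> * \<bar>v s - w s\<bar>) + (b - a) * max 0 (1 - k * \<bar>Q s\<bar>)"
      by (simp add: algebra_simps)
    then have "\<bar>g s\<bar> * \<bar>v s - w s\<bar> \<le> B * (k * (\<bar>Q s\<bar> * \<bar>v s - w s\<bar>) + (b - a) * max 0 (1 - k * \<bar>Q s\<bar>))"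
      using g(2)[OF s] B by (intro mult_mono) auto
    then show "norm (g s * v s - g s * w s) \<le> ?h s"
      unfolding gap by (simp add: abs_mult flip: right_diff_distrib)
  qed
  also have "integral {0..t} ?h = B * (k * (integral {0..t} (\<lambda>s. Q s * v s - Q s * w s)) +
      (b - a) * integral {0..t} (\<lambda>s. max 0 (1 - k * \<bar>Q s\<bar>)))"
    by (simp add: integral_add[OF integrable_on_cmult_left[OF int(2), of k]
          integrable_on_cmult_left[OF int_max, of "b - a"], simplified])
  finally show ?thesis
    by (simp add: integral_diff control_integrable[OF v(1)] control_integrable[OF w] Q g(1))
qed

text \<open>The integrands tend pointwise to the indicator of the zero set of \<open>Q\<close>,
  which is finite; domination by 1 allows the limit under the integral.\<close>

lemma integral_small_values_tendsto_0:
  fixes Q :: "real \<Rightarrow> real"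
  assumes "continuous_on {0..t} Q" "finite {s \<in> {0..t}. Q s = 0}"
  shows "(\<lambda>k. integral {0..t} (\<lambda>s. max 0 (1 - real k * \<bar>Q s\<bar>))) \<longlonglongrightarrow> 0"
proof -
  define g where "g s = (if Q s = 0 then 1 else 0 :: real)" for s
  have "(\<lambda>k. integral {0..t} (\<lambda>s. max 0 (1 - real k * \<bar>Q s\<bar>))) \<longlonglongrightarrow> integral {0..t} g"
  proof (rule dominated_convergence(2)[where h = "\<lambda>_. 1"])
    show "(\<lambda>s. max 0 (1 - real k * \<bar>Q s\<bar>)) integrable_on {0..t}" for k
      by (intro integrable_continuous_real continuous_intros assms(1))
    show "norm (max 0 (1 - real k * \<bar>Q s\<bar>)) \<le> 1" for k s by simp
    show "(\<lambda>k. max 0 (1 - real k * \<bar>Q s\<bar>)) \<longlonglongrightarrow> g s" for s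
    proof (cases "Q s = 0")
      case False
      obtain K :: nat where K: "1 / \<bar>Q s\<bar> < real K" using reals_Archimedean2 by blast
      have "\<forall>\<^sub>F k in sequentially. max 0 (1 - real k * \<bar>Q s\<bar>) = 0"
      proof (rule eventually_sequentiallyI[of K])
        fix k assume "K \<le> k"
        then have "1 / \<bar>Q s\<bar> < real k" using K by simp
        then show "max 0 (1 - real k * \<bar>Q s\<bar>) = 0" using False by (simp add: field_simps)
      qed
      then show ?thesis using False by (simp add: g_def tendsto_eventually)
    qed (simp add: g_def)
  qed auto
  moreover have "(g has_integral 0) {0..t}"
    by (rule has_integral_spike_finite[OF assms(2) _ has_integral_0]) (auto simp: g_def)
  ultimately show ?thesis by (simp add: integral_unique)
qed

lemma continuous_on_kernel: "continuous_on S (\<lambda>s :: real. (t - s) ^ p / fact p)"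
  by (intro continuous_intros) auto

lemma vec_boundary_switching:
  assumes n: "1 \<le> n" and ab: "a < b" and t: "0 \<le> t"
    and x: "x \<in> vec_boundary n (single_input_reach_set n a b y0 t)"
  shows "\<exists>e \<tau>. (e = 1 \<or> e = - 1) \<and> (\<forall>i<n. vec_index x i = free_motion n t y0 (Suc i) +
    midpoint a b * t ^ (n - i) / fact (n - i) + e * (half_width a b / fact (n - i)) *
    ((- 1) ^ (n - 1) * t ^ (n - i) + 2 * (\<Sum>q=1..n - 1. (- 1) ^ (q + 1) * \<tau> q ^ (n - i))))"
proof -
  define R where "R = single_input_reach_set n a b y0 t"
  define K where "K i s = (t - s) ^ (n - Suc i) / fact (n - Suc i)" for i and s :: real
  define \<Phi> where "\<Phi> w i = free_motion n t y0 (Suc i) + integral {0..t} (\<lambda>s. K i s * w s)" for w i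
  have contK: "continuous_on {0..t} (K i)" for i unfolding K_def by (rule continuous_on_kernel)
  have reach: "\<exists>y\<in>coords ` R. \<forall>i<n. y i = \<Phi> w i" if "control a b t w" for w
  proof (rule bexI[of _ "coords (vec n (\<Phi> w))"])
    have "vec n (\<Phi> w) \<in> R" unfolding R_def single_input_reach_set_iff[OF t]
      using that by (intro conjI exI[of _ w]) (auto simp: \<Phi>_def K_def)
    then show "coords (vec n (\<Phi> w)) \<in> coords ` R" by (rule imageI)
  qed (simp add: coords_def)
  have control: "\<exists>w. control a b t w \<and> (\<forall>i<n. y i = \<Phi> w i)" if y: "y \<in> coords ` R" for y
  proof -
    obtain x where x: "x \<in> R" "y = coords x" using y by blast
    then obtain w where "x \<in> carrier_vec n" "control a b t w" "\<forall>i<n. vec_index x i = \<Phi> w i"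
      unfolding R_def single_input_reach_set_iff[OF t] \<Phi>_def K_def by blast
    then show ?thesis using x(2) by (intro exI[of _ w]) (auto simp: coords_def)
  qed
  have top: "coords ` R \<subseteq> topspace (Euclidean_space n)"
    by (auto simp: R_def single_input_reach_set_iff[OF t] coords_def topspace_Euclidean_space)
  have conv: "\<exists>z\<in>coords ` R. \<forall>i<n. z i = (\<Sum>y\<in>Y. \<theta> y * y i)"
    if Y: "finite Y" "Y \<subseteq> coords ` R" "\<And>y. y \<in> Y \<Longrightarrow> 0 \<le> \<theta> y" "(\<Sum>y\<in>Y. \<theta> y) = (1::real)" for Y \<theta>
  proof -
    have "\<exists>W. \<forall>y\<in>Y. control a b t (W y) \<and> (\<forall>i<n. y i = \<Phi> (W y) i)"
      using control Y(2) by (intro bchoice) blast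
    then obtain W where W: "\<And>y. y \<in> Y \<Longrightarrow> control a b t (W y)" "\<And>y i. y \<in> Y \<Longrightarrow> i < n \<Longrightarrow> y i = \<Phi> (W y) i" by blast
    define w where "w s = (\<Sum>y\<in>Y. \<theta> y * W y s)" for s
    have "control a b t w" unfolding w_def by (rule control_convex_combination) (use Y W in auto)
    then obtain z where z: "z \<in> coords ` R" "\<forall>i<n. z i = \<Phi> w i" using reach by blast
    have "\<Phi> w i = (\<Sum>y\<in>Y. \<theta> y * y i)" if i: "i < n" for i
    proof -
      have "integral {0..t} (\<lambda>s. K i s * w s) = integral {0..t} (\<lambda>s. \<Sum>y\<in>Y. \<theta> y * (K i s * W y s))"
        by (simp add: w_def sum_distrib_left mult_ac)
      also have "\<dots> = (\<Sum>y\<in>Y. integral {0..t} (\<lambda>s. \<theta> y * (K i s * W y s)))"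
      proof (rule Henstock_Kurzweil_Integration.integral_sum[OF Y(1)])
        fix y assume "y \<in> Y"
        from integrable_on_cmult_left[OF control_integrable[OF W(1)[OF this] contK], of "\<theta> y" i]
        show "(\<lambda>s. \<theta> y * (K i s * W y s)) integrable_on {0..t}" by simp
      qed
      also have "\<dots> = (\<Sum>y\<in>Y. \<theta> y * integral {0..t} (\<lambda>s. K i s * W y s))" by simp
      finally have 1: "integral {0..t} (\<lambda>s. K i s * w s) = (\<Sum>y\<in>Y. \<theta> y * integral {0..t} (\<lambda>s. K i s * W y s))" .
      have "(\<Sum>y\<in>Y. \<theta> y * y i) = (\<Sum>y\<in>Y. \<theta> y * free_motion n t y0 (Suc i) + \<theta> y * integral {0..t} (\<lambda>s. K i s * W y s))"
      proof (intro sum.cong refl)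
        fix y assume "y \<in> Y"
        from W(2)[OF this i] show "\<theta> y * y i = \<theta> y * free_motion n t y0 (Suc i) + \<theta> y * integral {0..t} (\<lambda>s. K i s * W y s)"
          by (simp only: \<Phi>_def distrib_left)
      qed
      also have "\<dots> = (\<Sum>y\<in>Y. \<theta> y) * free_motion n t y0 (Suc i) + (\<Sum>y\<in>Y. \<theta> y * integral {0..t} (\<lambda>s. K i s * W y s))"
        by (simp add: sum.distrib sum_distrib_right)
      finally show ?thesis using Y(4) 1 by (simp add: \<Phi>_def)
    qed
    with z show ?thesis by auto
  qed
  have x_carrier: "x \<in> carrier_vec n" and fr: "coords x \<in> Euclidean_space n frontier_of (coords ` R)"
    using x by (auto simp: vec_boundary_def R_def)
  have cx: "coords x i = vec_index x i" if "i < n" for i using that x_carrier by (simp add: coords_def)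
  obtain c where c: "\<exists>i<n. c i \<noteq> 0" "\<forall>y\<in>coords ` R. (\<Sum>i<n. c i * y i) \<le> (\<Sum>i<n. c i * coords x i)"
    using frontier_of_Euclidean_support(1)[OF n fr top conv] by blast
  have near: "\<exists>y\<in>coords ` R. \<forall>i<n. \<bar>y i - coords x i\<bar> < \<epsilon>" if "\<epsilon> > 0" for \<epsilon>
    using frontier_of_Euclidean_support(2)[OF n fr top conv that] by blast
  \<comment> \<open>The kernels are powers of t - s, so in reversed time the functional is
    integration against the polynomial \<open>P\<close>.\<close>
  define P where "P = (\<Sum>i<n. monom (c i / fact (n - Suc i)) (n - Suc i))"
  define Q where "Q s = poly P (t - s)" for s
  have Q_sum: "Q s = (\<Sum>i<n. c i * K i s)" for s
    by (simp add: Q_def P_def poly_sum poly_monom K_def)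
  have contP: "continuous_on S (poly P)" for S by (intro continuous_intros)
  have contQ: "continuous_on {0..t} Q" unfolding Q_def by (intro continuous_intros)
  obtain j where j: "j < n" "c j \<noteq> 0" using c(1) by blast
  \<comment> \<open>The exponents \<open>n - Suc i\<close> are distinct, so no coefficients
    cancel.\<close>
  have "coeff P (n - Suc j) = (\<Sum>i<n. if i = j then c j / fact (n - Suc j) else 0)"
    unfolding P_def coeff_sum by (intro sum.cong) (use j in auto)
  then have "coeff P (n - Suc j) \<noteq> 0" using j by simp
  then have P0: "P \<noteq> 0" by auto
  have degP: "degree P \<le> n - 1" unfolding P_def
    by (intro degree_sum_le) (auto intro!: order_trans[OF degree_monom_le])
  have roots: "finite {s. poly P s = 0}" "card {s. poly P s = 0} \<le> n - 1"
    using poly_roots_finite[OF P0] card_poly_roots_bound[OF P0] degP by auto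
  have "{s \<in> {0..t}. Q s = 0} \<subseteq> (\<lambda>s. t - s) ` {s. poly P s = 0}"
    by (auto simp: Q_def intro!: image_eqI[where x = "t - _"])
  then have finQ: "finite {s \<in> {0..t}. Q s = 0}" using roots(1) finite_subset by blast
  have lin: "(\<Sum>i<n. c i * \<Phi> w i) = (\<Sum>i<n. c i * free_motion n t y0 (Suc i)) + integral {0..t} (\<lambda>s. Q s * w s)"
    if w: "control a b t w" for w
  proof -
    have "integral {0..t} (\<lambda>s. Q s * w s) = integral {0..t} (\<lambda>s. \<Sum>i<n. c i * (K i s * w s))"
      by (simp add: Q_sum sum_distrib_right mult.assoc)
    also have "\<dots> = (\<Sum>i<n. integral {0..t} (\<lambda>s. c i * (K i s * w s)))"
    proof (rule Henstock_Kurzweil_Integration.integral_sum)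
      fix i
      from integrable_on_cmult_left[OF control_integrable[OF w contK], of "c i" i]
      show "(\<lambda>s. c i * (K i s * w s)) integrable_on {0..t}" by simp
    qed simp
    finally show ?thesis by (simp add: \<Phi>_def distrib_left sum.distrib)
  qed
  \<comment> \<open>At zeros of \<open>Q\<close> this takes the midpoint, which is an admissible
    value.\<close>
  define v where "v s = midpoint a b + half_width a b * sgn (Q s)" for s
  have v_vals: "v s = (if Q s > 0 then b else if Q s < 0 then a else midpoint a b)" for s
    by (auto simp: v_def midpoint_def half_width_def field_simps)
  have v: "control a b t v"
    unfolding control_def
  proof
    show "\<forall>s\<in>{0..t}. a \<le> v s \<and> v s \<le> b" using ab by (auto simp: v_vals midpoint_def)
    have "Q \<in> borel_measurable (lebesgue_on {0..t})"
      by (rule continuous_imp_measurable_on_sets_lebesgue[OF contQ]) simp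
    then have "(\<lambda>s. sgn (Q s)) \<in> borel_measurable (lebesgue_on {0..t})"
      by (rule measurable_compose[OF _ borel_measurable_sgn])
    then show "v \<in> borel_measurable (lebesgue_on {0..t})"
      unfolding v_def by (intro borel_measurable_add borel_measurable_times borel_measurable_const)
  qed
  have x_eq: "vec_index x i = \<Phi> v i" if i: "i < n" for i
  proof -
    define B where "B = t ^ (n - Suc i) / fact (n - Suc i)"
    define I where "I k = integral {0..t} (\<lambda>s. max 0 (1 - real k * \<bar>Q s\<bar>))" for k
    have B: "\<bar>K i s\<bar> \<le> B" if "s \<in> {0..t}" for s
      using that unfolding K_def B_def by (auto simp: abs_divide power_abs intro!: divide_right_mono power_mono)
    have B0: "0 \<le> B" using t by (simp add: B_def)
    \<comment> \<open>Two limits in turn: for fixed \<open>k\<close> the nearby point tends to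
      \<open>x\<close>, which leaves this bound; then \<open>k\<close> tends to infinity.\<close>
    have "\<bar>\<Phi> v i - coords x i\<bar> \<le> B * ((b - a) * I k)" for k
    proof (rule field_le_epsilon)
      fix \<epsilon> :: real assume "\<epsilon> > 0"
      \<comment> \<open>Chosen so that a nearby point within \<epsilon> / C costs (C - 1) *
        \<epsilon> / C through the gap and \<epsilon> / C through its own distance, in total
        \<epsilon>.\<close>
      define C where "C = 1 + B * (real k * (\<Sum>i<n. \<bar>c i\<bar>))"
      have C: "C > 0" unfolding C_def using B0 by (intro add_pos_nonneg mult_nonneg_nonneg sum_nonneg) auto
      obtain y where y: "y \<in> coords ` R" "\<forall>i<n. \<bar>y i - coords x i\<bar> < \<epsilon> / C"
        using near[of "\<epsilon> / C"] \<open>\<epsilon> > 0\<close> C by auto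
      obtain w where w: "control a b t w" "\<And>i. i < n \<Longrightarrow> y i = \<Phi> w i" using control[OF y(1)] by blast
      obtain y' where y': "y' \<in> coords ` R" "\<forall>i<n. y' i = \<Phi> v i" using reach[OF v] by blast
      have "integral {0..t} (\<lambda>s. Q s * v s) - integral {0..t} (\<lambda>s. Q s * w s) =
          (\<Sum>i<n. c i * \<Phi> v i) - (\<Sum>i<n. c i * \<Phi> w i)"
        by (simp add: lin[OF v] lin[OF w(1)])
      also have "(\<Sum>i<n. c i * \<Phi> v i) = (\<Sum>i<n. c i * y' i)" using y'(2) by (intro sum.cong) auto
      also have "(\<Sum>i<n. c i * \<Phi> w i) = (\<Sum>i<n. c i * y i)" using w(2) by (intro sum.cong) auto
      \<comment> \<open>The point reached by \<open>v\<close> lies in the reach set, so the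
        functional is there at most its value at \<open>x\<close>.\<close>
      also have "(\<Sum>i<n. c i * y' i) - (\<Sum>i<n. c i * y i) \<le> (\<Sum>i<n. c i * coords x i) - (\<Sum>i<n. c i * y i)"
        using c(2) y'(1) by (intro diff_right_mono) auto
      also have "\<dots> = (\<Sum>i<n. c i * (coords x i - y i))" by (simp add: right_diff_distrib sum_subtractf)
      also have "\<dots> \<le> (\<Sum>i<n. \<bar>c i\<bar> * (\<epsilon> / C))"
      proof (rule sum_mono)
        fix i assume "i \<in> {..<n}"
        then have "\<bar>coords x i - y i\<bar> \<le> \<epsilon> / C" using y(2) by (auto simp: abs_minus_commute intro: less_imp_le)
        then have "\<bar>c i\<bar> * \<bar>coords x i - y i\<bar> \<le> \<bar>c i\<bar> * (\<epsilon> / C)" by (rule mult_left_mono) simp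
        then show "c i * (coords x i - y i) \<le> \<bar>c i\<bar> * (\<epsilon> / C)"
          by (metis abs_ge_self abs_mult order_trans)
      qed
      also have "\<dots> = (\<Sum>i<n. \<bar>c i\<bar>) * (\<epsilon> / C)" by (simp only: sum_distrib_right)
      finally have gap: "integral {0..t} (\<lambda>s. Q s * v s) - integral {0..t} (\<lambda>s. Q s * w s) \<le> (\<Sum>i<n. \<bar>c i\<bar>) * (\<epsilon> / C)" .
      have "\<bar>\<Phi> v i - \<Phi> w i\<bar> \<le> B * (real k * (integral {0..t} (\<lambda>s. Q s * v s) - integral {0..t} (\<lambda>s. Q s * w s)) + (b - a) * I k)"
        unfolding \<Phi>_def I_def add_diff_add diff_self add_0
        by (rule bang_bang_gap[OF t contQ w(1) _ v _ _ contK B]) (use ab in \<open>auto simp: v_vals\<close>)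
      also have "\<dots> \<le> B * (real k * ((\<Sum>i<n. \<bar>c i\<bar>) * (\<epsilon> / C)) + (b - a) * I k)"
        using gap B0 by (intro mult_left_mono add_right_mono) auto
      finally have "\<bar>\<Phi> v i - \<Phi> w i\<bar> \<le> (C - 1) * (\<epsilon> / C) + B * ((b - a) * I k)"
        by (simp add: C_def algebra_simps)
      moreover have "\<bar>\<Phi> w i - coords x i\<bar> \<le> \<epsilon> / C" using y(2) w(2) i by (auto intro: less_imp_le)
      moreover have "(C - 1) * (\<epsilon> / C) + \<epsilon> / C = \<epsilon>" using C by (simp add: field_simps)
      ultimately show "\<bar>\<Phi> v i - coords x i\<bar> \<le> B * ((b - a) * I k) + \<epsilon>" by linarith
    qed
    moreover have "(\<lambda>k. B * ((b - a) * I k)) \<longlonglongrightarrow> B * ((b - a) * 0)"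
      unfolding I_def by (intro tendsto_intros integral_small_values_tendsto_0 contQ finQ)
    ultimately have "\<bar>\<Phi> v i - coords x i\<bar> \<le> 0"
      using LIMSEQ_le_const by fastforce
    then show ?thesis using cx[OF i] by simp
  qed
  have "\<exists>e \<tau>. (e = 1 \<or> e = - 1) \<and> (\<forall>j. ((\<lambda>s. s ^ j * sgn (poly P s)) has_integral
    e / real (Suc j) * ((- 1) ^ (n - 1) * t ^ Suc j + 2 * (\<Sum>q=1..n - 1. (- 1) ^ (q + 1) * \<tau> q ^ Suc j))) {0..t})"
  proof (rule has_integral_sgn_switches[OF t contP])
    have sub: "{s. 0 < s \<and> s < t \<and> poly P s = 0} \<subseteq> {s. poly P s = 0}" by auto
    show "finite {s. 0 < s \<and> s < t \<and> poly P s = 0}" by (rule finite_subset[OF sub roots(1)])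
    show "card {s. 0 < s \<and> s < t \<and> poly P s = 0} \<le> n - 1"
      using card_mono[OF roots(1) sub] roots(2) by (rule order_trans)
  qed
  then obtain e \<tau> where e: "e = 1 \<or> e = - 1" and sw: "\<And>j. ((\<lambda>s. s ^ j * sgn (poly P s)) has_integral
    e / real (Suc j) * ((- 1) ^ (n - 1) * t ^ Suc j + 2 * (\<Sum>q=1..n - 1. (- 1) ^ (q + 1) * \<tau> q ^ Suc j))) {0..t}"
    by blast
  have "vec_index x i = free_motion n t y0 (Suc i) +
    midpoint a b * t ^ (n - i) / fact (n - i) + e * (half_width a b / fact (n - i)) *
    ((- 1) ^ (n - 1) * t ^ (n - i) + 2 * (\<Sum>q=1..n - 1. (- 1) ^ (q + 1) * \<tau> q ^ (n - i)))" if i: "i < n" for i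
  proof -
    define p where "p = n - Suc i"
    have p: "n - i = Suc p" using i by (simp add: p_def)
    define S where "S = (- 1) ^ (n - 1) * t ^ Suc p + 2 * (\<Sum>q=1..n - 1. (- 1) ^ (q + 1) * \<tau> q ^ Suc p)"
    have "((\<lambda>s. s ^ p) has_integral (t ^ Suc p / real (Suc p))) {0..t}"
    proof -
      have "((\<lambda>s. s ^ p) has_integral (t ^ Suc p / real (Suc p) - 0 ^ Suc p / real (Suc p))) {0..t}"
      proof (rule fundamental_theorem_of_calculus[OF t])
        fix s
        have "((\<lambda>s. s ^ Suc p / real (Suc p)) has_real_derivative s ^ p) (at s within {0..t})"
          by (auto intro!: derivative_eq_intros simp del: power_Suc of_nat_Suc)
        then show "((\<lambda>s. s ^ Suc p / real (Suc p)) has_vector_derivative s ^ p) (at s within {0..t})"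
          by (simp add: has_real_derivative_iff_has_vector_derivative)
      qed
      then show ?thesis by simp
    qed
    \<comment> \<open>The moments of the sign were computed for \<open>P\<close>. Reversing time
      turns them into integrals against the kernel, so the \<open>\<tau>\<close> are times counted
      backwards from \<open>t\<close>.\<close>
    from has_integral_reverse[OF this t] has_integral_reverse[OF sw[of p] t]
    have "((\<lambda>s. midpoint a b / fact p * (t - s) ^ p + half_width a b / fact p * ((t - s) ^ p * sgn (Q s))) has_integral
      (midpoint a b / fact p * (t ^ Suc p / real (Suc p)) + half_width a b / fact p * (e / real (Suc p) * S))) {0..t}"
      unfolding Q_def S_def by (intro has_integral_add has_integral_mult_right)
    moreover have "midpoint a b / fact p * (t - s) ^ p + half_width a b / fact p * ((t - s) ^ p * sgn (Q s)) = K i s * v s" for s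
      by (simp add: K_def v_def p_def algebra_simps add_divide_distrib)
    ultimately have "integral {0..t} (\<lambda>s. K i s * v s) =
        midpoint a b / fact p * (t ^ Suc p / real (Suc p)) + half_width a b / fact p * (e / real (Suc p) * S)"
      by (simp add: integral_unique)
    also have "\<dots> = midpoint a b * t ^ Suc p / fact (Suc p) + e * (half_width a b / fact (Suc p)) * S"
      by (simp add: mult_ac)
    finally show ?thesis unfolding x_eq[OF i] \<Phi>_def p S_def by simp
  qed
  with e show ?thesis by blast
qed

section \<open>The product of the single-input reach sets\<close>

lemma sum_blocks:
  fixes f :: "nat \<Rightarrow> 'a :: comm_monoid_add" and r :: "nat \<Rightarrow> nat"
  shows "(\<Sum>p<(\<Sum>j<m. r j). f p) = (\<Sum>j<m. \<Sum>i<r j. f ((\<Sum>j'<j. r j') + i))"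
proof (induction m)
  case (Suc m)
  have "(\<Sum>p<(\<Sum>j<Suc m. r j). f p) = (\<Sum>p = 0..<(\<Sum>j<m. r j) + r m. f p)"
    by (simp add: lessThan_atLeast0)
  also have "\<dots> = (\<Sum>p = 0..<(\<Sum>j<m. r j). f p) + (\<Sum>p = (\<Sum>j<m. r j)..<(\<Sum>j<m. r j) + r m. f p)"
    by (rule sum.atLeastLessThan_concat[symmetric]) auto
  also have "(\<Sum>p = (\<Sum>j<m. r j)..<(\<Sum>j<m. r j) + r m. f p) = (\<Sum>i<r m. f ((\<Sum>j<m. r j) + i))"
    using sum.shift_bounds_nat_ivl[of f 0 "\<Sum>j<m. r j" "r m"]
    by (simp add: lessThan_atLeast0 add.commute)
  finally show ?case using Suc by (simp add: lessThan_atLeast0)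
qed simp

lemma block_index_less:
  fixes r :: "nat \<Rightarrow> nat"
  assumes "j < m" "i < r j"
  shows "(\<Sum>j'<j. r j') + i < (\<Sum>j<m. r j :: nat)"
proof -
  have "(\<Sum>j'<j. r j') + i < (\<Sum>j'<Suc j. r j')" using assms by simp
  also have "\<dots> \<le> (\<Sum>j<m. r j)" using assms by (intro sum_mono2) auto
  finally show ?thesis .
qed

lemma block_index_exists:
  fixes r :: "nat \<Rightarrow> nat"
  assumes "p < (\<Sum>j<m. r j)"
  shows "\<exists>j i. j < m \<and> i < r j \<and> p = (\<Sum>j'<j. r j') + i"
  using assms
proof (induction m)
  case (Suc m)
  show ?case
  proof (cases "p < (\<Sum>j<m. r j)")
    case True
    then show ?thesis using Suc.IH less_SucI by blast
  next
    case False
    then show ?thesis using Suc.prems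
      by (intro exI[of _ m] exI[of _ "p - (\<Sum>j<m. r j)"]) auto
  qed
qed simp

lemma block_index_unique:
  fixes r :: "nat \<Rightarrow> nat"
  assumes "i < r j" "i' < r j'" "(\<Sum>l<j. r l) + i = (\<Sum>l<j'. r l) + i'"
  shows "j = j' \<and> i = i'"
proof -
  have less: False if "j < j'" "i < r j" "(\<Sum>l<j. r l) + i = (\<Sum>l<j'. r l) + i'" for j j' i i'
    using block_index_less[of j j' i r] that by simp
  have "j = j'" using less[of j j' i i'] less[of j' j i' i] assms by (cases j j' rule: linorder_cases) auto
  then show ?thesis using assms(3) by simp
qed

lemma dim_diag_block_map:
  "dim_row (diag_block_mat (map A [0..<m])) = (\<Sum>j<m. dim_row (A j))"
  "dim_col (diag_block_mat (map A [0..<m])) = (\<Sum>j<m. dim_col (A j))"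
  by (induction m) (simp_all add: diag_block_mat_last Let_def)

lemma diag_block_mat_index:
  fixes A :: "nat \<Rightarrow> 'a :: zero mat"
  assumes "j < m" "i < dim_row (A j)" "j' < m" "i' < dim_col (A j')"
  shows "diag_block_mat (map A [0..<m]) $$ ((\<Sum>l<j. dim_row (A l)) + i, (\<Sum>l<j'. dim_col (A l)) + i') =
    (if j = j' then A j $$ (i, i') else 0)"
  using assms
proof (induction m)
  case (Suc m)
  let ?D = "diag_block_mat (map A [0..<m])"
  have D: "dim_row ?D = (\<Sum>l<m. dim_row (A l))" "dim_col ?D = (\<Sum>l<m. dim_col (A l))"
    by (rule dim_diag_block_map)+
  have split: "diag_block_mat (map A [0..<Suc m]) =
      four_block_mat ?D (0\<^sub>m (dim_row ?D) (dim_col (A m))) (0\<^sub>m (dim_row (A m)) (dim_col ?D)) (A m)"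
    by (simp add: diag_block_mat_last Let_def)
  have r: "(\<Sum>l<j. dim_row (A l)) + i < dim_row ?D" if "j < m"
    unfolding D using that Suc.prems by (intro block_index_less)
  have c: "(\<Sum>l<j'. dim_col (A l)) + i' < dim_col ?D" if "j' < m"
    unfolding D using that Suc.prems by (intro block_index_less)
  have cases: "j < m \<or> j = m" "j' < m \<or> j' = m" using Suc.prems by auto
  then show ?case
    unfolding split using Suc.prems Suc.IH r c
    by (elim disjE) (auto simp: D)
qed simp

lemma diag_block_mat_mult_vec:
  fixes A :: "nat \<Rightarrow> real mat"
  assumes "j < m" "i < dim_row (A j)" "x \<in> carrier_vec (\<Sum>l<m. dim_col (A l))"
  shows "vec_index (diag_block_mat (map A [0..<m]) *\<^sub>v x) ((\<Sum>l<j. dim_row (A l)) + i) =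
    vec_index (A j *\<^sub>v vec (dim_col (A j)) (\<lambda>l. vec_index x ((\<Sum>l<j. dim_col (A l)) + l))) i"
proof -
  let ?D = "diag_block_mat (map A [0..<m])"
  let ?p = "(\<Sum>l<j. dim_row (A l)) + i"
  have p: "?p < dim_row ?D" unfolding dim_diag_block_map using assms by (intro block_index_less)
  have "vec_index (?D *\<^sub>v x) ?p = (\<Sum>q<(\<Sum>l<m. dim_col (A l)). ?D $$ (?p, q) * vec_index x q)"
    using p assms(3) by (simp add: scalar_prod_def dim_diag_block_map lessThan_atLeast0)
  also have "\<dots> = (\<Sum>j'<m. \<Sum>i'<dim_col (A j'). ?D $$ (?p, (\<Sum>l<j'. dim_col (A l)) + i') * vec_index x ((\<Sum>l<j'. dim_col (A l)) + i'))"
    by (rule sum_blocks)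
  also have "\<dots> = (\<Sum>j'<m. if j' = j then (\<Sum>i'<dim_col (A j). A j $$ (i, i') * vec_index x ((\<Sum>l<j. dim_col (A l)) + i')) else 0)"
    by (intro sum.cong refl) (use assms in \<open>auto simp: diag_block_mat_index\<close>)
  also have "\<dots> = (\<Sum>i'<dim_col (A j). A j $$ (i, i') * vec_index x ((\<Sum>l<j. dim_col (A l)) + i'))"
    using assms(1) by simp
  finally show ?thesis using assms(2) by (simp add: scalar_prod_def lessThan_atLeast0)
qed

lemma integrator_dynamics_index:
  fixes r :: "nat \<Rightarrow> nat" and m :: nat
  defines "A \<equiv> diag_block_mat (map (\<lambda>j. chain_A (r j)) [0..<m])"
    and "B \<equiv> diag_block_mat (map (\<lambda>j. chain_b (r j)) [0..<m])"
  shows "dim_row A = (\<Sum>j<m. r j)" "dim_row B = (\<Sum>j<m. r j)" "dim_col B = m"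
    and "\<And>X u j i. j < m \<Longrightarrow> i < r j \<Longrightarrow> X \<in> carrier_vec (\<Sum>j<m. r j) \<Longrightarrow> u \<in> carrier_vec m \<Longrightarrow>
      vec_index (A *\<^sub>v X + B *\<^sub>v u) ((\<Sum>l<j. r l) + i) =
        (if Suc i < r j then vec_index X ((\<Sum>l<j. r l) + Suc i) else vec_index u j)"
proof -
  have dA: "dim_row (chain_A k) = k" "dim_col (chain_A k) = k" for k by (simp_all add: chain_A_def)
  have dB: "dim_row (chain_b k) = k" "dim_col (chain_b k) = 1" for k by (simp_all add: chain_b_def)
  show dims: "dim_row A = (\<Sum>j<m. r j)" "dim_row B = (\<Sum>j<m. r j)" "dim_col B = m"
    by (simp_all add: A_def B_def dim_diag_block_map dA dB)
  fix X u :: "real vec" and j i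
  assume j: "j < m" and i: "i < r j" and X: "X \<in> carrier_vec (\<Sum>j<m. r j)" and u: "u \<in> carrier_vec m"
  let ?p = "(\<Sum>l<j. r l) + i"
  have p: "?p < (\<Sum>j<m. r j)" using j i by (rule block_index_less)
  have "vec_index (A *\<^sub>v X) ?p = vec_index (chain_A (r j) *\<^sub>v vec (r j) (\<lambda>l. vec_index X ((\<Sum>l<j. r l) + l))) i"
    using diag_block_mat_mult_vec[of j m i "\<lambda>j. chain_A (r j)" X] j i X by (simp add: A_def dA)
  also have "\<dots> = (if Suc i < r j then vec_index X ((\<Sum>l<j. r l) + Suc i) else 0)"
    using i by (subst chain_A_mult) auto
  finally have 1: "vec_index (A *\<^sub>v X) ?p = (if Suc i < r j then vec_index X ((\<Sum>l<j. r l) + Suc i) else 0)" .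
  have "vec_index (B *\<^sub>v u) ?p = vec_index (chain_b (r j) *\<^sub>v vec 1 (\<lambda>l. vec_index u (j + l))) i"
    using diag_block_mat_mult_vec[of j m i "\<lambda>j. chain_b (r j)" u] j i u by (simp add: B_def dB)
  also have "\<dots> = (if Suc i < r j then 0 else vec_index u j)"
    using i by (subst chain_b_mult) auto
  finally have 2: "vec_index (B *\<^sub>v u) ?p = (if Suc i < r j then 0 else vec_index u j)" .
  show "vec_index (A *\<^sub>v X + B *\<^sub>v u) ?p = (if Suc i < r j then vec_index X ((\<Sum>l<j. r l) + Suc i) else vec_index u j)"
    using p dims 1 2 by simp
qed

text \<open>The blocks are decoupled, and block j is driven by input j alone. A trajectory restricts
  to the blocks, and conversely finitely many block trajectories and controls are stacked.\<close>

lemma integrator_reach_set_product: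
  assumes t: "0 \<le> t"
  shows "integrator_reach_set m r \<alpha> \<beta> x0 t =
    {x \<in> carrier_vec (\<Sum>j<m. r j).
       \<forall>j<m. block r j x \<in> single_input_reach_set (r j) (\<alpha> j) (\<beta> j) (block r j x0) t}"
proof -
  define A where "A = diag_block_mat (map (\<lambda>j. chain_A (r j)) [0..<m])"
  define B where "B = diag_block_mat (map (\<lambda>j. chain_b (r j)) [0..<m])"
  note dims = integrator_dynamics_index(1-3)[of r m, folded A_def B_def]
  note dyn = integrator_dynamics_index(4)[of _ m _ r, folded A_def B_def]
  let ?d = "\<Sum>j<m. r j"
  let ?o = "\<lambda>j. \<Sum>l<j. r l"
  have blk: "vec_index (block r j x) i = vec_index x (?o j + i)" if "i < r j" for j i x
    using that by (simp add: block_def)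
  show ?thesis
  proof (rule Set.set_eqI, rule iffI)
    fix x assume "x \<in> integrator_reach_set m r \<alpha> \<beta> x0 t"
    then obtain X u where x: "x = X t" and X: "\<And>s. s \<in> {0..t} \<Longrightarrow> X s \<in> carrier_vec ?d"
      and u: "\<And>s. s \<in> {0..t} \<Longrightarrow> u s \<in> input_box m \<alpha> \<beta>"
      and meas: "\<And>j. j < m \<Longrightarrow> (\<lambda>s. vec_index (u s) j) \<in> borel_measurable (lebesgue_on {0..t})"
      and ode: "\<And>p T. p < ?d \<Longrightarrow> T \<in> {0..t} \<Longrightarrow> ((\<lambda>s. vec_index (A *\<^sub>v X s + B *\<^sub>v u s) p)
          has_integral (vec_index (X T) p - vec_index x0 p)) {0..T}"
      unfolding integrator_reach_set_def reach_set_def A_def[symmetric] B_def[symmetric] dims by blast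
    have "block r j x \<in> single_input_reach_set (r j) (\<alpha> j) (\<beta> j) (block r j x0) t" if j: "j < m" for j
      unfolding single_input_reach_set_iff_trajectory[OF t]
    proof (intro conjI exI[of _ "\<lambda>i s. vec_index (X s) (?o j + i)"] exI[of _ "\<lambda>s. vec_index (u s) j"] allI impI ballI)
      show "block r j x \<in> carrier_vec (r j)" by (simp add: block_def)
      show "control (\<alpha> j) (\<beta> j) t (\<lambda>s. vec_index (u s) j)"
        using u meas j by (auto simp: control_def input_box_def)
      fix i assume i: "i < r j"
      show "vec_index (X t) (?o j + i) = vec_index (block r j x) i" using i by (simp add: blk x)
      fix T assume T: "T \<in> {0..t}"
      show "((\<lambda>s. if Suc i < r j then vec_index (X s) (?o j + Suc i) else vec_index (u s) j) has_integral
          (vec_index (X T) (?o j + i) - vec_index (block r j x0) i)) {0..T}"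
        unfolding blk[OF i]
      proof (rule has_integral_eq[OF _ ode[OF block_index_less[of j m i r, OF j i] T]])
        fix s assume "s \<in> {0..T}"
        then have s: "s \<in> {0..t}" using T by auto
        then have "u s \<in> carrier_vec m" using u by (auto simp: input_box_def)
        then show "vec_index (A *\<^sub>v X s + B *\<^sub>v u s) (?o j + i) =
            (if Suc i < r j then vec_index (X s) (?o j + Suc i) else vec_index (u s) j)"
          using dyn[OF j i X[OF s]] by blast
      qed
    qed
    then show "x \<in> {x \<in> carrier_vec ?d. \<forall>j<m. block r j x \<in> single_input_reach_set (r j) (\<alpha> j) (\<beta> j) (block r j x0) t}"
      using x X t by auto
  next
    fix x assume "x \<in> {x \<in> carrier_vec ?d. \<forall>j<m. block r j x \<in> single_input_reach_set (r j) (\<alpha> j) (\<beta> j) (block r j x0) t}"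
    then have x: "x \<in> carrier_vec ?d"
      and "\<forall>j\<in>{..<m}. \<exists>\<xi> w. control (\<alpha> j) (\<beta> j) t w \<and>
        (\<forall>i<r j. \<forall>T\<in>{0..t}. ((\<lambda>s. if Suc i < r j then \<xi> (Suc i) s else w s) has_integral (\<xi> i T - vec_index (block r j x0) i)) {0..T}) \<and>
        (\<forall>i<r j. \<xi> i t = vec_index (block r j x) i)"
      unfolding single_input_reach_set_iff_trajectory[OF t] by auto
    then obtain \<xi> w where traj: "\<forall>j\<in>{..<m}. control (\<alpha> j) (\<beta> j) t (w j) \<and>
        (\<forall>i<r j. \<forall>T\<in>{0..t}. ((\<lambda>s. if Suc i < r j then \<xi> j (Suc i) s else w j s) has_integral (\<xi> j i T - vec_index (block r j x0) i)) {0..T}) \<and>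
        (\<forall>i<r j. \<xi> j i t = vec_index (block r j x) i)"
      unfolding bchoice_iff by blast
    have w: "control (\<alpha> j) (\<beta> j) t (w j)" if "j < m" for j
      using traj that by blast
    have ode: "((\<lambda>s. if Suc i < r j then \<xi> j (Suc i) s else w j s) has_integral (\<xi> j i T - vec_index (block r j x0) i)) {0..T}"
      if "j < m" "i < r j" "T \<in> {0..t}" for j i T
      using traj that by blast
    have fin: "\<xi> j i t = vec_index (block r j x) i" if "j < m" "i < r j" for j i
      using traj that by blast
    \<comment> \<open>Decodes a global index into block and position;
      \<open>block_index_unique\<close> makes the description definite.\<close>
    define J where "J p = (THE ji. fst ji < m \<and> snd ji < r (fst ji) \<and> p = ?o (fst ji) + snd ji)" for p
    have J: "J (?o j + i) = (j, i)" if "j < m" "i < r j" for j i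
      unfolding J_def by (rule the_equality) (use that block_index_unique[of _ r] in \<open>fastforce+\<close>)
    define X where "X s = vec ?d (\<lambda>p. \<xi> (fst (J p)) (snd (J p)) s)" for s
    define u where "u s = vec m (\<lambda>j. w j s)" for s
    have X: "vec_index (X s) (?o j + i) = \<xi> j i s" if "j < m" "i < r j" for j i s
      using block_index_less[of j m i r, OF that] by (simp add: X_def J that)
    have Xt: "X t = x"
    proof (rule eq_vecI)
      fix p assume "p < dim_vec x"
      then have "p < ?d" using x by simp
      then obtain j i where ji: "j < m" "i < r j" "p = ?o j + i" using block_index_exists by blast
      show "vec_index (X t) p = vec_index x p"
        unfolding ji(3) X[OF ji(1,2)] fin[OF ji(1,2)] blk[OF ji(2)] ..
    qed (use x in \<open>simp add: X_def\<close>)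
    show "x \<in> integrator_reach_set m r \<alpha> \<beta> x0 t"
      unfolding integrator_reach_set_def reach_set_def A_def[symmetric] B_def[symmetric] dims mem_Collect_eq
    proof (rule exI[of _ X], rule exI[of _ u], intro conjI ballI allI impI)
      show "x = X t" by (simp add: Xt)
      show "X s \<in> carrier_vec ?d" for s by (simp add: X_def)
      show "u s \<in> input_box m \<alpha> \<beta>" if "s \<in> {0..t}" for s
        using w that by (auto simp: u_def input_box_def control_def)
      show "(\<lambda>s. vec_index (u s) j) \<in> borel_measurable (lebesgue_on {0..t})" if "j < m" for j
        using w[OF that] that by (simp add: u_def control_def)
      fix p T assume "p < ?d" and T: "T \<in> {0..t}"
      then obtain j i where ji: "j < m" "i < r j" "p = ?o j + i" using block_index_exists by blast
      show "((\<lambda>s. vec_index (A *\<^sub>v X s + B *\<^sub>v u s) p) has_integral (vec_index (X T) p - vec_index x0 p)) {0..T}"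
        unfolding ji(3) X[OF ji(1,2)] blk[OF ji(2), of x0, symmetric]
      proof (rule has_integral_eq[OF _ ode[OF ji(1,2) T]])
        fix s
        have "X s \<in> carrier_vec ?d" "u s \<in> carrier_vec m" by (auto simp: X_def u_def)
        from dyn[OF ji(1,2) this] show "(if Suc i < r j then \<xi> j (Suc i) s else w j s) =
            vec_index (A *\<^sub>v X s + B *\<^sub>v u s) (?o j + i)"
          using ji(1) X[of j "Suc i" s] by (simp add: u_def)
      qed
    qed
  qed
qed

section \<open>The bounding hypersurfaces\<close>

text \<open>The sign \<open>e\<close> of the bang-bang control selects the branch, and its switching
  times become the parameters. An implicit polynomial vanishes at every real parameter value, in
  particular at these.\<close>

lemma vec_boundary_subset_implicit:
  assumes n: "1 \<le> n" and ab: "a < b" and t: "0 \<le> t"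
    and upper: "implicit_polynomial Upper n a b t y0 p_upper"
    and lower: "implicit_polynomial Lower n a b t y0 p_lower"
  shows "vec_boundary n (single_input_reach_set n a b y0 t) \<subseteq>
    {x. peval_vec p_upper x = 0 \<or> peval_vec p_lower x = 0}"
proof
  fix x assume "x \<in> vec_boundary n (single_input_reach_set n a b y0 t)"
  from vec_boundary_switching[OF n ab t this] obtain e \<tau> where e: "e = 1 \<or> e = - 1"
    and x: "\<And>i. i < n \<Longrightarrow> vec_index x i = free_motion n t y0 (Suc i) +
      midpoint a b * t ^ (n - i) / fact (n - i) + e * (half_width a b / fact (n - i)) *
      ((- 1) ^ (n - 1) * t ^ (n - i) + 2 * (\<Sum>q=1..n - 1. (- 1) ^ (q + 1) * \<tau> q ^ (n - i)))" by blast
  define \<sigma> where "\<sigma> = (if e = 1 then Upper else Lower)"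
  have \<sigma>: "pm \<sigma> = e" using e by (auto simp: \<sigma>_def)
  define \<omega> where "\<omega> i = \<tau> (i - n)" for i
  have point: "vec_index x (k - 1) = peval (boundary_param \<sigma> n a b t y0 k) \<omega>" if k: "k \<in> {1..n}" for k
  proof -
    have k': "k - 1 < n" "Suc (k - 1) = k" "n - (k - 1) = n - k + 1" using k by auto
    show ?thesis unfolding x[OF k'(1)] k'(2,3) boundary_param_def
      by (simp add: \<sigma> \<omega>_def del: One_nat_def)
  qed
  show "x \<in> {x. peval_vec p_upper x = 0 \<or> peval_vec p_lower x = 0}"
  proof (cases \<sigma>)
    case Upper
    then show ?thesis using implicit_polynomial_hankel(4)[OF n ab upper] point by blast
  next
    case Lower
    then show ?thesis using implicit_polynomial_hankel(4)[OF n ab lower] point by blast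
  qed
qed

theorem theorem4:
  fixes m :: nat and r :: "nat \<Rightarrow> nat" and \<alpha> \<beta> :: "nat \<Rightarrow> real"
    and x0 :: "real vec" and t :: real
  assumes "\<And>j. j < m \<Longrightarrow> 1 \<le> r j"
    and "\<And>j. j < m \<Longrightarrow> \<alpha> j < \<beta> j"
    and "x0 \<in> carrier_vec (\<Sum>j<m. r j)"
    and "0 \<le> t"
  shows "integrator_reach_set m r \<alpha> \<beta> x0 t =
      {x \<in> carrier_vec (\<Sum>j<m. r j).
         \<forall>j<m. block r j x \<in> single_input_reach_set (r j) (\<alpha> j) (\<beta> j) (block r j x0) t}
    \<and> (\<forall>j<m.
        (\<forall>\<sigma>. \<exists>p. implicit_polynomial \<sigma> (r j) (\<alpha> j) (\<beta> j) t (block r j x0) p) \<and>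
        (\<forall>p_upper p_lower.
           implicit_polynomial Upper (r j) (\<alpha> j) (\<beta> j) t (block r j x0) p_upper \<and>
           implicit_polynomial Lower (r j) (\<alpha> j) (\<beta> j) t (block r j x0) p_lower \<longrightarrow>
             vec_boundary (r j) (single_input_reach_set (r j) (\<alpha> j) (\<beta> j) (block r j x0) t)
               \<subseteq> {x. peval_vec p_upper x = 0 \<or> peval_vec p_lower x = 0} \<and>
             pdegree p_upper = (delta (r j) + 1) * (r j - delta (r j)) \<and>
             pdegree p_lower = (delta (r j) + 1) * (r j - delta (r j)) \<and>
             (\<exists>c. c \<noteq> 0 \<and> (\<forall>x\<in>carrier_vec (r j).
                peval_vec p_upper x
                  = c * hankel_det Upper (r j) (\<alpha> j) (\<beta> j) t (block r j x0) x)) \<and>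
             (\<exists>c. c \<noteq> 0 \<and> (\<forall>x\<in>carrier_vec (r j).
                peval_vec p_lower x
                  = c * hankel_det Lower (r j) (\<alpha> j) (\<beta> j) t (block r j x0) x))))"
proof (intro conjI allI impI)
  show "integrator_reach_set m r \<alpha> \<beta> x0 t =
      {x \<in> carrier_vec (\<Sum>j<m. r j).
         \<forall>j<m. block r j x \<in> single_input_reach_set (r j) (\<alpha> j) (\<beta> j) (block r j x0) t}"
    using assms(4) by (rule integrator_reach_set_product)
next
  fix j \<sigma> assume "j < m"
  then show "\<exists>p. implicit_polynomial \<sigma> (r j) (\<alpha> j) (\<beta> j) t (block r j x0) p"
    by (intro implicit_polynomial_hankel(1) assms(1,2))
next
  fix j p_upper p_lower
  assume j: "j < m"
    and p: "implicit_polynomial Upper (r j) (\<alpha> j) (\<beta> j) t (block r j x0) p_upper \<and>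
      implicit_polynomial Lower (r j) (\<alpha> j) (\<beta> j) t (block r j x0) p_lower"
  note upper = conjunct1[OF p] and lower = conjunct2[OF p]
  note hankel = implicit_polynomial_hankel[OF assms(1)[OF j] assms(2)[OF j]]
  show "vec_boundary (r j) (single_input_reach_set (r j) (\<alpha> j) (\<beta> j) (block r j x0) t)
      \<subseteq> {x. peval_vec p_upper x = 0 \<or> peval_vec p_lower x = 0}"
    by (rule vec_boundary_subset_implicit[OF assms(1)[OF j] assms(2)[OF j] assms(4) upper lower])
  show "pdegree p_upper = (delta (r j) + 1) * (r j - delta (r j))" by (rule hankel(2)[OF upper])
  show "pdegree p_lower = (delta (r j) + 1) * (r j - delta (r j))" by (rule hankel(2)[OF lower])
  show "\<exists>c. c \<noteq> 0 \<and> (\<forall>x\<in>carrier_vec (r j). peval_vec p_upper x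
      = c * hankel_det Upper (r j) (\<alpha> j) (\<beta> j) t (block r j x0) x)" by (rule hankel(3)[OF upper])
  show "\<exists>c. c \<noteq> 0 \<and> (\<forall>x\<in>carrier_vec (r j). peval_vec p_lower x
      = c * hankel_det Lower (r j) (\<alpha> j) (\<beta> j) t (block r j x0) x)" by (rule hankel(3)[OF lower])
qed

end
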